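(* There exists a polynomial $H\in\mathcal R=\mathbb C[t_1,\dots,t_4,d_1,\dots,d_4,\Lambda]$ such that: (1) the extended spectra $(t_1,\dots,t_4;d_1,\dots,d_4;\lambda_1,\lambda_2,\lambda_3)$ of any quadratic vector field in $\mathcal V_2$ satisfies $$H(t_1,\dots,t_4;d_1,\dots,d_4;\Lambda)=0,\qquad \Lambda=\lambda_1\lambda_2\lambda_3;$$ (2) the equality $H(t;d;\lambda_1\lambda_2\lambda_3)=0$ is independent from the relations (EJ1), (EJ2), (BB), (CS); (3) if $F\in\mathbb C[t_1,\dots,t_4,d_1,\dots,d_4,\lambda_1,\lambda_2,\lambda_3]$ is another polynomial vanishing on the extended spectra of every vector field in $\mathcal V_2$, then $F=0$ follows from $H(t;d;\lambda_1\lambda_2\lambda_3)=0$ together with the equalities (EJ1), (EJ2), (BB), (CS) and the inequalities $d_k\ne0$ ($k=1,\dots,4$) and $\lambda_j\neq 0$ ($j=1,2,3$).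
   Context: A quadratic vector field on $\mathbb C^2$ is $v=P\,\partial_x+Q\,\partial_y$ with $P,Q\in\mathbb C[x,y]$ of degree at most $2$; let $P_2,Q_2$ be the homogeneous parts of degree $2$. $\mathcal V_2$ is the space of all quadratic vector fields $v$ having exactly $4$ isolated singularities $p_1,\dots,p_4\in\mathbb C^2$ and such that the extension $\mathcal F_v$ of the foliation to $\mathbb P^2$ has an invariant line at infinity $\mathcal L=\mathbb P^2\setminus\mathbb C^2$ carrying exactly $3$ singular points (i.e. $yP_2-xQ_2$ is a nonzero cubic form with three distinct zeros in $\mathbb P^1$). Both the finite and the infinite singularities are assumed to be enumerated. Extended spectra: $t_k=\operatorname{tr}Dv(p_k)$, $d_k=\det Dv(p_k)$ for $k=1,\dots,4$, where $Dv$ is the Jacobian matrix of $(P,Q)$, together with the characteristic numbers at infinity $\lambda_1,\lambda_2,\lambda_3$. The latter are the Camacho-Sad indices of $\mathcal F_v$ along $\mathcal L$: in the coordinates $z=1/x$, $w=y/x$ the foliation is given by $\frac{dz}{dw}=z\sum_{j=1}^3\frac{\lambda_j}{w-w_j}+O(z^2)$, where $w_j$ are the singular points on $\mathcal L=\{z=0\}$; if a singular point at infinity lies in the direction $x=0$, one first applies a linear change of coordinates, on which the $\lambda_j$ do not depend. For $v\in\mathcal V_2$ all $d_k$ and $\lambda_j$ are nonzero. The four classical relations are (EJ1) $\sum_{k=1}^4 \frac1{d_k}=0$; (EJ2) $\sum_{k=1}^4\frac{t_k}{d_k}=0$; (BB) $\sum_{k=1}^4\frac{t_k^2}{d_k}+\sum_{j=1}^3\frac{(\lambda_j+1)^2}{\lambda_j}=16$;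 (CS) $\lambda_1+\lambda_2+\lambda_3=1$. "Independent" means that the equality is not a consequence of the four relations: there is a tuple $(t;d;\lambda)\in\mathbb C^{11}$ with all $d_k,\lambda_j\ne0$ satisfying (EJ1), (EJ2), (BB), (CS) at which it fails. "$F=0$ follows from" a list of conditions means that $F$ vanishes at every point $(t;d;\lambda)\in\mathbb C^{11}$ satisfying all of them. *)

theory Defs
  imports "HOL-Analysis.Analysis" "HOL-Library.Poly_Mapping" "HOL-Library.Landau_Symbols"
begin

section \<open>Polynomials in several variables\<close>

text \<open>A polynomial with variables indexed by \<open>'i\<close> is a finitely supported family of coefficients
  indexed by monomials, a monomial being a finitely supported family of exponents.\<close>

type_synonym ('i, 'a) mpoly = "('i \<Rightarrow>\<^sub>0 nat) \<Rightarrow>\<^sub>0 'a"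

definition mpoly_eval :: "('i, 'a::comm_semiring_1) mpoly \<Rightarrow> ('i \<Rightarrow> 'a) \<Rightarrow> 'a" where
  "mpoly_eval p x = (\<Sum>m\<in>Poly_Mapping.keys p. Poly_Mapping.lookup p m *
     (\<Prod>i\<in>Poly_Mapping.keys m. x i ^ Poly_Mapping.lookup m i))"

definition mon_degree :: "('i \<Rightarrow>\<^sub>0 nat) \<Rightarrow> nat" where
  "mon_degree m = (\<Sum>i\<in>Poly_Mapping.keys m. Poly_Mapping.lookup m i)"

definition total_degree_le :: "nat \<Rightarrow> ('i, 'a::zero) mpoly \<Rightarrow> bool" where
  "total_degree_le n p \<longleftrightarrow> (\<forall>m\<in>Poly_Mapping.keys p. mon_degree m \<le> n)"

definition hom_part :: "nat \<Rightarrow> ('i, 'a::comm_monoid_add) mpoly \<Rightarrow> ('i, 'a) mpoly" where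
  "hom_part n p = (\<Sum>m\<in>{m\<in>Poly_Mapping.keys p. mon_degree m = n}.
     Poly_Mapping.single m (Poly_Mapping.lookup p m))"


section \<open>Quadratic vector fields\<close>

text \<open>The pair \<open>(P, Q)\<close> stands for \<open>P \<partial>/\<partial>x + Q \<partial>/\<partial>y\<close>. The variables
  \<open>x\<close>, \<open>y\<close> are indexed by \<open>1, 2 :: 2\<close>, so a point of \<open>\<complex>\<^sup>2\<close> is a vector \<open>u :: complex^2\<close>
  with \<open>x = u $ 1\<close>, \<open>y = u $ 2\<close>.\<close>

type_synonym vfield = "(2, complex) mpoly \<times> (2, complex) mpoly"

definition quadratic :: "vfield \<Rightarrow> bool" where
  "quadratic v \<longleftrightarrow> total_degree_le 2 (fst v) \<and> total_degree_le 2 (snd v)"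

definition vf_at :: "vfield \<Rightarrow> complex^2 \<Rightarrow> complex^2" where
  "vf_at v u = vector [mpoly_eval (fst v) (($) u), mpoly_eval (snd v) (($) u)]"

definition vf_jacobian :: "vfield \<Rightarrow> complex^2 \<Rightarrow> complex^2^2" where
  "vf_jacobian v u = (\<chi> i j. deriv (\<lambda>s. vf_at v (u + axis j s) $ i) 0)"

definition sing :: "vfield \<Rightarrow> (complex^2) set" where
  "sing v = {u. vf_at v u = 0}"

text \<open>The cubic form \<open>y P\<^sub>2 - x Q\<^sub>2\<close>. Points of the line at infinity are directions in
  \<open>\<complex>\<^sup>2\<close>, i.e. one-dimensional subspaces of \<open>complex^2\<close>.\<close>

definition inf_form :: "vfield \<Rightarrow> complex^2 \<Rightarrow> complex" where
  "inf_form v u = u $ 2 * mpoly_eval (hom_part 2 (fst v)) (($) u)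
                - u $ 1 * mpoly_eval (hom_part 2 (snd v)) (($) u)"

definition inf_sing :: "vfield \<Rightarrow> (complex^2) set set" where
  "inf_sing v = {vec.span {u} | u. u \<noteq> 0 \<and> inf_form v u = 0}"

text \<open>The singularities are isolated since there are finitely many of them.\<close>

definition V2 :: "vfield set" where
  "V2 = {v. quadratic v \<and> card (sing v) = 4 \<and>
            (\<exists>u. inf_form v u \<noteq> 0) \<and> card (inf_sing v) = 3}"


section \<open>Characteristic numbers at infinity and extended spectra\<close>

text \<open>Along a solution, \<open>z = 1/x\<close> and \<open>w = y/x\<close> satisfy
  \<open>z' = - z\<^sup>2 P(1/z, w/z)\<close> and \<open>w' = z Q(1/z, w/z) - w z P(1/z, w/z)\<close>; the slope is their quotient.\<close>

definition slope_dz_dw :: "vfield \<Rightarrow> complex \<Rightarrow> complex \<Rightarrow> complex" where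
  "slope_dz_dw v z w =
    (let f = vf_at v (vector [1 / z, w / z])
     in (- (z^2) * f $ 1) / (z * f $ 2 - w * z * f $ 1))"

text \<open>\<open>v'\<close> is \<open>v\<close> in the linear coordinates \<open>u' = A u\<close>.\<close>

definition linear_change :: "complex^2^2 \<Rightarrow> vfield \<Rightarrow> vfield \<Rightarrow> bool" where
  "linear_change A v v' \<longleftrightarrow> invertible A \<and> (\<forall>u. vf_at v' (A *v u) = A *v vf_at v u)"

text \<open>\<open>q\<close> enumerates the singular points at infinity. After the coordinate change \<open>A\<close> (possibly the
  identity) the point \<open>q j\<close> has the direction \<open>(1 : w\<^sub>j)\<close>, so that none of the three points
  lies in the direction \<open>x = 0\<close>. The quantification over \<open>z\<close> is in the filter \<open>at 0\<close>, for each
  fixed \<open>w\<close> different from all \<open>w\<^sub>j\<close>.\<close>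

definition char_numbers :: "vfield \<Rightarrow> (3 \<Rightarrow> (complex^2) set) \<Rightarrow> complex^3 \<Rightarrow> bool" where
  "char_numbers v q l \<longleftrightarrow>
    (\<exists>A v' (w :: complex^3). linear_change A v v' \<and>
       (\<forall>j. (\<lambda>u. A *v u) ` q j = vec.span {vector [1, w $ j]}) \<and>
       (\<forall>\<omega>. (\<forall>j. \<omega> \<noteq> w $ j) \<longrightarrow>
          (\<lambda>z. slope_dz_dw v' z \<omega> - z * (\<Sum>j\<in>UNIV. l $ j / (\<omega> - w $ j))) \<in> O[at 0](\<lambda>z. z^2)))"

text \<open>\<open>(t; d; l)\<close> is the extended spectrum of \<open>v\<close> for some enumeration \<open>p\<close> of the finite and
  some enumeration \<open>q\<close> of the infinite singularities.\<close>

definition extended_spectrum ::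
  "vfield \<Rightarrow> complex^4 \<Rightarrow> complex^4 \<Rightarrow> complex^3 \<Rightarrow> bool" where
  "extended_spectrum v t d l \<longleftrightarrow>
    (\<exists>p q. bij_betw p (UNIV :: 4 set) (sing v) \<and> bij_betw q (UNIV :: 3 set) (inf_sing v) \<and>
       (\<forall>k. t $ k = trace (vf_jacobian v (p k))) \<and>
       (\<forall>k. d $ k = det (vf_jacobian v (p k))) \<and>
       char_numbers v q l)"


section \<open>Relations between the components of the spectra\<close>

definition EJ1 :: "complex^4 \<Rightarrow> bool" where
  "EJ1 d \<longleftrightarrow> (\<Sum>k\<in>UNIV. 1 / d $ k) = 0"

definition EJ2 :: "complex^4 \<Rightarrow> complex^4 \<Rightarrow> bool" where
  "EJ2 t d \<longleftrightarrow> (\<Sum>k\<in>UNIV. t $ k / d $ k) = 0"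

definition BB :: "complex^4 \<Rightarrow> complex^4 \<Rightarrow> complex^3 \<Rightarrow> bool" where
  "BB t d l \<longleftrightarrow> (\<Sum>k\<in>UNIV. (t $ k)^2 / d $ k) + (\<Sum>j\<in>UNIV. (l $ j + 1)^2 / l $ j) = 16"

definition CS :: "complex^3 \<Rightarrow> bool" where
  "CS l \<longleftrightarrow> (\<Sum>j\<in>UNIV. l $ j) = 1"

definition nonzero_dl :: "complex^4 \<Rightarrow> complex^3 \<Rightarrow> bool" where
  "nonzero_dl d l \<longleftrightarrow> (\<forall>k. d $ k \<noteq> 0) \<and> (\<forall>j. l $ j \<noteq> 0)"

definition classical_relations :: "complex^4 \<Rightarrow> complex^4 \<Rightarrow> complex^3 \<Rightarrow> bool" where
  "classical_relations t d l \<longleftrightarrow> EJ1 d \<and> EJ2 t d \<and> BB t d l \<and> CS l"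

text \<open>\<open>3 spec_var\<close> indexes the variables \<open>t\<^sub>1, \<dots>, t\<^sub>4, d\<^sub>1, \<dots>, d\<^sub>4, \<lambda>\<^sub>1, \<lambda>\<^sub>2, \<lambda>\<^sub>3\<close>, and
  \<open>1 spec_var\<close> indexes \<open>t\<^sub>1, \<dots>, t\<^sub>4, d\<^sub>1, \<dots>, d\<^sub>4, \<Lambda>\<close>.\<close>

datatype 'n spec_var = VarT 4 | VarD 4 | VarL 'n

definition spec_eval ::
  "('n spec_var, complex) mpoly \<Rightarrow> complex^4 \<Rightarrow> complex^4 \<Rightarrow> complex^'n \<Rightarrow> complex" where
  "spec_eval F t d l =
    mpoly_eval F (\<lambda>i. case i of VarT k \<Rightarrow> t $ k | VarD k \<Rightarrow> d $ k | VarL j \<Rightarrow> l $ j)"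

text \<open>The value \<open>H(t; d; \<lambda>\<^sub>1 \<lambda>\<^sub>2 \<lambda>\<^sub>3)\<close>.\<close>

definition eval_Lambda ::
  "(1 spec_var, complex) mpoly \<Rightarrow> complex^4 \<Rightarrow> complex^4 \<Rightarrow> complex^3 \<Rightarrow> complex" where
  "eval_Lambda H t d l = spec_eval H t d (vec (\<Prod>j\<in>UNIV. l $ j))"

end

theory Submission
  imports Defs "HOL-Complex_Analysis.Conformal_Mappings"
begin

text \<open>Write \<open>u\<^sub>k = 1 / d\<^sub>k\<close>. The Euler--Jacobi relations \<open>\<Sum>u\<^sub>k = 0\<close> and \<open>\<Sum>u\<^sub>k p\<^sub>k = 0\<close> place the
  finite singularities, after an affine change of coordinates, at \<open>(0, 0)\<close>, \<open>(1/u\<^sub>2, 0)\<close>, \<open>(0, 1/u\<^sub>3)\<close>,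
  \<open>(-1/u\<^sub>4, -1/u\<^sub>4)\<close>. The fields with these singularities are the invertible linear combinations of
  two conics, so they are given by a matrix with entries \<open>a\<close>, \<open>b\<close>, \<open>c\<close>, \<open>e\<close> and determinant
  \<open>1/u\<^sub>1\<close>, and the traces \<open>t\<^sub>k\<close> are linear in the matrix. At infinity, \<open>\<Lambda>\<close> times the discriminant
  of \<open>y P\<^sub>2 - x Q\<^sub>2\<close> is minus the resultant of \<open>P\<^sub>2\<close> and \<open>Q\<^sub>2\<close>, here \<open>u\<^sub>2 u\<^sub>3 u\<^sub>4 / u\<^sub>1\<close>.
  When none of the sums \<open>u\<^sub>2 + u\<^sub>4\<close>, \<open>u\<^sub>3 + u\<^sub>4\<close>, \<open>u\<^sub>2 + u\<^sub>3\<close> vanishes,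
  \<open>t\<close> and \<open>d\<close> leave a single unknown \<open>\<delta> = a - e\<close>, a root of a quadratic equation; taking the norm
  over its roots turns the discriminant equation into a polynomial relation for \<open>(t, d, \<Lambda>)\<close>.
  \<open>H\<close> is this norm divided by the largest powers of the three sums. Zeros of \<open>H\<close> off
  the three hyperplanes are exactly spectra, and they are dense in all zeros of \<open>H\<close>, since \<open>H\<close> does not vanish
  identically on any of the hyperplanes. Finally (CS) and (BB) fix the elementary symmetric functions of the
  \<open>\<lambda>\<^sub>j\<close> in terms of \<open>(t, d, \<Lambda>)\<close>, and every order of the \<open>\<lambda>\<^sub>j\<close> occurs.\<close>


section \<open>Polynomial functions and their zeros\<close>

text \<open>The three sums have different origins. For given traces, the entries \<open>c\<close>
  and \<open>b\<close> are found by dividing by \<open>u\<^sub>2 + u\<^sub>4\<close> and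
  \<open>u\<^sub>3 + u\<^sub>4\<close>, while \<open>u\<^sub>2 + u\<^sub>3\<close> is, up to the
  factor \<open>- u\<^sub>1^2 / 2\<close>, the leading coefficient of the quadratic equation for
  \<delta>. On each hyperplane the elimination breaks down and the norm might vanish identically,
  which could admit zeros that are not limits of spectra; hence the division by the largest powers.
  The hyperplanes then have to be crossed in both directions. Spectra on a hyperplane are limits of
  spectra off all three, so they satisfy \<open>H = 0\<close> by continuity. Conversely, at a limit
  of spectra any \<open>F\<close> vanishing on spectra vanishes, provided that the \<lambda>'s of
  the approximating fields converge too; they do so along a subsequence, being roots of monic cubics
  with convergent coefficients. The work is done on C^7, in coordinates that solve (EJ1) and (EJ2)
  polynomially and turn each hyperplane into the zero set of a coordinate; denominators
  \<open>d\<^sub>k\<close> are cleared only at the end.\<close>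

inductive cpolyfun :: "(complex^'n \<Rightarrow> complex) \<Rightarrow> bool" where
  cpolyfun_const: "cpolyfun (\<lambda>x. c)"
| cpolyfun_nth: "cpolyfun (\<lambda>x. x $ i)"
| cpolyfun_add: "cpolyfun f \<Longrightarrow> cpolyfun g \<Longrightarrow> cpolyfun (\<lambda>x. f x + g x)"
| cpolyfun_mult: "cpolyfun f \<Longrightarrow> cpolyfun g \<Longrightarrow> cpolyfun (\<lambda>x. f x * g x)"

lemma cpolyfun_uminus: "cpolyfun f \<Longrightarrow> cpolyfun (\<lambda>x. - f x)"
  using cpolyfun_mult[OF cpolyfun_const[of "-1"], of f] by simp

lemma cpolyfun_diff: "cpolyfun f \<Longrightarrow> cpolyfun g \<Longrightarrow> cpolyfun (\<lambda>x. f x - g x)"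
  using cpolyfun_add[OF _ cpolyfun_uminus, of f g] by simp

lemma cpolyfun_power: "cpolyfun f \<Longrightarrow> cpolyfun (\<lambda>x. f x ^ k)"
  by (induction k) (simp_all add: cpolyfun_const cpolyfun_mult)

lemma cpolyfun_divide_const: "cpolyfun f \<Longrightarrow> cpolyfun (\<lambda>x. f x / c)"
  using cpolyfun_mult[OF cpolyfun_const[of "inverse c"], of f] by (simp add: field_simps)

lemmas cpolyfun_intros = cpolyfun_const cpolyfun_nth cpolyfun_add cpolyfun_mult
  cpolyfun_uminus cpolyfun_diff cpolyfun_power cpolyfun_divide_const

lemma cpolyfun_continuous:
  fixes f :: "complex^'n::finite \<Rightarrow> complex"
  shows "cpolyfun f \<Longrightarrow> continuous_on S f"
  by (induction rule: cpolyfun.induct) (auto intro!: continuous_intros)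

text \<open>Reduces questions about several variables to one: along a complex line, finiteness of
  roots and degree bounds are available, although \<open>cpolyfun\<close> carries no
  coefficients.\<close>

lemma cpolyfun_line:
  fixes f :: "complex^'n::finite \<Rightarrow> complex"
  assumes "cpolyfun f"
  obtains p where "\<And>s. f (a + s *s b) = poly p s"
proof -
  have "\<exists>p. \<forall>s. f (a + s *s b) = poly p s"
    using assms
  proof (induction rule: cpolyfun.induct)
    case (cpolyfun_const c)
    show ?case by (intro exI[of _ "[:c:]"]) simp
  next
    case (cpolyfun_nth i)
    show ?case by (intro exI[of _ "[:a $ i, b $ i:]"]) (simp add: vector_scalar_mult_def)
  next
    case (cpolyfun_add f g)
    then obtain p q where "\<forall>s. f (a + s *s b) = poly p s" "\<forall>s. g (a + s *s b) = poly q s" by blast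
    then show ?case by (intro exI[of _ "p + q"]) simp
  next
    case (cpolyfun_mult f g)
    then obtain p q where "\<forall>s. f (a + s *s b) = poly p s" "\<forall>s. g (a + s *s b) = poly q s" by blast
    then show ?case by (intro exI[of _ "p * q"]) simp
  qed
  then show ?thesis using that by blast
qed

text \<open>Division with remainder by the variable \<open>x $ i\<close>, the remainder being the
  restriction to the hyperplane. In the product case the remainders are
  \<open>f1 - x\<^sub>i g1\<close> and \<open>f2 - x\<^sub>i g2\<close>, and their product is
  expanded.\<close>

lemma cpolyfun_split_nth:
  fixes f :: "complex^'n::finite \<Rightarrow> complex"
  assumes "cpolyfun f"
  shows "\<exists>g. cpolyfun g \<and> (\<forall>x. f x = f (\<chi> j. if j = i then 0 else x $ j) + x $ i * g x)"
  using assms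
proof (induction rule: cpolyfun.induct)
  case (cpolyfun_const c)
  show ?case by (rule exI[of _ "\<lambda>x. 0"]) (simp add: cpolyfun_intros)
next
  case (cpolyfun_nth j)
  show ?case
    by (rule exI[of _ "\<lambda>x. if j = i then 1 else 0"]) (simp add: cpolyfun_intros)
next
  case (cpolyfun_add f1 f2)
  then obtain g1 g2 where g: "cpolyfun g1" "cpolyfun g2"
    and eq: "\<And>x. f1 x = f1 (\<chi> j. if j = i then 0 else x $ j) + x $ i * g1 x"
    "\<And>x. f2 x = f2 (\<chi> j. if j = i then 0 else x $ j) + x $ i * g2 x" by blast
  have *: "f1 x + f2 x = f1 (\<chi> j. if j = i then 0 else x $ j) + f2 (\<chi> j. if j = i then 0 else x $ j)
      + x $ i * (g1 x + g2 x)" for x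
    using eq(1)[of x] eq(2)[of x] by (simp only: distrib_left ac_simps)
  show ?case
    by (rule exI[of _ "\<lambda>x. g1 x + g2 x"]) (intro conjI allI * cpolyfun_intros g)
next
  case (cpolyfun_mult f1 f2)
  then obtain g1 g2 where g: "cpolyfun g1" "cpolyfun g2"
    and eq: "\<And>x. f1 x = f1 (\<chi> j. if j = i then 0 else x $ j) + x $ i * g1 x"
    "\<And>x. f2 x = f2 (\<chi> j. if j = i then 0 else x $ j) + x $ i * g2 x" by blast
  have *: "f1 x * f2 x = f1 (\<chi> j. if j = i then 0 else x $ j) * f2 (\<chi> j. if j = i then 0 else x $ j)
      + x $ i * (g1 x * f2 x + f1 x * g2 x - x $ i * g1 x * g2 x)" for x
  proof -
    have **: "f1 (\<chi> j. if j = i then 0 else x $ j) = f1 x - x $ i * g1 x"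
      "f2 (\<chi> j. if j = i then 0 else x $ j) = f2 x - x $ i * g2 x"
      using eq[of x] by (simp_all only: eq_diff_eq)
    show ?thesis unfolding ** by (simp add: algebra_simps)
  qed
  show ?case
    by (rule exI[of _ "\<lambda>x. g1 x * f2 x + f1 x * g2 x - x $ i * g1 x * g2 x"])
      (intro conjI allI * cpolyfun_intros g cpolyfun_mult.hyps)
qed

text \<open>The exponents \<open>k\<close> for which the \<open>k\<close>-th power of
  \<open>x $ i\<close> divides \<open>f\<close> are bounded: on the line through \<open>y\<close> in
  direction \<open>i\<close>, \<open>f\<close> is a nonzero polynomial divisible by the
  \<open>k\<close>-th power of the parameter. For the greatest \<open>k\<close> the cofactor cannot
  vanish on the whole hyperplane, since otherwise another factor \<open>x $ i\<close> could be split
  off; \<open>z\<close> witnesses this.\<close>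

lemma cpolyfun_factor_nth:
  fixes f :: "complex^'n::finite \<Rightarrow> complex"
  assumes f: "cpolyfun f" and y: "f y \<noteq> 0"
  obtains k g z where "cpolyfun g" "\<And>x. f x = (x $ i) ^ k * g x" "z $ i = 0" "g z \<noteq> 0"
proof -
  define P where "P k \<longleftrightarrow> (\<exists>g. cpolyfun g \<and> (\<forall>x. f x = (x $ i) ^ k * g x))" for k
  define a where "a = (\<chi> j. if j = i then 0 else y $ j)"
  have line: "a + (y $ i) *s axis i 1 = y" "(a + s *s axis i 1) $ i = s" for s
    by (auto simp: a_def vec_eq_iff axis_def)
  obtain p where p: "\<And>s. f (a + s *s axis i 1) = poly p s"
    using cpolyfun_line[OF f] by blast
  have "p \<noteq> 0" using y p[of "y $ i"] line(1) by auto
  have bound: "k \<le> degree p" if "P k" for k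
  proof -
    obtain g where g: "cpolyfun g" "\<And>x. f x = (x $ i) ^ k * g x" using \<open>P k\<close> P_def by blast
    obtain q where q: "\<And>s. g (a + s *s axis i 1) = poly q s"
      using cpolyfun_line[OF g(1)] by blast
    have "poly p s = poly ([:0, 1:] ^ k * q) s" for s
      using p[of s] q[of s] g(2)[of "a + s *s axis i 1"] line(2) by simp
    then have pq: "p = [:0, 1:] ^ k * q" by (simp add: poly_eq_poly_eq_iff[symmetric] fun_eq_iff)
    then have "q \<noteq> 0" using \<open>p \<noteq> 0\<close> by auto
    then show ?thesis unfolding pq by (simp add: degree_mult_eq degree_power_eq)
  qed
  have "P 0" using f by (auto simp: P_def)
  define k where "k = (GREATEST k. P k)"
  have "P k" unfolding k_def using GreatestI_nat[of P 0 "degree p"] \<open>P 0\<close> bound by blast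
  then obtain g where g: "cpolyfun g" "\<And>x. f x = (x $ i) ^ k * g x" using P_def by blast
  have "\<not> P (Suc k)"
    using Greatest_le_nat[of P "Suc k" "degree p"] bound unfolding k_def[symmetric] by fastforce
  obtain g' where g': "cpolyfun g'"
    "\<And>x. g x = g (\<chi> j. if j = i then 0 else x $ j) + x $ i * g' x"
    using cpolyfun_split_nth[OF g(1)] by blast
  have "\<exists>x. g (\<chi> j. if j = i then 0 else x $ j) \<noteq> 0"
  proof (rule ccontr)
    assume "\<nexists>x. g (\<chi> j. if j = i then 0 else x $ j) \<noteq> 0"
    then have "g x = x $ i * g' x" for x using g'(2)[of x] by simp
    then have "f x = (x $ i) ^ Suc k * g' x" for x using g(2)[of x] by simp
    then have "P (Suc k)" using g'(1) P_def by blast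
    then show False using \<open>\<not> P (Suc k)\<close> by blast
  qed
  then obtain x where "g (\<chi> j. if j = i then 0 else x $ j) \<noteq> 0" by blast
  with g show ?thesis by (intro that[of g k "\<chi> j. if j = i then 0 else x $ j"]) simp_all
qed

text \<open>Restricted to a line inside the hyperplane, \<open>f\<close> is a nonzero polynomial with a zero at \<open>x0\<close>;
  this zero survives when the line is pushed off the hyperplane, by the minimum modulus principle.\<close>
lemma cpolyfun_zero_off_hyperplane:
  fixes f :: "complex^'n::finite \<Rightarrow> complex"
  assumes f: "cpolyfun f" and x0: "f x0 = 0" and U: "open U" "x0 \<in> U"
    and z: "z $ i = 0" "f z \<noteq> 0"
  obtains x where "x \<in> U" "f x = 0" "x $ i \<noteq> 0"
proof (cases "x0 $ i = 0")
  case False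
  then show ?thesis using that x0 U by blast
next
  case True
  define \<xi> where "\<xi> = z - x0"
  define L where "L s \<tau> = x0 + \<tau> *s \<xi> + s *s axis i 1" for s \<tau> :: complex
  have Li: "L s \<tau> $ i = s" for s \<tau>
    using True z(1) by (simp add: L_def \<xi>_def axis_def)
  have contL: "continuous_on UNIV (\<lambda>st. L (fst st) (snd st))"
    unfolding L_def vector_scalar_mult_def by (intro continuous_intros)
  have L00: "L 0 0 = x0" by (simp add: L_def)
  have contf: "continuous_on UNIV (\<lambda>st. f (L (fst st) (snd st)))"
    using continuous_on_compose2[OF cpolyfun_continuous[OF f, of UNIV] contL] by simp
  have "open ((\<lambda>st. L (fst st) (snd st)) -` U)"
    using open_vimage[OF U(1) contL] .
  moreover have "(0, 0) \<in> (\<lambda>st. L (fst st) (snd st)) -` U" using L00 U(2) by simp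
  ultimately obtain e where e: "e > 0" "ball (0, 0) e \<subseteq> (\<lambda>st. L (fst st) (snd st)) -` U"
    using open_contains_ball by blast
  have inU: "L s \<tau> \<in> U" if "cmod s < e / 2" "cmod \<tau> < e / 2" for s \<tau>
  proof -
    have "norm (s, \<tau>) < e" using norm_Pair_le[of s \<tau>] that by linarith
    then have "(s, \<tau>) \<in> ball (0, 0) e"
      by (metis mem_ball dist_0_norm zero_prod_def)
    then show ?thesis using e(2) by auto
  qed
  obtain p where p: "\<And>\<tau>. f (x0 + \<tau> *s \<xi>) = poly p \<tau>"
    using cpolyfun_line[OF f] by blast
  have "poly p 1 = f z" using p[of 1] by (simp add: \<xi>_def)
  then have "p \<noteq> 0" using z by auto
  then have "finite {\<tau>. poly p \<tau> = 0}" by (rule poly_roots_finite)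
  then obtain r0 where r0: "r0 > 0" "\<forall>\<tau>\<in>{\<tau>. poly p \<tau> = 0}. \<tau> \<noteq> 0 \<longrightarrow> r0 \<le> dist 0 \<tau>"
    using finite_set_avoid by blast
  \<comment> \<open>All nonzero roots of \<open>p\<close> have modulus at least \<open>r0\<close>,
    so \<open>f\<close> has no zero on the circle of radius \<open>r\<close> in the unperturbed
    line; \<open>r < e / 2\<close> keeps the disc, also for small \<open>s\<close>, inside
    \<open>U\<close>.\<close>
  define r where "r = min (r0 / 2) (e / 4)"
  have r: "r > 0" "r < r0" "r < e / 2" using r0(1) e(1) by (auto simp: r_def)
  have nz: "f (L 0 \<tau>) \<noteq> 0" if "cmod \<tau> = r" for \<tau>
  proof
    assume "f (L 0 \<tau>) = 0"
    then have "poly p \<tau> = 0" using p by (simp add: L_def)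
    then show False using r0(2) that r by force
  qed
  show ?thesis
  proof (rule ccontr)
    assume "\<not> thesis"
    then have contr: "x $ i = 0" if "x \<in> U" "f x = 0" for x
      using that \<open>\<And>x. x \<in> U \<Longrightarrow> f x = 0 \<Longrightarrow> x $ i \<noteq> 0 \<Longrightarrow> thesis\<close> by blast
    have no: "f (L s \<tau>) \<noteq> 0" if "s \<noteq> 0" "cmod s < e / 2" "cmod \<tau> < e / 2" for s \<tau>
      using contr[OF inU[OF that(2,3)]] Li[of s \<tau>] that(1) by argo
    have ex: "\<exists>\<tau>. cmod \<tau> = r \<and> cmod (f (L s \<tau>)) \<le> cmod (f (L s 0))"
      if s: "s \<noteq> 0" "cmod s < e / 2" for s
    proof (rule ccontr)
      assume "\<not> ?thesis"
      then have big: "cmod (f (L s \<tau>)) > cmod (f (L s 0))" if "cmod \<tau> = r" for \<tau> using that by force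
      have nonz: "f (L s \<tau>) \<noteq> 0" if "cmod \<tau> \<le> r" for \<tau> using no[OF s] that r by auto
      obtain q where q: "\<And>\<tau>. f ((x0 + s *s axis i 1) + \<tau> *s \<xi>) = poly q \<tau>"
        using cpolyfun_line[OF f] by blast
      have q': "f (L s \<tau>) = poly q \<tau>" for \<tau>
        using q[of \<tau>] by (simp add: L_def add_ac)
      have "compact (sphere (0::complex) r)" by simp
      moreover have "sphere (0::complex) r \<noteq> {}" using r by simp
      moreover have "continuous_on (sphere 0 r) (\<lambda>\<tau>. cmod (poly q \<tau>))" by (intro continuous_intros)
      ultimately obtain \<tau>m where \<tau>m: "\<tau>m \<in> sphere 0 r"
        "\<forall>\<tau>\<in>sphere 0 r. cmod (poly q \<tau>m) \<le> cmod (poly q \<tau>)"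
        using continuous_attains_inf by blast
      \<comment> \<open>The inverse is holomorphic because \<open>f\<close> has no zero on the disc.
        A value at the centre smaller in modulus than all values on the circle would contradict the
        maximum modulus principle for it.\<close>
      have "cmod (inverse (poly q 0)) \<le> inverse (cmod (poly q \<tau>m))"
      proof (rule maximum_modulus_frontier[where S = "ball 0 r" and f = "\<lambda>\<tau>. inverse (poly q \<tau>)"])
        show "(\<lambda>\<tau>. inverse (poly q \<tau>)) holomorphic_on interior (ball 0 r)"
          using nonz q' by (auto intro!: holomorphic_intros)
        show "continuous_on (closure (ball 0 r)) (\<lambda>\<tau>. inverse (poly q \<tau>))"
          using nonz q' r by (auto intro!: continuous_intros)
        show "cmod (inverse (poly q z)) \<le> inverse (cmod (poly q \<tau>m))"
          if "z \<in> frontier (ball 0 r)" for z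
        proof -
          have "z \<in> sphere 0 r" using that r by simp
          moreover have "poly q \<tau>m \<noteq> 0" using \<tau>m(1) nonz q' by auto
          ultimately show ?thesis using \<tau>m(2) by (simp add: norm_inverse le_imp_inverse_le)
        qed
      qed (use r in auto)
      then have "cmod (poly q \<tau>m) \<le> cmod (poly q 0)"
        using nonz[of 0] nonz[of \<tau>m] \<tau>m(1) q' r by (simp add: norm_inverse)
      then show False using big[of \<tau>m] \<tau>m(1) q' by simp
    qed
    define s where "s n = complex_of_real (e / 4 / real (Suc n))" for n
    have s: "s n \<noteq> 0" "cmod (s n) < e / 2" for n
    proof -
      show "s n \<noteq> 0" using e(1) unfolding s_def of_real_eq_0_iff by simp
      have "cmod (s n) = e / 4 / real (Suc n)" unfolding s_def using e(1) by (simp only: norm_of_real) simp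
      also have "\<dots> \<le> e / 4" using e(1) by (simp add: field_simps)
      finally show "cmod (s n) < e / 2" using e(1) by linarith
    qed
    have "(\<lambda>n. e / 4 / real (Suc n)) \<longlonglongrightarrow> 0"
      by (rule LIMSEQ_Suc) (rule lim_const_over_n)
    then have "s \<longlonglongrightarrow> complex_of_real 0"
      unfolding s_def by (rule tendsto_of_real)
    then have slim: "s \<longlonglongrightarrow> 0" by simp
    \<comment> \<open>As \<open>s n\<close> tends to 0, these points accumulate at some
      \<open>l\<close> on the compact circle. In the limit \<open>cmod (f (L 0 l))\<close> is at
      most \<open>cmod (f x0) = 0\<close>, although the unperturbed circle avoids all zeros.\<close>
    have "\<forall>n. \<exists>\<tau>. cmod \<tau> = r \<and> cmod (f (L (s n) \<tau>)) \<le> cmod (f (L (s n) 0))"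
      using ex s by blast
    then obtain \<tau> where \<tau>: "\<And>n. cmod (\<tau> n) = r"
      "\<And>n. cmod (f (L (s n) (\<tau> n))) \<le> cmod (f (L (s n) 0))"
      by metis
    have "\<forall>n. \<tau> n \<in> sphere 0 r" using \<tau>(1) by simp
    then obtain l \<rho> where l: "l \<in> sphere 0 r" "strict_mono (\<rho> :: nat \<Rightarrow> nat)" "(\<tau> \<circ> \<rho>) \<longlonglongrightarrow> l"
      using seq_compactE[of "sphere (0::complex) r"] compact_sphere[of "0::complex" r]
      unfolding compact_eq_seq_compact_metric by blast
    have s\<rho>: "(s \<circ> \<rho>) \<longlonglongrightarrow> 0" using slim l(2) by (rule LIMSEQ_subseq_LIMSEQ)
    have lim1: "(\<lambda>n. f (L ((s \<circ> \<rho>) n) ((\<tau> \<circ> \<rho>) n))) \<longlonglongrightarrow> f (L 0 l)"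
      using continuous_on_tendsto_compose[OF contf tendsto_Pair[OF s\<rho> l(3)]] by simp
    have lim2: "(\<lambda>n. f (L ((s \<circ> \<rho>) n) 0)) \<longlonglongrightarrow> f (L 0 0)"
      using continuous_on_tendsto_compose[OF contf tendsto_Pair[OF s\<rho> tendsto_const[of 0]]] by simp
    have "cmod (f (L 0 l)) \<le> cmod (f (L 0 0))"
      by (rule LIMSEQ_le[OF tendsto_norm[OF lim1] tendsto_norm[OF lim2]]) (use \<tau>(2) in auto)
    then show False using nz[of l] l(1) L00 x0 by simp
  qed
qed


section \<open>Elimination of a root of a quadratic equation\<close>

text \<open>Pseudo-division of an expression in \<delta> by the quadratic: the power of
  \<open>c2\<close> replaces the division by a leading coefficient that may vanish. Since the
  congruence is demanded only at the roots \<delta>, expressions remain plain functions and no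
  formal polynomials over the ring of \<open>cpolyfun\<close> functions are involved.\<close>

definition reducible_mod where
  "reducible_mod c2 c1 c0 E \<longleftrightarrow> (\<exists>k A B. cpolyfun A \<and> cpolyfun B \<and>
     (\<forall>\<delta> x. c2 x * \<delta>^2 + c1 x * \<delta> + c0 x = 0 \<longrightarrow> c2 x ^ k * E \<delta> x = A x + B x * \<delta>))"

lemma reducible_mod_coeff: "cpolyfun f \<Longrightarrow> reducible_mod c2 c1 c0 (\<lambda>\<delta> x. f x)"
  unfolding reducible_mod_def
  by (rule exI[of _ 0], rule exI[of _ f], rule exI[of _ "\<lambda>x. 0"]) (simp add: cpolyfun_intros)

lemma reducible_mod_var: "reducible_mod c2 c1 c0 (\<lambda>\<delta> x. \<delta>)"
  unfolding reducible_mod_def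
  by (rule exI[of _ 0], rule exI[of _ "\<lambda>x. 0"], rule exI[of _ "\<lambda>x. 1"]) (simp add: cpolyfun_intros)

lemma reducible_mod_add:
  assumes "cpolyfun c2" "reducible_mod c2 c1 c0 E" "reducible_mod c2 c1 c0 E'"
  shows "reducible_mod c2 c1 c0 (\<lambda>\<delta> x. E \<delta> x + E' \<delta> x)"
proof -
  from assms obtain k A B k' A' B' where pf: "cpolyfun A" "cpolyfun B" "cpolyfun A'" "cpolyfun B'"
    and eq: "\<And>\<delta> x. c2 x * \<delta>^2 + c1 x * \<delta> + c0 x = 0 \<Longrightarrow> c2 x ^ k * E \<delta> x = A x + B x * \<delta>"
    "\<And>\<delta> x. c2 x * \<delta>^2 + c1 x * \<delta> + c0 x = 0 \<Longrightarrow> c2 x ^ k' * E' \<delta> x = A' x + B' x * \<delta>"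
    unfolding reducible_mod_def by blast
  show ?thesis unfolding reducible_mod_def
  proof (intro exI conjI allI impI)
    show "cpolyfun (\<lambda>x. c2 x ^ k' * A x + c2 x ^ k * A' x)"
      "cpolyfun (\<lambda>x. c2 x ^ k' * B x + c2 x ^ k * B' x)"
      by (intro cpolyfun_intros pf assms(1))+
    fix \<delta> x assume "c2 x * \<delta>^2 + c1 x * \<delta> + c0 x = 0"
    note eqs = eq[OF this]
    have "c2 x ^ (k + k') * (E \<delta> x + E' \<delta> x)
        = c2 x ^ k' * (c2 x ^ k * E \<delta> x) + c2 x ^ k * (c2 x ^ k' * E' \<delta> x)"
      by (simp add: power_add algebra_simps)
    also have "\<dots> = c2 x ^ k' * A x + c2 x ^ k * A' x + (c2 x ^ k' * B x + c2 x ^ k * B' x) * \<delta>"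
      unfolding eqs by (simp add: algebra_simps)
    finally show "c2 x ^ (k + k') * (E \<delta> x + E' \<delta> x) = \<dots>" .
  qed
qed

text \<open>The product of two linear remainders contains \<open>B B' \<delta>^2\<close>. One extra
  factor \<open>c2\<close> allows \<open>c2 \<delta>^2\<close> to be replaced by
  \<open>- c1 \<delta> - c0\<close>, hence the exponent \<open>Suc (k + k')\<close>.\<close>

lemma reducible_mod_mult:
  assumes "cpolyfun c2" "cpolyfun c1" "cpolyfun c0"
    "reducible_mod c2 c1 c0 E" "reducible_mod c2 c1 c0 E'"
  shows "reducible_mod c2 c1 c0 (\<lambda>\<delta> x. E \<delta> x * E' \<delta> x)"
proof -
  from assms obtain k A B k' A' B' where pf: "cpolyfun A" "cpolyfun B" "cpolyfun A'" "cpolyfun B'"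
    and eq: "\<And>\<delta> x. c2 x * \<delta>^2 + c1 x * \<delta> + c0 x = 0 \<Longrightarrow> c2 x ^ k * E \<delta> x = A x + B x * \<delta>"
    "\<And>\<delta> x. c2 x * \<delta>^2 + c1 x * \<delta> + c0 x = 0 \<Longrightarrow> c2 x ^ k' * E' \<delta> x = A' x + B' x * \<delta>"
    unfolding reducible_mod_def by blast
  show ?thesis unfolding reducible_mod_def
  proof (intro exI conjI allI impI)
    show "cpolyfun (\<lambda>x. c2 x * (A x * A' x) - c0 x * (B x * B' x))"
      "cpolyfun (\<lambda>x. c2 x * (A x * B' x + B x * A' x) - c1 x * (B x * B' x))"
      by (intro cpolyfun_intros pf assms(1-3))+
    fix \<delta> x assume q: "c2 x * \<delta>^2 + c1 x * \<delta> + c0 x = 0"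
    note eqs = eq[OF this]
    have "c2 x ^ (Suc (k + k')) * (E \<delta> x * E' \<delta> x)
        = c2 x * ((c2 x ^ k * E \<delta> x) * (c2 x ^ k' * E' \<delta> x))"
      by (simp add: power_add algebra_simps)
    also have "\<dots> = c2 x * (A x * A' x) - c0 x * (B x * B' x)
        + (c2 x * (A x * B' x + B x * A' x) - c1 x * (B x * B' x)) * \<delta>
        + B x * B' x * (c2 x * \<delta>^2 + c1 x * \<delta> + c0 x)"
      unfolding eqs by (simp add: algebra_simps power2_eq_square)
    finally show "c2 x ^ (Suc (k + k')) * (E \<delta> x * E' \<delta> x)
        = c2 x * (A x * A' x) - c0 x * (B x * B' x)
        + (c2 x * (A x * B' x + B x * A' x) - c1 x * (B x * B' x)) * \<delta>"
      unfolding q by simp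
  qed
qed

lemma reducible_mod_power:
  assumes "cpolyfun c2" "cpolyfun c1" "cpolyfun c0" "reducible_mod c2 c1 c0 E"
  shows "reducible_mod c2 c1 c0 (\<lambda>\<delta> x. E \<delta> x ^ k)"
  using assms by (induction k) (auto intro: reducible_mod_coeff cpolyfun_const reducible_mod_mult)

lemma complex_quadratic_root:
  fixes c2 c1 c0 :: complex
  assumes "c2 \<noteq> 0"
  obtains \<delta> where "c2 * \<delta>^2 + c1 * \<delta> + c0 = 0"
proof
  show "c2 * ((csqrt (c1^2 - 4 * c2 * c0) - c1) / (2 * c2))^2
      + c1 * ((csqrt (c1^2 - 4 * c2 * c0) - c1) / (2 * c2)) + c0 = 0"
  proof -
    define s where "s = csqrt (c1^2 - 4 * c2 * c0)"
    have s: "s * s = c1 * c1 - 4 * c2 * c0"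
      unfolding s_def using power2_csqrt[of "c1^2 - 4 * c2 * c0"] by (simp add: power2_eq_square)
    have "c2 * ((s - c1) / (2 * c2))^2 + c1 * ((s - c1) / (2 * c2)) + c0
        = (s * s - (c1 * c1 - 4 * c2 * c0)) / (4 * c2)"
      using assms by (simp add: field_simps power2_eq_square)
    then show ?thesis unfolding s_def[symmetric] using s by simp
  qed
qed

text \<open>At a root \<delta> the equation \<open>S E = R\<close>, multiplied by
  \<open>c2 ^ k\<close>, becomes linear: \<open>B S \<delta> = V\<close>. Inserting the homogeneous
  coordinates \<open>(V : B S)\<close> of \<delta> into the quadratic gives \<open>N\<close>, which
  makes sense even where \<open>B S = 0\<close>. If \<open>B = 0\<close> while \<open>c2\<close> and
  \<open>S\<close> are nonzero, \<open>N = 0\<close> forces \<open>V = 0\<close>, and any root of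
  the quadratic serves. Where \<open>S = 0\<close>, \<open>N\<close> is
  \<open>c2 (R c2 ^ k)^2\<close>; this will provide a point at which \<open>N\<close> does not
  vanish.\<close>

lemma eliminate_quadratic:
  fixes c2 c1 c0 R S :: "complex^'n::finite \<Rightarrow> complex"
  assumes pf: "cpolyfun c2" "cpolyfun c1" "cpolyfun c0" "cpolyfun R" "cpolyfun S"
    and E: "reducible_mod c2 c1 c0 E"
  obtains N where "cpolyfun N"
    "\<And>x \<delta>. c2 x * \<delta>^2 + c1 x * \<delta> + c0 x = 0 \<Longrightarrow> S x * E \<delta> x = R x \<Longrightarrow> N x = 0"
    "\<And>x. N x = 0 \<Longrightarrow> c2 x \<noteq> 0 \<Longrightarrow> S x \<noteq> 0 \<Longrightarrow>
       \<exists>\<delta>. c2 x * \<delta>^2 + c1 x * \<delta> + c0 x = 0 \<and> S x * E \<delta> x = R x"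
    "\<And>x. S x = 0 \<Longrightarrow> c2 x \<noteq> 0 \<Longrightarrow> R x \<noteq> 0 \<Longrightarrow> N x \<noteq> 0"
proof -
  obtain k A B where AB: "cpolyfun A" "cpolyfun B"
    and eq: "\<And>\<delta> x. c2 x * \<delta>^2 + c1 x * \<delta> + c0 x = 0 \<Longrightarrow> c2 x ^ k * E \<delta> x = A x + B x * \<delta>"
    using E unfolding reducible_mod_def by blast
  define V where "V x = R x * c2 x ^ k - A x * S x" for x
  define N where "N x = c2 x * V x ^ 2 + c1 x * (B x * S x) * V x + c0 x * (B x * S x)^2" for x
  show ?thesis
  proof
    show "cpolyfun N" unfolding N_def V_def using pf AB by (intro cpolyfun_intros)
    show "N x = 0" if q: "c2 x * \<delta>^2 + c1 x * \<delta> + c0 x = 0" and s: "S x * E \<delta> x = R x" for x \<delta>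
    proof -
      have "V x = S x * (c2 x ^ k * E \<delta> x) - A x * S x"
        unfolding V_def s[symmetric] by (simp add: algebra_simps)
      then have V: "V x = B x * S x * \<delta>" unfolding eq[OF q] by (simp add: algebra_simps)
      have "N x = (B x * S x)^2 * (c2 x * \<delta>^2 + c1 x * \<delta> + c0 x)"
        unfolding N_def V by (simp add: algebra_simps power2_eq_square)
      then show ?thesis unfolding q by simp
    qed
    show "\<exists>\<delta>. c2 x * \<delta>^2 + c1 x * \<delta> + c0 x = 0 \<and> S x * E \<delta> x = R x"
      if N: "N x = 0" and c2: "c2 x \<noteq> 0" and S: "S x \<noteq> 0" for x
    proof -
      have *: "S x * E \<delta> x = R x" if q: "c2 x * \<delta>^2 + c1 x * \<delta> + c0 x = 0"
        and V: "V x = B x * S x * \<delta>" for \<delta>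
      proof -
        have "c2 x ^ k * (S x * E \<delta> x) = S x * (A x + B x * \<delta>)"
          using eq[OF q] by (simp add: algebra_simps)
        also have "\<dots> = c2 x ^ k * R x" using V by (simp add: V_def algebra_simps)
        finally show ?thesis using c2 by simp
      qed
      show ?thesis
      proof (cases "B x = 0")
        case True
        then have "V x = 0" using N c2 by (simp add: N_def)
        moreover obtain \<delta> where "c2 x * \<delta>^2 + c1 x * \<delta> + c0 x = 0"
          using complex_quadratic_root[OF c2] by blast
        ultimately show ?thesis using * True by auto
      next
        case False
        define \<delta> where "\<delta> = V x / (B x * S x)"
        have V: "V x = B x * S x * \<delta>" using False S by (simp add: \<delta>_def)
        have "(B x * S x)^2 * (c2 x * \<delta>^2 + c1 x * \<delta> + c0 x) = N x"
          unfolding N_def V by (simp add: algebra_simps power2_eq_square)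
        then have "c2 x * \<delta>^2 + c1 x * \<delta> + c0 x = 0" using N False S by simp
        then show ?thesis using * V by blast
      qed
    qed
    show "N x \<noteq> 0" if "S x = 0" "c2 x \<noteq> 0" "R x \<noteq> 0" for x
      using that by (simp add: N_def V_def)
  qed
qed

section \<open>Realizable spectra and the quadratic equation for \<delta>\<close>

definition cubic_disc :: "complex \<Rightarrow> complex \<Rightarrow> complex \<Rightarrow> complex \<Rightarrow> complex" where
  "cubic_disc a b c d = b^2 * c^2 - 4 * a * c^3 - 4 * b^3 * d - 27 * a^2 * d^2 + 18 * a * b * c * d"

text \<open>The matrix with rows \<open>a, b\<close> and \<open>c, e\<close> is minus the Jacobian
  at the first singularity in normal coordinates. Its determinant, the traces at the first three
  singularities and (EJ2) in place of the fourth trace are prescribed; the arguments of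
  \<open>cubic_disc\<close> are the coefficients of the form
  \<open>y P\<^sub>2 - x Q\<^sub>2\<close>. Nothing is divided by a sum of two
  \<open>u\<^sub>k\<close>, so the conditions make sense on the three hyperplanes as well. For
  nonzero \<open>u\<^sub>k\<close> the last equation forces \<Lambda> and the discriminant to be
  nonzero.\<close>

definition realizable :: "complex^4 \<Rightarrow> complex^4 \<Rightarrow> complex \<Rightarrow> bool" where
  "realizable u t \<Lambda> \<longleftrightarrow> (\<exists>a b c e. u$1 * (a * e - b * c) = 1 \<and> t$1 = - (a + e) \<and>
     u$2 * t$2 = u$2 * a - (u$2 + u$4) * c + u$1 * e \<and>
     u$3 * t$3 = u$3 * e - (u$3 + u$4) * b + u$1 * a \<and>
     u$1 * t$1 + u$2 * t$2 + u$3 * t$3 + u$4 * t$4 = 0 \<and>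
     \<Lambda> * cubic_disc (- u$2 * c) (u$2 * a + (u$2 + u$4) * c + (u$3 + u$4) * e)
        (- (u$3 * e + (u$3 + u$4) * b + (u$2 + u$4) * a)) (u$3 * b) = - (u$2 * u$3 * u$4) / u$1)"

text \<open>With \<open>t\<^sub>1 = - (a + e)\<close>, the difference
  \<open>\<delta> = a - e\<close> determines \<open>a\<close> and \<open>e\<close>, and the traces
  at the second and third singularity become \<open>m c = f \<delta>\<close> and
  \<open>n b = h \<delta>\<close>. The determinant condition is then quadratic in \<delta>.
  \<open>B\<close> and \<open>C\<close> are the middle coefficients of the cubic form, affine in
  \<delta> because the trace equations eliminate \<open>c\<close> and \<open>b\<close> from them;
  the factor \<open>m^2 n^2\<close> clears the denominators of the discriminant.\<close>

lemma realizable_iff_quadratic: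
  fixes u t :: "complex^4" and \<Lambda> :: complex
  defines "m \<equiv> u$2 + u$4" and "n \<equiv> u$3 + u$4"
  defines "f \<equiv> \<lambda>\<delta>. ((u$2 - u$1) * \<delta> + (n * t$1 - 2 * (u$2 * t$2))) / 2"
    and "h \<equiv> \<lambda>\<delta>. ((u$1 - u$3) * \<delta> + (m * t$1 - 2 * (u$3 * t$3))) / 2"
    and "B \<equiv> \<lambda>\<delta>. u$2 * (3 * \<delta> - t$1 - 2 * t$2) / 2"
    and "C \<equiv> \<lambda>\<delta>. u$3 * (3 * \<delta> + t$1 + 2 * t$3) / 2"
  assumes u: "\<And>k. u$k \<noteq> 0" "u$1 + u$2 + u$3 + u$4 = 0"
    and t: "u$1 * t$1 + u$2 * t$2 + u$3 * t$3 + u$4 * t$4 = 0"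
    and mn: "m \<noteq> 0" "n \<noteq> 0"
  shows "realizable u t \<Lambda> \<longleftrightarrow>
    (\<exists>\<delta>. u$1 * (m * n * (t$1^2 - \<delta>^2) / 4 - f \<delta> * h \<delta>) = m * n \<and>
     \<Lambda> * u$1 * (m^2 * n^2 * (B \<delta>)^2 * (C \<delta>)^2 + 4 * u$2 * f \<delta> * m * n^2 * (C \<delta>)^3
       - 4 * (B \<delta>)^3 * u$3 * h \<delta> * m^2 * n - 27 * u$2^2 * u$3^2 * (f \<delta>)^2 * (h \<delta>)^2
       - 18 * u$2 * u$3 * f \<delta> * h \<delta> * m * n * B \<delta> * C \<delta>) = - (u$2 * u$3 * u$4 * m^2 * n^2))"
    (is "_ \<longleftrightarrow> (\<exists>\<delta>. ?q \<delta> \<and> \<Lambda> * u$1 * ?E \<delta> = ?R)")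
proof -
  have u4: "u$4 = - u$1 - u$2 - u$3" using u(2) by (simp add: algebra_simps eq_neg_iff_add_eq_0)
  have disc: "m^2 * n^2 * cubic_disc (- u$2 * c) (B \<delta>) (C \<delta>) (u$3 * b) = ?E \<delta>"
    if "f \<delta> = m * c" "h \<delta> = n * b" for b c \<delta>
    unfolding cubic_disc_def that by (simp add: algebra_simps power2_eq_square power3_eq_cube)
  have fin: "\<Lambda> * cubic_disc (- u$2 * c) (B \<delta>) (C \<delta>) (u$3 * b) = - (u$2 * u$3 * u$4) / u$1
      \<longleftrightarrow> \<Lambda> * u$1 * ?E \<delta> = ?R" if fh: "f \<delta> = m * c" "h \<delta> = n * b" for b c \<delta>
  proof -
    have "\<Lambda> * u$1 * ?E \<delta> = ?R \<longleftrightarrow>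
      (m^2 * n^2) * (\<Lambda> * u$1 * cubic_disc (- u$2 * c) (B \<delta>) (C \<delta>) (u$3 * b)) = (m^2 * n^2) * (- (u$2 * u$3 * u$4))"
      unfolding disc[OF fh, symmetric] by (simp add: algebra_simps)
    also have "\<dots> \<longleftrightarrow> \<Lambda> * u$1 * cubic_disc (- u$2 * c) (B \<delta>) (C \<delta>) (u$3 * b) = - (u$2 * u$3 * u$4)"
      using mn by (intro mult_left_cancel) simp
    also have "\<dots> \<longleftrightarrow> \<Lambda> * cubic_disc (- u$2 * c) (B \<delta>) (C \<delta>) (u$3 * b) = - (u$2 * u$3 * u$4) / u$1"
      using u(1)[of 1] by (simp add: field_simps)
    finally show ?thesis by simp
  qed
  show ?thesis
  proof
    assume "realizable u t \<Lambda>"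
    then obtain a b c e where M: "u$1 * (a * e - b * c) = 1" "t$1 = - (a + e)"
      "u$2 * t$2 = u$2 * a - m * c + u$1 * e" "u$3 * t$3 = u$3 * e - n * b + u$1 * a"
      "\<Lambda> * cubic_disc (- u$2 * c) (u$2 * a + m * c + n * e) (- (u$3 * e + n * b + m * a)) (u$3 * b)
        = - (u$2 * u$3 * u$4) / u$1"
      unfolding realizable_def m_def n_def by blast
    have f: "f (a - e) = m * c" unfolding f_def M(3) M(2) by (simp add: n_def u4 field_simps)
    have h: "h (a - e) = n * b" unfolding h_def M(4) M(2) by (simp add: m_def u4 field_simps)
    have "B (a - e) = (u$2 * (3 * (a - e) - t$1) - 2 * (u$2 * t$2)) / 2"
      unfolding B_def by (simp add: algebra_simps)
    also have "\<dots> = u$2 * a + m * c + n * e" unfolding M(3) M(2) by (simp add: n_def u4 field_simps)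
    finally have B: "B (a - e) = u$2 * a + m * c + n * e" .
    have "C (a - e) = (u$3 * (3 * (a - e) + t$1) + 2 * (u$3 * t$3)) / 2"
      unfolding C_def by (simp add: algebra_simps)
    also have "\<dots> = - (u$3 * e + n * b + m * a)" unfolding M(4) M(2) by (simp add: m_def u4 field_simps)
    finally have C: "C (a - e) = - (u$3 * e + n * b + m * a)" .
    have "u$1 * (m * n * (t$1^2 - (a - e)^2) / 4 - f (a - e) * h (a - e)) = m * n * (u$1 * (a * e - b * c))"
      unfolding f h M(2) by (simp add: field_simps power2_eq_square)
    then have "?q (a - e)" unfolding M(1) by simp
    moreover have "\<Lambda> * u$1 * ?E (a - e) = ?R" using fin[OF f h] M(5) unfolding B C by simp
    ultimately show "\<exists>\<delta>. ?q \<delta> \<and> \<Lambda> * u$1 * ?E \<delta> = ?R" by blast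
  next
    assume "\<exists>\<delta>. ?q \<delta> \<and> \<Lambda> * u$1 * ?E \<delta> = ?R"
    then obtain \<delta> where q: "?q \<delta>" and E: "\<Lambda> * u$1 * ?E \<delta> = ?R" by blast
    define a where "a = (\<delta> - t$1) / 2"
    define e where "e = - (\<delta> + t$1) / 2"
    define c where "c = f \<delta> / m"
    define b where "b = h \<delta> / n"
    have f: "f \<delta> = m * c" and h: "h \<delta> = n * b" using mn by (simp_all add: c_def b_def)
    have "m * n * (u$1 * (a * e - b * c)) = u$1 * (m * n * (t$1^2 - \<delta>^2) / 4 - f \<delta> * h \<delta>)"
      unfolding f h a_def e_def by (simp add: field_simps power2_eq_square)
    then have 1: "u$1 * (a * e - b * c) = 1" using q mn by simp
    have 2: "t$1 = - (a + e)" by (simp add: a_def e_def field_simps)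
    have 3: "u$2 * t$2 = u$2 * a - m * c + u$1 * e"
      unfolding f[symmetric] f_def a_def e_def by (simp add: n_def u4 field_simps)
    have 4: "u$3 * t$3 = u$3 * e - n * b + u$1 * a"
      unfolding h[symmetric] h_def a_def e_def by (simp add: m_def u4 field_simps)
    have B: "B \<delta> = u$2 * a + m * c + n * e"
      unfolding f[symmetric] B_def f_def a_def e_def by (simp add: n_def u4 field_simps)
    have C: "C \<delta> = - (u$3 * e + n * b + m * a)"
      unfolding h[symmetric] C_def h_def a_def e_def by (simp add: m_def u4 field_simps)
    show "realizable u t \<Lambda>" unfolding realizable_def
      using 1 2 3 4 t fin[OF f h] E unfolding B C m_def n_def by blast
  qed
qed


section \<open>The missing relation\<close>

lemma vector_4 [simp]:
  "(vector [a,b,c,d] :: ('a::zero)^4)$1 = a"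
  "(vector [a,b,c,d] :: ('a::zero)^4)$2 = b"
  "(vector [a,b,c,d] :: ('a::zero)^4)$3 = c"
  "(vector [a,b,c,d] :: ('a::zero)^4)$4 = d"
  unfolding vector_def by simp_all

lemma vector_7 [simp]:
  "(vector [a,b,c,d,e,f,g] :: ('a::zero)^7)$1 = a"
  "(vector [a,b,c,d,e,f,g] :: ('a::zero)^7)$2 = b"
  "(vector [a,b,c,d,e,f,g] :: ('a::zero)^7)$3 = c"
  "(vector [a,b,c,d,e,f,g] :: ('a::zero)^7)$4 = d"
  "(vector [a,b,c,d,e,f,g] :: ('a::zero)^7)$5 = e"
  "(vector [a,b,c,d,e,f,g] :: ('a::zero)^7)$6 = f"
  "(vector [a,b,c,d,e,f,g] :: ('a::zero)^7)$7 = g"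
  unfolding vector_def by simp_all

lemma exhaust_7:
  fixes x :: 7
  shows "x = 1 \<or> x = 2 \<or> x = 3 \<or> x = 4 \<or> x = 5 \<or> x = 6 \<or> x = 7"
proof (induct x)
  case (of_int z)
  then have "0 \<le> z" and "z < 7" by simp_all
  then have "z = 0 \<or> z = 1 \<or> z = 2 \<or> z = 3 \<or> z = 4 \<or> z = 5 \<or> z = 6" by arith
  then show ?case by auto
qed

lemma forall_7: "(\<forall>i::7. P i) \<longleftrightarrow> P 1 \<and> P 2 \<and> P 3 \<and> P 4 \<and> P 5 \<and> P 6 \<and> P 7"
  by (metis exhaust_7)

text \<open>Polynomial coordinates on the variety given by (EJ1) and (EJ2): the first three are the sums
  \<open>u\<^sub>2 + u\<^sub>4\<close>, \<open>u\<^sub>3 + u\<^sub>4\<close>, \<open>u\<^sub>2 + u\<^sub>3\<close>, the next three \<open>t\<^sub>k / u\<^sub>1\<close> for \<open>k = 2, 3, 4\<close>,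
  and the last one is \<open>\<Lambda>\<close>.\<close>
definition chart_u :: "complex^7 \<Rightarrow> complex^4" where
  "chart_u x = vector [- (x$1 + x$2 + x$3) / 2, (x$1 + x$3 - x$2) / 2,
     (x$2 + x$3 - x$1) / 2, (x$1 + x$2 - x$3) / 2]"

definition chart_t :: "complex^7 \<Rightarrow> complex^4" where
  "chart_t x = vector [- (chart_u x $ 2 * x$4 + chart_u x $ 3 * x$5 + chart_u x $ 4 * x$6),
     chart_u x $ 1 * x$4, chart_u x $ 1 * x$5, chart_u x $ 1 * x$6]"

lemma chart_u_relations:
  "chart_u x $ 2 + chart_u x $ 4 = x$1" "chart_u x $ 3 + chart_u x $ 4 = x$2"
  "chart_u x $ 2 + chart_u x $ 3 = x$3"
  "chart_u x $ 1 + chart_u x $ 2 + chart_u x $ 3 + chart_u x $ 4 = 0"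
  by (simp_all add: chart_u_def field_simps)

lemma chart_t_relation:
  "chart_u x $ 1 * chart_t x $ 1 + chart_u x $ 2 * chart_t x $ 2
    + chart_u x $ 3 * chart_t x $ 3 + chart_u x $ 4 * chart_t x $ 4 = 0"
  by (simp add: chart_t_def algebra_simps)

text \<open>Taking \<open>t\<^sub>k / u\<^sub>1\<close> as coordinates lets (EJ2) be solved for
  \<open>t\<^sub>1\<close> without division, so that the chart is polynomial. The halves in
  \<open>chart_u\<close> invert the system of pairwise sums of
  \<open>u\<^sub>2, u\<^sub>3, u\<^sub>4\<close>.\<close>

lemma chart_surj:
  fixes u t :: "complex^4" and \<Lambda> :: complex
  assumes "u$1 \<noteq> 0" "u$1 + u$2 + u$3 + u$4 = 0"
    "u$1 * t$1 + u$2 * t$2 + u$3 * t$3 + u$4 * t$4 = 0"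
  defines "x \<equiv> vector [u$2 + u$4, u$3 + u$4, u$2 + u$3, t$2 / u$1, t$3 / u$1, t$4 / u$1, \<Lambda>] :: complex^7"
  shows "chart_u x = u" "chart_t x = t"
proof -
  have u1: "u$1 = - u$2 - u$3 - u$4" using assms(2) by (simp add: algebra_simps eq_neg_iff_add_eq_0)
  show u: "chart_u x = u"
    by (simp add: chart_u_def vec_eq_iff forall_4 x_def u1 field_simps)
  have "u$1 * t$1 = - (u$2 * t$2 + u$3 * t$3 + u$4 * t$4)"
    using assms(3) by (simp add: algebra_simps eq_neg_iff_add_eq_0)
  then have "- (u$2 * (t$2 / u$1) + u$3 * (t$3 / u$1) + u$4 * (t$4 / u$1)) = t$1"
    using assms(1) by (simp add: field_simps)
  then show "chart_t x = t"
    using assms(1) by (simp add: chart_t_def vec_eq_iff forall_4 u) (simp add: x_def)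
qed

lemma cpolyfun_chart:
  "cpolyfun (\<lambda>x. chart_u x $ 1)" "cpolyfun (\<lambda>x. chart_u x $ 2)"
  "cpolyfun (\<lambda>x. chart_u x $ 3)" "cpolyfun (\<lambda>x. chart_u x $ 4)"
  "cpolyfun (\<lambda>x. chart_t x $ 1)" "cpolyfun (\<lambda>x. chart_t x $ 2)"
  "cpolyfun (\<lambda>x. chart_t x $ 3)" "cpolyfun (\<lambda>x. chart_t x $ 4)"
proof -
  show u: "cpolyfun (\<lambda>x. chart_u x $ 1)" "cpolyfun (\<lambda>x. chart_u x $ 2)"
    "cpolyfun (\<lambda>x. chart_u x $ 3)" "cpolyfun (\<lambda>x. chart_u x $ 4)"
    unfolding chart_u_def vector_4 by (intro cpolyfun_intros)+
  show "cpolyfun (\<lambda>x. chart_t x $ 1)" "cpolyfun (\<lambda>x. chart_t x $ 2)"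
    "cpolyfun (\<lambda>x. chart_t x $ 3)" "cpolyfun (\<lambda>x. chart_t x $ 4)"
    unfolding chart_t_def vector_4 by (intro cpolyfun_intros u)+
qed

text \<open>The elimination applied to the two equations for \<delta>, with \<open>S\<close>
  carrying \<Lambda>. At \<open>\<Lambda> = 0\<close> the equation \<open>S E = R\<close> has no
  solution, as \<open>R\<close> is nonzero there; the last claim is the corresponding statement
  about \<open>N\<close>.\<close>

lemma norm_polynomial:
  obtains N where "cpolyfun N"
    "\<And>x. \<forall>k. chart_u x $ k \<noteq> 0 \<Longrightarrow> x$1 \<noteq> 0 \<Longrightarrow> x$2 \<noteq> 0 \<Longrightarrow>
       realizable (chart_u x) (chart_t x) (x$7) \<Longrightarrow> N x = 0"
    "\<And>x. \<forall>k. chart_u x $ k \<noteq> 0 \<Longrightarrow> x$1 \<noteq> 0 \<Longrightarrow> x$2 \<noteq> 0 \<Longrightarrow> x$3 \<noteq> 0 \<Longrightarrow> x$7 \<noteq> 0 \<Longrightarrow>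
       N x = 0 \<Longrightarrow> realizable (chart_u x) (chart_t x) (x$7)"
    "\<And>x. \<forall>k. chart_u x $ k \<noteq> 0 \<Longrightarrow> x$1 \<noteq> 0 \<Longrightarrow> x$2 \<noteq> 0 \<Longrightarrow> x$3 \<noteq> 0 \<Longrightarrow> x$7 = 0 \<Longrightarrow> N x \<noteq> 0"
proof -
  \<comment> \<open>\<open>f\<close> and \<open>h\<close> are affine in \<delta> with constant terms
    \<open>k1 / 2\<close> and \<open>k2 / 2\<close>; the coefficients \<open>c2\<close>,
    \<open>c1\<close>, \<open>c0\<close> result from expanding the determinant condition.\<close>
  define k1 where "k1 x = x$2 * chart_t x $ 1 - 2 * (chart_u x $ 2 * chart_t x $ 2)" for x
  define k2 where "k2 x = x$1 * chart_t x $ 1 - 2 * (chart_u x $ 3 * chart_t x $ 3)" for x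
  define c2 where "c2 x = chart_u x $ 1 * (- (x$1 * x$2) - (chart_u x $ 2 - chart_u x $ 1) * (chart_u x $ 1 - chart_u x $ 3)) / 4" for x
  define c1 where "c1 x = - (chart_u x $ 1 * ((chart_u x $ 2 - chart_u x $ 1) * k2 x + (chart_u x $ 1 - chart_u x $ 3) * k1 x)) / 4" for x
  define c0 where "c0 x = chart_u x $ 1 * (x$1 * x$2 * (chart_t x $ 1)^2 - k1 x * k2 x) / 4 - x$1 * x$2" for x
  define f where "f \<delta> x = ((chart_u x $ 2 - chart_u x $ 1) * \<delta> + k1 x) / 2" for \<delta> x
  define h where "h \<delta> x = ((chart_u x $ 1 - chart_u x $ 3) * \<delta> + k2 x) / 2" for \<delta> x
  define B where "B \<delta> x = chart_u x $ 2 * (3 * \<delta> - chart_t x $ 1 - 2 * chart_t x $ 2) / 2" for \<delta> x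
  define C where "C \<delta> x = chart_u x $ 3 * (3 * \<delta> + chart_t x $ 1 + 2 * chart_t x $ 3) / 2" for \<delta> x
  define E where "E \<delta> x = (x$1)^2 * (x$2)^2 * (B \<delta> x)^2 * (C \<delta> x)^2
       + 4 * chart_u x $ 2 * f \<delta> x * x$1 * (x$2)^2 * (C \<delta> x)^3
       - 4 * (B \<delta> x)^3 * chart_u x $ 3 * h \<delta> x * (x$1)^2 * x$2
       - 27 * (chart_u x $ 2)^2 * (chart_u x $ 3)^2 * (f \<delta> x)^2 * (h \<delta> x)^2
       - 18 * chart_u x $ 2 * chart_u x $ 3 * f \<delta> x * h \<delta> x * x$1 * x$2 * B \<delta> x * C \<delta> x" for \<delta> x
  define S where "S x = x$7 * chart_u x $ 1" for x :: "complex^7"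
  define R where "R x = - (chart_u x $ 2 * chart_u x $ 3 * chart_u x $ 4 * (x$1)^2 * (x$2)^2)" for x
  have pfk: "cpolyfun k1" "cpolyfun k2"
    unfolding k1_def k2_def by (intro cpolyfun_intros cpolyfun_chart)+
  have pfc: "cpolyfun c2" "cpolyfun c1" "cpolyfun c0" "cpolyfun R" "cpolyfun S"
    unfolding c2_def c1_def c0_def R_def S_def by (intro cpolyfun_intros cpolyfun_chart pfk)+
  note red_mult = reducible_mod_mult[OF pfc(1-3)] and red_add = reducible_mod_add[OF pfc(1)]
    and red_power = reducible_mod_power[OF pfc(1-3)]
  have red_uminus: "reducible_mod c2 c1 c0 (\<lambda>\<delta> x. - F \<delta> x)" if "reducible_mod c2 c1 c0 F" for F
    using red_mult[OF reducible_mod_coeff[OF cpolyfun_const[of "-1"]] that] by simp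
  have red_diff: "reducible_mod c2 c1 c0 (\<lambda>\<delta> x. F \<delta> x - G \<delta> x)"
    if "reducible_mod c2 c1 c0 F" "reducible_mod c2 c1 c0 G" for F G
    using red_add[OF that(1) red_uminus[OF that(2)]] by simp
  have red_half: "reducible_mod c2 c1 c0 (\<lambda>\<delta> x. F \<delta> x / 2)" if "reducible_mod c2 c1 c0 F" for F
    using red_mult[OF reducible_mod_coeff[OF cpolyfun_const[of "1/2"]] that] by simp
  note red_coeff = reducible_mod_coeff[OF cpolyfun_const] reducible_mod_coeff[OF cpolyfun_nth]
    cpolyfun_chart[THEN reducible_mod_coeff] pfk[THEN reducible_mod_coeff]
  have redf: "reducible_mod c2 c1 c0 f" "reducible_mod c2 c1 c0 h"
    "reducible_mod c2 c1 c0 B" "reducible_mod c2 c1 c0 C"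
    unfolding f_def h_def B_def C_def
    by (intro red_mult red_add red_diff red_half red_coeff reducible_mod_var)+
  have redE: "reducible_mod c2 c1 c0 E"
    unfolding E_def
    by (intro red_mult red_add red_diff red_power redf red_coeff)
  obtain N where N: "cpolyfun N"
    "\<And>x \<delta>. c2 x * \<delta>^2 + c1 x * \<delta> + c0 x = 0 \<Longrightarrow> S x * E \<delta> x = R x \<Longrightarrow> N x = 0"
    "\<And>x. N x = 0 \<Longrightarrow> c2 x \<noteq> 0 \<Longrightarrow> S x \<noteq> 0 \<Longrightarrow>
       \<exists>\<delta>. c2 x * \<delta>^2 + c1 x * \<delta> + c0 x = 0 \<and> S x * E \<delta> x = R x"
    "\<And>x. S x = 0 \<Longrightarrow> c2 x \<noteq> 0 \<Longrightarrow> R x \<noteq> 0 \<Longrightarrow> N x \<noteq> 0"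
    using eliminate_quadratic[OF pfc redE] by blast
  \<comment> \<open>This is the source of the third hyperplane \<open>x $ 3 = 0\<close>. The
    identity depends on the \<open>u\<^sub>k\<close> having sum zero, which the chart builds
    in.\<close>
  have c2: "c2 x = - ((chart_u x $ 1)^2 * x$3) / 2" for x
    unfolding c2_def by (simp add: chart_u_def field_simps power2_eq_square)
  have iff: "realizable (chart_u x) (chart_t x) (x$7) \<longleftrightarrow>
      (\<exists>\<delta>. c2 x * \<delta>^2 + c1 x * \<delta> + c0 x = 0 \<and> S x * E \<delta> x = R x)"
    if "\<And>k. chart_u x $ k \<noteq> 0" "x$1 \<noteq> 0" "x$2 \<noteq> 0" for x
  proof -
    have "c2 x * \<delta>^2 + c1 x * \<delta> + c0 x = 0 \<longleftrightarrow>
      chart_u x $ 1 * (x$1 * x$2 * ((chart_t x $ 1)^2 - \<delta>^2) / 4 - f \<delta> x * h \<delta> x) = x$1 * x$2" for \<delta>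
    proof -
      have "c2 x * \<delta>^2 + c1 x * \<delta> + c0 x
        = chart_u x $ 1 * (x$1 * x$2 * ((chart_t x $ 1)^2 - \<delta>^2) / 4 - f \<delta> x * h \<delta> x) - x$1 * x$2"
        unfolding c2_def c1_def c0_def f_def h_def by (simp add: field_simps power2_eq_square)
      then show ?thesis by simp
    qed
    note q = this
    show ?thesis
      unfolding q S_def R_def E_def f_def h_def B_def C_def k1_def k2_def
      using realizable_iff_quadratic[of "chart_u x" "chart_t x" "x$7"] that
      unfolding chart_u_relations using chart_t_relation[of x] by blast
  qed
  show ?thesis
  proof (rule that[OF N(1)])
    show "N x = 0" if "\<forall>k. chart_u x $ k \<noteq> 0" "x$1 \<noteq> 0" "x$2 \<noteq> 0"
      "realizable (chart_u x) (chart_t x) (x$7)" for x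
      using iff[OF that(1)[rule_format] that(2,3)] that(4) N(2) by blast
    show "realizable (chart_u x) (chart_t x) (x$7)"
      if "\<forall>k. chart_u x $ k \<noteq> 0" "x$1 \<noteq> 0" "x$2 \<noteq> 0" "x$3 \<noteq> 0" "x$7 \<noteq> 0" "N x = 0" for x
      using iff[OF that(1)[rule_format] that(2,3)] N(3)[OF that(6)] that by (simp add: c2 S_def)
    show "N x \<noteq> 0"
      if "\<forall>k. chart_u x $ k \<noteq> 0" "x$1 \<noteq> 0" "x$2 \<noteq> 0" "x$3 \<noteq> 0" "x$7 = 0" for x
      using that by (intro N(4)) (simp_all add: c2 S_def R_def)
  qed
qed

text \<open>The matrix and \<open>u\<^sub>1\<close> stay fixed, so the determinant condition
  persists, while \<open>u\<^sub>2, u\<^sub>3, u\<^sub>4\<close> move by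
  \<open>\<epsilon>, \<epsilon>, - 2 \<epsilon>\<close>. This preserves (EJ1) and changes each of
  the three sums at a nonzero rate. Traces and \<Lambda> are recomputed from their equations;
  \<Lambda> is continuous in \<epsilon> because the discriminant is nonzero at
  \<open>\<epsilon> = 0\<close>.\<close>

lemma realizable_perturb:
  assumes x: "\<And>k. chart_u x $ k \<noteq> 0" and re: "realizable (chart_u x) (chart_t x) (x$7)"
  obtains X where "X \<midarrow>0\<rightarrow> x"
    "eventually (\<lambda>\<epsilon>::complex. (\<forall>k. chart_u (X \<epsilon>) $ k \<noteq> 0) \<and> X \<epsilon> $ 1 \<noteq> 0 \<and> X \<epsilon> $ 2 \<noteq> 0 \<and>
       X \<epsilon> $ 3 \<noteq> 0 \<and> realizable (chart_u (X \<epsilon>)) (chart_t (X \<epsilon>)) (X \<epsilon> $ 7)) (at 0)"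
proof -
  define u where "u = chart_u x"
  define t where "t = chart_t x"
  have u: "u$1 + u$2 + u$3 + u$4 = 0" unfolding u_def by (rule chart_u_relations)
  have unz: "u$k \<noteq> 0" for k using x by (simp add: u_def)
  have ut: "u$1 * t$1 + u$2 * t$2 + u$3 * t$3 + u$4 * t$4 = 0"
    unfolding u_def t_def by (rule chart_t_relation)
  obtain a b c e where M: "u$1 * (a * e - b * c) = 1" "t$1 = - (a + e)"
      "u$2 * t$2 = u$2 * a - (u$2 + u$4) * c + u$1 * e" "u$3 * t$3 = u$3 * e - (u$3 + u$4) * b + u$1 * a"
      "x$7 * cubic_disc (- u$2 * c) (u$2 * a + (u$2 + u$4) * c + (u$3 + u$4) * e)
         (- (u$3 * e + (u$3 + u$4) * b + (u$2 + u$4) * a)) (u$3 * b) = - (u$2 * u$3 * u$4) / u$1"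
    using re unfolding realizable_def u_def t_def by blast
  define v2 where "v2 \<epsilon> = u$2 + \<epsilon>" for \<epsilon>
  define v3 where "v3 \<epsilon> = u$3 + \<epsilon>" for \<epsilon>
  define v4 where "v4 \<epsilon> = u$4 - 2 * \<epsilon>" for \<epsilon>
  define s2 where "s2 \<epsilon> = (v2 \<epsilon> * a - (v2 \<epsilon> + v4 \<epsilon>) * c + u$1 * e) / v2 \<epsilon>" for \<epsilon>
  define s3 where "s3 \<epsilon> = (v3 \<epsilon> * e - (v3 \<epsilon> + v4 \<epsilon>) * b + u$1 * a) / v3 \<epsilon>" for \<epsilon>
  define s4 where "s4 \<epsilon> = - (u$1 * t$1 + v2 \<epsilon> * s2 \<epsilon> + v3 \<epsilon> * s3 \<epsilon>) / v4 \<epsilon>" for \<epsilon>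
  define D where "D \<epsilon> = cubic_disc (- v2 \<epsilon> * c) (v2 \<epsilon> * a + (v2 \<epsilon> + v4 \<epsilon>) * c + (v3 \<epsilon> + v4 \<epsilon>) * e)
        (- (v3 \<epsilon> * e + (v3 \<epsilon> + v4 \<epsilon>) * b + (v2 \<epsilon> + v4 \<epsilon>) * a)) (v3 \<epsilon> * b)" for \<epsilon>
  define X where "X \<epsilon> = (vector [v2 \<epsilon> + v4 \<epsilon>, v3 \<epsilon> + v4 \<epsilon>, v2 \<epsilon> + v3 \<epsilon>, s2 \<epsilon> / u$1, s3 \<epsilon> / u$1,
     s4 \<epsilon> / u$1, - (v2 \<epsilon> * v3 \<epsilon> * v4 \<epsilon>) / u$1 / D \<epsilon>] :: complex^7)" for \<epsilon>
  have lim: "v2 \<midarrow>0\<rightarrow> u$2" "v3 \<midarrow>0\<rightarrow> u$3" "v4 \<midarrow>0\<rightarrow> u$4"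
    unfolding v2_def v3_def v4_def by (auto intro!: tendsto_eq_intros)
  have t2: "t$2 = (u$2 * a - (u$2 + u$4) * c + u$1 * e) / u$2"
    using M(3) unz[of 2] by (simp add: eq_divide_eq mult.commute)
  have lim2: "s2 \<midarrow>0\<rightarrow> t$2"
    unfolding s2_def t2 using unz by (intro tendsto_intros lim) auto
  have t3: "t$3 = (u$3 * e - (u$3 + u$4) * b + u$1 * a) / u$3"
    using M(4) unz[of 3] by (simp add: eq_divide_eq mult.commute)
  have lim3: "s3 \<midarrow>0\<rightarrow> t$3"
    unfolding s3_def t3 using unz by (intro tendsto_intros lim) auto
  have "u$4 * t$4 = - (u$1 * t$1 + u$2 * t$2 + u$3 * t$3)"
    using ut by (simp add: algebra_simps eq_neg_iff_add_eq_0)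
  then have t4: "t$4 = - (u$1 * t$1 + u$2 * t$2 + u$3 * t$3) / u$4"
    using unz[of 4] by (simp add: eq_divide_eq mult.commute)
  have lim4: "s4 \<midarrow>0\<rightarrow> t$4"
    unfolding s4_def t4 using unz by (intro tendsto_intros lim lim2 lim3) auto
  define D0 where "D0 = cubic_disc (- u$2 * c) (u$2 * a + (u$2 + u$4) * c + (u$3 + u$4) * e)
         (- (u$3 * e + (u$3 + u$4) * b + (u$2 + u$4) * a)) (u$3 * b)"
  have limD: "D \<midarrow>0\<rightarrow> D0"
    unfolding D_def D0_def cubic_disc_def by (intro tendsto_intros lim)
  have D0: "D0 \<noteq> 0" using M(5) unz unfolding D0_def[symmetric] by auto
  have x7: "x$7 = - (u$2 * u$3 * u$4) / u$1 / D0"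
    using M(5) D0 unfolding D0_def[symmetric] by (subst nonzero_eq_divide_eq)
  have x123: "x$1 = u$2 + u$4" "x$2 = u$3 + u$4" "x$3 = u$2 + u$3"
    unfolding u_def by (simp_all add: chart_u_relations)
  have x456: "x$4 = t$2 / u$1" "x$5 = t$3 / u$1" "x$6 = t$4 / u$1"
    using unz[of 1] unfolding u_def t_def by (simp_all add: chart_t_def)
  have X: "X \<midarrow>0\<rightarrow> x"
  proof (rule vec_tendstoI)
    have "\<forall>i. ((\<lambda>\<epsilon>. X \<epsilon> $ i) \<longlongrightarrow> x $ i) (at 0)"
      unfolding forall_7 X_def vector_7 x123 x456 x7
      using unz D0 by (intro conjI tendsto_intros lim lim2 lim3 lim4 limD) auto
    then show "((\<lambda>\<epsilon>. X \<epsilon> $ i) \<longlongrightarrow> x $ i) (at 0)" for i by blast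
  qed
  moreover have "eventually (\<lambda>\<epsilon>. (\<forall>k. chart_u (X \<epsilon>) $ k \<noteq> 0) \<and> X \<epsilon> $ 1 \<noteq> 0 \<and> X \<epsilon> $ 2 \<noteq> 0 \<and>
       X \<epsilon> $ 3 \<noteq> 0 \<and> realizable (chart_u (X \<epsilon>)) (chart_t (X \<epsilon>)) (X \<epsilon> $ 7)) (at 0)"
  proof -
    have ne: "eventually (\<lambda>\<epsilon>. \<epsilon> \<noteq> - u$2 \<and> \<epsilon> \<noteq> - u$3 \<and> \<epsilon> \<noteq> u$4 / 2 \<and> \<epsilon> \<noteq> u$2 + u$4 \<and> \<epsilon> \<noteq> u$3 + u$4
        \<and> \<epsilon> \<noteq> - (u$2 + u$3) / 2) (at 0)"
      by (intro eventually_conj eventually_neq_at_within)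
    moreover have "eventually (\<lambda>\<epsilon>. D \<epsilon> \<noteq> 0) (at 0)"
      using limD D0 by (rule tendsto_imp_eventually_ne)
    ultimately show ?thesis
    proof eventually_elim
      case (elim \<epsilon>)
      define u' where "u' = (vector [u$1, v2 \<epsilon>, v3 \<epsilon>, v4 \<epsilon>] :: complex^4)"
      define t' where "t' = (vector [t$1, s2 \<epsilon>, s3 \<epsilon>, s4 \<epsilon>] :: complex^4)"
      have v: "v2 \<epsilon> \<noteq> 0" "v3 \<epsilon> \<noteq> 0" "v4 \<epsilon> \<noteq> 0"
        using elim(1) by (auto simp: v2_def v3_def v4_def eq_neg_iff_add_eq_0 add.commute)
      have m: "v2 \<epsilon> + v4 \<epsilon> \<noteq> 0" "v3 \<epsilon> + v4 \<epsilon> \<noteq> 0" "v2 \<epsilon> + v3 \<epsilon> \<noteq> 0"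
        using elim(1) by (auto simp: v2_def v3_def v4_def field_simps eq_neg_iff_add_eq_0)
      have u'0: "u'$1 + u'$2 + u'$3 + u'$4 = 0"
        using u by (simp add: u'_def v2_def v3_def v4_def algebra_simps)
      have t'0: "u'$1 * t'$1 + u'$2 * t'$2 + u'$3 * t'$3 + u'$4 * t'$4 = 0"
        using v by (simp add: u'_def t'_def s4_def)
      have XX: "X \<epsilon> = vector [u'$2 + u'$4, u'$3 + u'$4, u'$2 + u'$3, t'$2 / u'$1, t'$3 / u'$1, t'$4 / u'$1, X \<epsilon> $ 7]"
        by (simp add: X_def u'_def t'_def)
      have ch: "chart_u (X \<epsilon>) = u'" "chart_t (X \<epsilon>) = t'"
        using chart_surj[of u' t' "X \<epsilon> $ 7"] u'0 t'0 unz[of 1] XX by (simp_all add: u'_def)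
      have "realizable u' t' (X \<epsilon> $ 7)"
        unfolding realizable_def
      proof (intro exI conjI)
        show "u'$1 * (a * e - b * c) = 1" using M(1) by (simp add: u'_def)
        show "t'$1 = - (a + e)" using M(2) by (simp add: t'_def)
        show "u'$2 * t'$2 = u'$2 * a - (u'$2 + u'$4) * c + u'$1 * e" using v by (simp add: u'_def t'_def s2_def)
        show "u'$3 * t'$3 = u'$3 * e - (u'$3 + u'$4) * b + u'$1 * a" using v by (simp add: u'_def t'_def s3_def)
        show "X \<epsilon> $ 7 * cubic_disc (- u'$2 * c) (u'$2 * a + (u'$2 + u'$4) * c + (u'$3 + u'$4) * e)
           (- (u'$3 * e + (u'$3 + u'$4) * b + (u'$2 + u'$4) * a)) (u'$3 * b) = - (u'$2 * u'$3 * u'$4) / u'$1"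
          using elim(2) by (simp add: u'_def X_def D_def)
      qed (rule t'0)
      then show ?case unfolding ch using v m unz[of 1] by (simp add: forall_4 u'_def X_def)
    qed
  qed
  ultimately show ?thesis using that by blast
qed

text \<open>After the division \<open>H\<close> is nonzero somewhere on each hyperplane, which is
  exactly what is required for pushing zeros off it. On the hyperplanes themselves
  \<open>N = 0\<close> says nothing about \<open>H\<close>, so there the vanishing of
  \<open>H\<close> at realizable points comes from the perturbation and continuity.\<close>

lemma missing_relation:
  obtains H where "cpolyfun H"
    "\<And>x. \<forall>k. chart_u x $ k \<noteq> 0 \<Longrightarrow> realizable (chart_u x) (chart_t x) (x$7) \<Longrightarrow> H x = 0"
    "\<And>x U. \<forall>k. chart_u x $ k \<noteq> 0 \<Longrightarrow> x$7 \<noteq> 0 \<Longrightarrow> H x = 0 \<Longrightarrow> open U \<Longrightarrow> x \<in> U \<Longrightarrow>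
       \<exists>y\<in>U. (\<forall>k. chart_u y $ k \<noteq> 0) \<and> y$7 \<noteq> 0 \<and> realizable (chart_u y) (chart_t y) (y$7)"
    "\<exists>x. (\<forall>k. chart_u x $ k \<noteq> 0) \<and> x$7 \<noteq> 0 \<and> H x \<noteq> 0"
proof -
  obtain N where N: "cpolyfun N"
    "\<And>x. \<forall>k. chart_u x $ k \<noteq> 0 \<Longrightarrow> x$1 \<noteq> 0 \<Longrightarrow> x$2 \<noteq> 0 \<Longrightarrow>
       realizable (chart_u x) (chart_t x) (x$7) \<Longrightarrow> N x = 0"
    "\<And>x. \<forall>k. chart_u x $ k \<noteq> 0 \<Longrightarrow> x$1 \<noteq> 0 \<Longrightarrow> x$2 \<noteq> 0 \<Longrightarrow> x$3 \<noteq> 0 \<Longrightarrow> x$7 \<noteq> 0 \<Longrightarrow>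
       N x = 0 \<Longrightarrow> realizable (chart_u x) (chart_t x) (x$7)"
    "\<And>x. \<forall>k. chart_u x $ k \<noteq> 0 \<Longrightarrow> x$1 \<noteq> 0 \<Longrightarrow> x$2 \<noteq> 0 \<Longrightarrow> x$3 \<noteq> 0 \<Longrightarrow> x$7 = 0 \<Longrightarrow> N x \<noteq> 0"
    using norm_polynomial by blast
  \<comment> \<open>Here \<open>u = (-3/2, 1/2, 1/2, 1/2)\<close> and \<open>\<Lambda> = 0\<close>.
    Moving in direction \<open>axis 7\<close> changes only \<Lambda>, so \<open>u\<close> is
    constant on that line.\<close>
  define p where "p = (vector [1, 1, 1, 0, 0, 0, 0] :: complex^7)"
  have pu: "chart_u (p + s *s axis 7 1) $ k \<noteq> 0" for s k
    using exhaust_4[of k] by (auto simp: chart_u_def p_def axis_def)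
  have "N p \<noteq> 0" using pu[of 0] by (intro N(4)) (simp_all add: p_def)
  obtain i g1 z1 where g1: "cpolyfun g1" "\<And>x. N x = (x$1)^i * g1 x" "z1$1 = 0" "g1 z1 \<noteq> 0"
    using cpolyfun_factor_nth[OF N(1) \<open>N p \<noteq> 0\<close>, of 1] by metis
  obtain j g2 z2 where g2: "cpolyfun g2" "\<And>x. g1 x = (x$2)^j * g2 x" "z2$2 = 0" "g2 z2 \<noteq> 0"
    using cpolyfun_factor_nth[OF g1(1,4), of 2] by metis
  obtain k H z3 where H: "cpolyfun H" "\<And>x. g2 x = (x$3)^k * H x" "z3$3 = 0" "H z3 \<noteq> 0"
    using cpolyfun_factor_nth[OF g2(1,4), of 3] by metis
  have NH: "N x = (x$1)^i * (x$2)^j * (x$3)^k * H x" for x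
    unfolding g1(2) g2(2) H(2) by (simp add: mult_ac)
  \<comment> \<open>\<open>H\<close> divides \<open>g1\<close> and \<open>g2\<close>, so the points
    found for the first two hyperplanes are witnesses for \<open>H\<close> too.\<close>
  have z: "H z1 \<noteq> 0" "H z2 \<noteq> 0" using g1(4) g2(4) unfolding g2(2) H(2) by auto
  have contH: "continuous_on UNIV H" using H(1) by (rule cpolyfun_continuous)
  show ?thesis
  proof (rule that[OF H(1)])
    show "H x = 0" if x: "\<forall>k. chart_u x $ k \<noteq> 0" "realizable (chart_u x) (chart_t x) (x$7)" for x
    proof -
      obtain X where X: "X \<midarrow>0\<rightarrow> x"
        "eventually (\<lambda>\<epsilon>::complex. (\<forall>k. chart_u (X \<epsilon>) $ k \<noteq> 0) \<and> X \<epsilon> $ 1 \<noteq> 0 \<and> X \<epsilon> $ 2 \<noteq> 0 \<and>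
          X \<epsilon> $ 3 \<noteq> 0 \<and> realizable (chart_u (X \<epsilon>)) (chart_t (X \<epsilon>)) (X \<epsilon> $ 7)) (at 0)"
        using realizable_perturb[OF x(1)[rule_format] x(2)] by blast
      have "((\<lambda>\<epsilon>. H (X \<epsilon>)) \<longlongrightarrow> H x) (at 0)"
        using continuous_on_tendsto_compose[OF contH X(1)] by simp
      moreover have "eventually (\<lambda>\<epsilon>. H (X \<epsilon>) = 0) (at 0)"
        using X(2)
      proof eventually_elim
        case (elim \<epsilon>)
        then have "N (X \<epsilon>) = 0" using N(2) by blast
        then show ?case using elim unfolding NH by simp
      qed
      then have "((\<lambda>\<epsilon>. H (X \<epsilon>)) \<longlongrightarrow> 0) (at 0)" by (rule tendsto_eventually)
      ultimately show "H x = 0" using tendsto_unique[OF at_neq_bot] by blast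
    qed
    show "\<exists>y\<in>U. (\<forall>k. chart_u y $ k \<noteq> 0) \<and> y$7 \<noteq> 0 \<and> realizable (chart_u y) (chart_t y) (y$7)"
      if x: "\<forall>k. chart_u x $ k \<noteq> 0" "x$7 \<noteq> 0" "H x = 0" and U: "open U" "x \<in> U" for x U
    proof -
      have openne: "open {y. f y \<noteq> 0}" if "cpolyfun f" for f :: "complex^7 \<Rightarrow> complex"
        using open_vimage[OF open_Compl[OF closed_singleton[of 0]] cpolyfun_continuous[OF that]]
        by (simp add: vimage_def)
      \<comment> \<open>The open conditions on the \<open>u\<^sub>k\<close> and on \<Lambda> are
        built into the neighbourhood, and after each push also the coordinate just made nonzero, so
        that later pushes do not undo earlier ones.\<close>
      define V where "V = {y. chart_u y $ 1 \<noteq> 0} \<inter> {y. chart_u y $ 2 \<noteq> 0} \<inter> {y. chart_u y $ 3 \<noteq> 0}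
        \<inter> {y. chart_u y $ 4 \<noteq> 0} \<inter> {y. y $ 7 \<noteq> 0}"
      have V: "open (U \<inter> V)" unfolding V_def
        by (intro open_Int U openne cpolyfun_chart cpolyfun_nth)
      have "x \<in> U \<inter> V" using x U by (simp add: V_def)
      then obtain x1 where x1: "x1 \<in> U \<inter> V" "H x1 = 0" "x1$1 \<noteq> 0"
        using cpolyfun_zero_off_hyperplane[OF H(1) x(3) V _ g1(3) z(1)] by metis
      have V1: "open (U \<inter> V \<inter> {y. y$1 \<noteq> 0})" by (intro open_Int V openne cpolyfun_nth)
      have "x1 \<in> U \<inter> V \<inter> {y. y$1 \<noteq> 0}" using x1 by simp
      then obtain x2 where x2: "x2 \<in> U \<inter> V \<inter> {y. y$1 \<noteq> 0}" "H x2 = 0" "x2$2 \<noteq> 0"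
        using cpolyfun_zero_off_hyperplane[OF H(1) x1(2) V1 _ g2(3) z(2)] by metis
      have V2: "open (U \<inter> V \<inter> {y. y$1 \<noteq> 0} \<inter> {y. y$2 \<noteq> 0})" by (intro open_Int V1 openne cpolyfun_nth)
      have "x2 \<in> U \<inter> V \<inter> {y. y$1 \<noteq> 0} \<inter> {y. y$2 \<noteq> 0}" using x2 by simp
      then obtain y where y: "y \<in> U \<inter> V \<inter> {y. y$1 \<noteq> 0} \<inter> {y. y$2 \<noteq> 0}" "H y = 0" "y$3 \<noteq> 0"
        using cpolyfun_zero_off_hyperplane[OF H(1) x2(2) V2 _ H(3,4)] by metis
      have yu: "chart_u y $ k \<noteq> 0" for k using y(1) exhaust_4[of k] by (auto simp: V_def)
      have "realizable (chart_u y) (chart_t y) (y$7)"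
        using y yu by (intro N(3)) (auto simp: V_def NH)
      then show ?thesis using y yu by (intro bexI[of _ y]) (auto simp: V_def)
    qed
    show "\<exists>x. (\<forall>k. chart_u x $ k \<noteq> 0) \<and> x$7 \<noteq> 0 \<and> H x \<noteq> 0"
    proof -
      \<comment> \<open>\<open>H\<close> is nonzero at \<open>p\<close>, where
        \<open>\<Lambda> = 0\<close>. As a nonzero polynomial in \<Lambda> along this line it is
        also nonzero at some \<open>\<Lambda> \<noteq> 0\<close>, which nonzero characteristic
        numbers demand.\<close>
      obtain q where q: "\<And>s. H (p + s *s axis 7 1) = poly q s"
        using cpolyfun_line[OF H(1)] by blast
      have "poly q 0 \<noteq> 0" using q[of 0] \<open>N p \<noteq> 0\<close> unfolding NH by auto
      then have "q \<noteq> 0" by auto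
      then have "finite (insert 0 {s. poly q s = 0})" using poly_roots_finite by blast
      then obtain s where "s \<notin> insert 0 {s. poly q s = 0}"
        using ex_new_if_finite[OF infinite_UNIV_char_0] by blast
      then show ?thesis using pu q by (intro exI[of _ "p + s *s axis 7 1"]) (auto simp: p_def axis_def)
    qed
  qed
qed


section \<open>Evaluation of polynomials\<close>

lemma mpoly_eval_superset:
  assumes "finite S" "Poly_Mapping.keys p \<subseteq> S"
  shows "mpoly_eval p x = (\<Sum>m\<in>S. Poly_Mapping.lookup p m *
     (\<Prod>i\<in>Poly_Mapping.keys m. x i ^ Poly_Mapping.lookup m i))"
  unfolding mpoly_eval_def
  by (rule sum.mono_neutral_left) (use assms in \<open>auto simp: in_keys_iff\<close>)

lemma mpoly_eval_zero [simp]: "mpoly_eval 0 x = 0"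
  by (simp add: mpoly_eval_def)

lemma mpoly_eval_add: "mpoly_eval (p + q) x = mpoly_eval p x + mpoly_eval q x"
proof -
  define S where "S = Poly_Mapping.keys p \<union> Poly_Mapping.keys q"
  have S: "finite S" "Poly_Mapping.keys p \<subseteq> S" "Poly_Mapping.keys q \<subseteq> S"
    "Poly_Mapping.keys (p + q) \<subseteq> S"
    using Poly_Mapping.keys_add[of p q] by (auto simp: S_def)
  show ?thesis
    unfolding mpoly_eval_superset[OF S(1,2)] mpoly_eval_superset[OF S(1,3)]
      mpoly_eval_superset[OF S(1,4)]
    by (simp add: lookup_add sum.distrib distrib_right)
qed

lemma mpoly_eval_sum: "mpoly_eval (\<Sum>a\<in>A. p a) x = (\<Sum>a\<in>A. mpoly_eval (p a) x)"
  by (induction A rule: infinite_finite_induct) (simp_all add: mpoly_eval_add)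

lemma mpoly_eval_single:
  "mpoly_eval (Poly_Mapping.single m c) x = c * (\<Prod>i\<in>Poly_Mapping.keys m. x i ^ Poly_Mapping.lookup m i)"
  by (simp add: mpoly_eval_superset[of "{m}"])

lemma monomial_superset:
  assumes "finite S" "Poly_Mapping.keys m \<subseteq> S"
  shows "(\<Prod>i\<in>Poly_Mapping.keys m. (x i :: 'a::comm_semiring_1) ^ Poly_Mapping.lookup m i)
    = (\<Prod>i\<in>S. x i ^ Poly_Mapping.lookup m i)"
  by (rule prod.mono_neutral_left) (use assms in \<open>auto simp: in_keys_iff\<close>)

lemma monomial_add:
  fixes m m' :: "'i \<Rightarrow>\<^sub>0 nat" and x :: "'i \<Rightarrow> 'a::comm_semiring_1"
  shows "(\<Prod>i\<in>Poly_Mapping.keys (m + m'). x i ^ Poly_Mapping.lookup (m + m') i)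
    = (\<Prod>i\<in>Poly_Mapping.keys m. x i ^ Poly_Mapping.lookup m i)
      * (\<Prod>i\<in>Poly_Mapping.keys m'. x i ^ Poly_Mapping.lookup m' i)"
proof -
  define S where "S = Poly_Mapping.keys m \<union> Poly_Mapping.keys m'"
  have S: "finite S" "Poly_Mapping.keys m \<subseteq> S" "Poly_Mapping.keys m' \<subseteq> S"
    "Poly_Mapping.keys (m + m') \<subseteq> S"
    using Poly_Mapping.keys_add[of m m'] by (auto simp: S_def)
  show ?thesis
    unfolding monomial_superset[OF S(1,2)] monomial_superset[OF S(1,3)] monomial_superset[OF S(1,4)]
    by (simp add: lookup_add power_add prod.distrib)
qed

lemma mpoly_eval_mult_ex:
  "\<exists>r. \<forall>x. mpoly_eval r x = mpoly_eval p x * mpoly_eval q x"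
proof (intro exI allI)
  fix x
  show "mpoly_eval (\<Sum>m\<in>Poly_Mapping.keys p. \<Sum>m'\<in>Poly_Mapping.keys q.
      Poly_Mapping.single (m + m') (Poly_Mapping.lookup p m * Poly_Mapping.lookup q m')) x
    = mpoly_eval p x * mpoly_eval q x"
    unfolding mpoly_eval_sum mpoly_eval_single monomial_add mpoly_eval_def[of p] mpoly_eval_def[of q]
      sum_product
    by (simp add: mult_ac)
qed

lemma mpoly_eval_const: "mpoly_eval (Poly_Mapping.single 0 c) x = c"
  by (simp add: mpoly_eval_single)

lemma mpoly_eval_var: "mpoly_eval (Poly_Mapping.single (Poly_Mapping.single i 1) 1) x = x i"
  by (simp add: mpoly_eval_single)

lemma mpoly_eval_tendsto:
  fixes X :: "'b \<Rightarrow> 'i \<Rightarrow> complex"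
  assumes "\<And>i. ((\<lambda>n. X n i) \<longlongrightarrow> x i) G"
  shows "((\<lambda>n. mpoly_eval p (X n)) \<longlongrightarrow> mpoly_eval p x) G"
  unfolding mpoly_eval_def by (intro tendsto_intros assms)

lemma monomial_2:
  fixes m :: "2 \<Rightarrow>\<^sub>0 nat" and x :: "2 \<Rightarrow> 'a::comm_semiring_1"
  shows "(\<Prod>i\<in>Poly_Mapping.keys m. x i ^ Poly_Mapping.lookup m i)
    = x 1 ^ Poly_Mapping.lookup m 1 * x 2 ^ Poly_Mapping.lookup m 2"
    "mon_degree m = Poly_Mapping.lookup m 1 + Poly_Mapping.lookup m 2"
proof -
  show "(\<Prod>i\<in>Poly_Mapping.keys m. x i ^ Poly_Mapping.lookup m i)
    = x 1 ^ Poly_Mapping.lookup m 1 * x 2 ^ Poly_Mapping.lookup m 2"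
    by (subst monomial_superset[of UNIV]) (simp_all, simp add: UNIV_2)
  have "mon_degree m = (\<Sum>i\<in>UNIV. Poly_Mapping.lookup m i)"
    unfolding mon_degree_def by (rule sum.mono_neutral_left) (auto simp: in_keys_iff)
  then show "mon_degree m = Poly_Mapping.lookup m 1 + Poly_Mapping.lookup m 2"
    by (simp add: sum_2)
qed

lemma lookup_hom_part:
  fixes p :: "('i, 'a::comm_monoid_add) mpoly"
  shows "Poly_Mapping.lookup (hom_part n p) m = (if mon_degree m = n then Poly_Mapping.lookup p m else 0)"
proof -
  have "Poly_Mapping.lookup (\<Sum>a\<in>A. f a) m = (\<Sum>a\<in>A. Poly_Mapping.lookup (f a) m)" for A and f :: "('i \<Rightarrow>\<^sub>0 nat) \<Rightarrow> ('i, 'a) mpoly"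
    by (induction A rule: infinite_finite_induct) (simp_all add: lookup_add)
  then show ?thesis unfolding hom_part_def
    by (simp add: lookup_single when_def in_keys_iff)
qed

lemma quadratic_coeffs:
  fixes p :: "(2, 'a::comm_semiring_1) mpoly"
  assumes "total_degree_le 2 p"
  obtains c00 c10 c01 c20 c11 c02 where
    "\<And>x. mpoly_eval p x = c00 + c10 * x 1 + c01 * x 2 + c20 * x 1 ^ 2 + c11 * (x 1 * x 2) + c02 * x 2 ^ 2"
    "\<And>x. mpoly_eval (hom_part 2 p) x = c20 * x 1 ^ 2 + c11 * (x 1 * x 2) + c02 * x 2 ^ 2"
proof -
  define mk :: "nat \<times> nat \<Rightarrow> 2 \<Rightarrow>\<^sub>0 nat" where
    "mk ij = Poly_Mapping.single 1 (fst ij) + Poly_Mapping.single 2 (snd ij)" for ij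
  define I :: "(nat \<times> nat) set" where "I = {(0,0), (1,0), (0,1), (2,0), (1,1), (0,2)}"
  have lk: "Poly_Mapping.lookup (mk ij) 1 = fst ij" "Poly_Mapping.lookup (mk ij) 2 = snd ij" for ij
    by (simp_all add: mk_def lookup_add lookup_single when_def)
  have inj: "inj_on mk I"
    by (rule inj_onI) (metis lk prod_eqI)
  have mk_id: "m = mk (Poly_Mapping.lookup m 1, Poly_Mapping.lookup m 2)" for m
    by (rule poly_mapping_eqI) (metis exhaust_2 lk fst_conv snd_conv)
  have sub: "Poly_Mapping.keys q \<subseteq> mk ` I" if "total_degree_le 2 q" for q :: "(2, 'a) mpoly"
  proof
    fix m assume "m \<in> Poly_Mapping.keys q"
    then have "Poly_Mapping.lookup m 1 + Poly_Mapping.lookup m 2 \<le> 2"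
      using that unfolding total_degree_le_def monomial_2(2) by blast
    then have "(Poly_Mapping.lookup m 1, Poly_Mapping.lookup m 2) \<in> I"
      unfolding I_def by auto
    then show "m \<in> mk ` I" using mk_id[of m] by blast
  qed
  have ev: "mpoly_eval q x = (\<Sum>ij\<in>I. Poly_Mapping.lookup q (mk ij) * (x 1 ^ fst ij * x 2 ^ snd ij))"
    if "total_degree_le 2 q" for q :: "(2, 'a) mpoly" and x
  proof -
    have "finite (mk ` I)" by (simp add: I_def)
    from mpoly_eval_superset[OF this sub[OF that]] show ?thesis
      by (simp add: sum.reindex[OF inj] monomial_2(1) lk)
  qed
  have "total_degree_le 2 (hom_part 2 p)"
    by (auto simp: total_degree_le_def in_keys_iff lookup_hom_part split: if_splits)
  note evh = ev[OF this]
  show ?thesis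
  proof (rule that)
    show "mpoly_eval p x = Poly_Mapping.lookup p (mk (0,0)) + Poly_Mapping.lookup p (mk (1,0)) * x 1
      + Poly_Mapping.lookup p (mk (0,1)) * x 2 + Poly_Mapping.lookup p (mk (2,0)) * x 1 ^ 2
      + Poly_Mapping.lookup p (mk (1,1)) * (x 1 * x 2) + Poly_Mapping.lookup p (mk (0,2)) * x 2 ^ 2" for x
      unfolding ev[OF assms] by (simp add: I_def add_ac)
    show "mpoly_eval (hom_part 2 p) x = Poly_Mapping.lookup p (mk (2,0)) * x 1 ^ 2
      + Poly_Mapping.lookup p (mk (1,1)) * (x 1 * x 2) + Poly_Mapping.lookup p (mk (0,2)) * x 2 ^ 2" for x
      unfolding evh lookup_hom_part monomial_2(2) lk by (simp add: I_def add_ac)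
  qed
qed

text \<open>The coefficients of \<open>hom_part 2 p\<close> are not read off from the monomials.
  \<open>quadratic_coeffs\<close> supplies some expansion of the same \<open>p\<close>, and the
  values at (0,0), (1,0), (-1,0), (0,1), (0,-1) and (1,1) identify it with the prescribed
  one.\<close>

lemma quadratic_ex:
  fixes c00 c10 c01 c20 c11 c02 :: "'a::field_char_0"
  obtains p :: "(2, 'a) mpoly" where "total_degree_le 2 p"
    "\<And>x. mpoly_eval p x = c00 + c10 * x 1 + c01 * x 2 + c20 * x 1 ^ 2 + c11 * (x 1 * x 2) + c02 * x 2 ^ 2"
    "\<And>x. mpoly_eval (hom_part 2 p) x = c20 * x 1 ^ 2 + c11 * (x 1 * x 2) + c02 * x 2 ^ 2"
proof -
  define e1 e2 :: "2 \<Rightarrow>\<^sub>0 nat" where "e1 = Poly_Mapping.single 1 1" and "e2 = Poly_Mapping.single 2 1"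
  define p where "p = Poly_Mapping.single 0 c00 + Poly_Mapping.single e1 c10 + Poly_Mapping.single e2 c01
    + Poly_Mapping.single (e1 + e1) c20 + Poly_Mapping.single (e1 + e2) c11 + Poly_Mapping.single (e2 + e2) c02"
  have deg: "mon_degree m \<le> 2" if "m \<in> {0, e1, e2, e1 + e1, e1 + e2, e2 + e2}" for m
    using that by (auto simp: monomial_2(2) e1_def e2_def lookup_add lookup_single when_def)
  have "Poly_Mapping.keys p \<subseteq> {0, e1, e2, e1 + e1, e1 + e2, e2 + e2}"
    unfolding p_def
    by (intro subset_trans[OF Poly_Mapping.keys_add] Un_least subset_trans[OF keys_single[THEN equalityD1]]) auto
  then have td: "total_degree_le 2 p" using deg unfolding total_degree_le_def by blast
  have ev: "mpoly_eval p x = c00 + c10 * x 1 + c01 * x 2 + c20 * x 1 ^ 2 + c11 * (x 1 * x 2) + c02 * x 2 ^ 2" for x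
    unfolding p_def mpoly_eval_add mpoly_eval_single monomial_add
    by (simp add: e1_def e2_def power2_eq_square)
  obtain d00 d10 d01 d20 d11 d02 where
    d: "\<And>x. mpoly_eval p x = d00 + d10 * x 1 + d01 * x 2 + d20 * x 1 ^ 2 + d11 * (x 1 * x 2) + d02 * x 2 ^ 2"
    "\<And>x. mpoly_eval (hom_part 2 p) x = d20 * x 1 ^ 2 + d11 * (x 1 * x 2) + d02 * x 2 ^ 2"
    using quadratic_coeffs[OF td] by metis
  have cd: "c00 + c10 * x + c01 * y + c20 * x^2 + c11 * (x * y) + c02 * y^2
    = d00 + d10 * x + d01 * y + d20 * x^2 + d11 * (x * y) + d02 * y^2" for x y
    using ev[of "\<lambda>i. if i = 1 then x else y"] d(1)[of "\<lambda>i. if i = 1 then x else y"] by simp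
  have c00: "c00 = d00" using cd[of 0 0] by simp
  have *: "c = d" if "c00 + b + c = d00 + b' + d" "c00 - b + c = d00 - b' + d" for b b' c d :: 'a
  proof -
    have "2 * c = (c00 + b + c) + (c00 - b + c) - 2 * c00" by (simp add: algebra_simps)
    also have "\<dots> = 2 * d" unfolding that unfolding c00 by (simp add: algebra_simps)
    finally show ?thesis by (metis mult_left_cancel zero_neq_numeral)
  qed
  have "c20 = d20" using *[of c10 c20 d10 d20] cd[of 1 0] cd[of "-1" 0] by simp
  moreover have "c02 = d02" using *[of c01 c02 d01 d02] cd[of 0 1] cd[of 0 "-1"] by simp
  moreover have "c11 = d11" using cd[of 1 0] cd[of 0 1] cd[of 1 1] c00 calculation by (simp add: algebra_simps)
  ultimately show ?thesis using td ev d(2) by (intro that[of p]) simp_all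
qed


section \<open>Covariants of homogeneous quadratic maps\<close>

definition quad_map :: "complex \<Rightarrow> complex \<Rightarrow> complex \<Rightarrow> complex \<Rightarrow> complex \<Rightarrow> complex \<Rightarrow> complex^2 \<Rightarrow> complex^2" where
  "quad_map a0 a1 a2 b0 b1 b2 u = vector [a0 * (u$1)^2 + a1 * (u$1 * u$2) + a2 * (u$2)^2,
     b0 * (u$1)^2 + b1 * (u$1 * u$2) + b2 * (u$2)^2]"

text \<open>The arguments are the coefficients of \<open>x^3\<close>, \<open>x^2 y\<close>,
  \<open>x y^2\<close> and \<open>y^3\<close> in the cubic form
  \<open>y P\<^sub>2 - x Q\<^sub>2\<close>.\<close>

definition quad_disc :: "complex \<Rightarrow> complex \<Rightarrow> complex \<Rightarrow> complex \<Rightarrow> complex \<Rightarrow> complex \<Rightarrow> complex" where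
  "quad_disc a0 a1 a2 b0 b1 b2 = cubic_disc (- b0) (a0 - b1) (a1 - b2) a2"

text \<open>The resultant of the two components, written through the minors of their coefficients,
  which makes its behaviour under coordinate changes visible.\<close>

definition quad_res :: "complex \<Rightarrow> complex \<Rightarrow> complex \<Rightarrow> complex \<Rightarrow> complex \<Rightarrow> complex \<Rightarrow> complex" where
  "quad_res a0 a1 a2 b0 b1 b2 = (a0 * b2 - a2 * b0)^2 - (a0 * b1 - a1 * b0) * (a1 * b2 - a2 * b1)"

text \<open>The linear functional on quadratic forms that vanishes on both components of the map (its
  coefficients are their \<open>2 \<times> 2\<close> minors), applied to the square of the divergence.\<close>
definition quad_div :: "complex \<Rightarrow> complex \<Rightarrow> complex \<Rightarrow> complex \<Rightarrow> complex \<Rightarrow> complex \<Rightarrow> complex" where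
  "quad_div a0 a1 a2 b0 b1 b2 = (2 * a0 + b1)^2 * (a1 * b2 - a2 * b1)
     - 2 * (2 * a0 + b1) * (a1 + 2 * b2) * (a0 * b2 - a2 * b0) + (a1 + 2 * b2)^2 * (a0 * b1 - a1 * b0)"

text \<open>Expresses the elementary symmetric functions of the \<lambda>'s as quotients with the
  discriminant as denominator, in cross-multiplied form. Discriminant, resultant and
  \<open>quad_div\<close> all acquire the squared determinant under a linear change of coordinates,
  so the relations do not depend on the coordinates.\<close>

definition infinity_relations ::
  "complex \<Rightarrow> complex \<Rightarrow> complex \<Rightarrow> complex \<Rightarrow> complex \<Rightarrow> complex \<Rightarrow> complex^3 \<Rightarrow> bool" where
  "infinity_relations a0 a1 a2 b0 b1 b2 l \<longleftrightarrow> l$1 + l$2 + l$3 = 1 \<and>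
     l$1 * l$2 * l$3 * quad_disc a0 a1 a2 b0 b1 b2 = - quad_res a0 a1 a2 b0 b1 b2 \<and>
     (l$1 * l$2 + l$1 * l$3 + l$2 * l$3) * quad_disc a0 a1 a2 b0 b1 b2
       = - 9 * quad_res a0 a1 a2 b0 b1 b2 - quad_div a0 a1 a2 b0 b1 b2"

lemma cubic_disc_scale: "cubic_disc (c * a) (c * b) (c * d) (c * e) = c^4 * cubic_disc a b d e"
  unfolding cubic_disc_def by (simp add: algebra_simps power2_eq_square power3_eq_cube power4_eq_xxxx)

text \<open>The arguments are the coefficients of \<open>c\<close> times the product of the linear
  forms \<open>k1 x + n1 y\<close>, \<open>k2 x + n2 y\<close>, \<open>k3 x + n3 y\<close>; the
  discriminant is governed by their pairwise determinants.\<close>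

lemma cubic_disc_factored:
  "cubic_disc (c * (k1 * k2 * k3)) (c * (k1 * k2 * n3 + k1 * n2 * k3 + n1 * k2 * k3))
     (c * (k1 * n2 * n3 + n1 * k2 * n3 + n1 * n2 * k3)) (c * (n1 * n2 * n3))
   = c^4 * ((k1 * n2 - k2 * n1) * (k1 * n3 - k3 * n1) * (k2 * n3 - k3 * n2))^2"
proof -
  have "cubic_disc (k1 * k2 * k3) (k1 * k2 * n3 + k1 * n2 * k3 + n1 * k2 * k3)
     (k1 * n2 * n3 + n1 * k2 * n3 + n1 * n2 * k3) (n1 * n2 * n3)
   = ((k1 * n2 - k2 * n1) * (k1 * n3 - k3 * n1) * (k2 * n3 - k3 * n2))^2"
    unfolding cubic_disc_def by algebra
  then show ?thesis by (simp add: cubic_disc_scale)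
qed

text \<open>The hypotheses say that the matrix with rows \<open>p, q\<close> and \<open>r, s\<close>
  conjugates one quadratic map into the other. Under it the minors transform like the coefficients
  \<open>m01, 2 m02, m12\<close> of a quadratic form, and the divergence like a linear form. The
  resultant is a discriminant of the former and \<open>quad_div\<close> pairs it with the square of
  the latter, so both gain the squared determinant. The last four claims are the transformation of
  the cubic form, coefficient by coefficient.\<close>

lemma quad_covariance:
  fixes p q r s :: complex
  defines "D \<equiv> p * s - q * r"
  assumes D: "D \<noteq> 0"
    and E: "p * a0 + q * b0 = a0' * p^2 + a1' * (p * r) + a2' * r^2"
      "p * a1 + q * b1 = 2 * a0' * (p * q) + a1' * (p * s + q * r) + 2 * a2' * (r * s)"
      "p * a2 + q * b2 = a0' * q^2 + a1' * (q * s) + a2' * s^2"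
      "r * a0 + s * b0 = b0' * p^2 + b1' * (p * r) + b2' * r^2"
      "r * a1 + s * b1 = 2 * b0' * (p * q) + b1' * (p * s + q * r) + 2 * b2' * (r * s)"
      "r * a2 + s * b2 = b0' * q^2 + b1' * (q * s) + b2' * s^2"
  shows "quad_res a0 a1 a2 b0 b1 b2 = D^2 * quad_res a0' a1' a2' b0' b1' b2'"
    and "quad_div a0 a1 a2 b0 b1 b2 = D^2 * quad_div a0' a1' a2' b0' b1' b2'"
    and "D * (- b0) = - b0' * p^3 + (a0' - b1') * (p^2 * r) + (a1' - b2') * (p * r^2) + a2' * r^3"
    and "D * (a0 - b1) = - b0' * (3 * p^2 * q) + (a0' - b1') * (p^2 * s + 2 * p * q * r)
       + (a1' - b2') * (2 * p * r * s + q * r^2) + a2' * (3 * r^2 * s)"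
    and "D * (a1 - b2) = - b0' * (3 * p * q^2) + (a0' - b1') * (2 * p * q * s + q^2 * r)
       + (a1' - b2') * (p * s^2 + 2 * q * r * s) + a2' * (3 * r * s^2)"
    and "D * a2 = - b0' * q^3 + (a0' - b1') * (q^2 * s) + (a1' - b2') * (q * s^2) + a2' * s^3"
proof -
  define m01 where "m01 = a0 * b1 - a1 * b0"
  define m02 where "m02 = a0 * b2 - a2 * b0"
  define m12 where "m12 = a1 * b2 - a2 * b1"
  define m01' where "m01' = a0' * b1' - a1' * b0'"
  define m02' where "m02' = a0' * b2' - a2' * b0'"
  define m12' where "m12' = a1' * b2' - a2' * b1'"
  define l1 l2 l1' l2' where "l1 = 2 * a0 + b1" and "l2 = a1 + 2 * b2"
    and "l1' = 2 * a0' + b1'" and "l2' = a1' + 2 * b2'"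
  have Da: "D * a0 = s * (p * a0 + q * b0) - q * (r * a0 + s * b0)"
    "D * a1 = s * (p * a1 + q * b1) - q * (r * a1 + s * b1)"
    "D * a2 = s * (p * a2 + q * b2) - q * (r * a2 + s * b2)"
    and Db: "D * b0 = p * (r * a0 + s * b0) - r * (p * a0 + q * b0)"
    "D * b1 = p * (r * a1 + s * b1) - r * (p * a1 + q * b1)"
    "D * b2 = p * (r * a2 + s * b2) - r * (p * a2 + q * b2)"
    unfolding D_def by algebra+
  have "D * m01 = D * (p^2 * m01' + 2 * (p * r) * m02' + r^2 * m12')"
  proof -
    have "D * m01 = (p * a0 + q * b0) * (r * a1 + s * b1) - (p * a1 + q * b1) * (r * a0 + s * b0)"
      unfolding D_def m01_def by algebra
    then show ?thesis unfolding E unfolding D_def m01'_def m02'_def m12'_def by algebra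
  qed
  then have m01: "m01 = p^2 * m01' + 2 * (p * r) * m02' + r^2 * m12'" using D by simp
  have "D * m02 = D * (p * q * m01' + (p * s + q * r) * m02' + r * s * m12')"
  proof -
    have "D * m02 = (p * a0 + q * b0) * (r * a2 + s * b2) - (p * a2 + q * b2) * (r * a0 + s * b0)"
      unfolding D_def m02_def by algebra
    then show ?thesis unfolding E unfolding D_def m01'_def m02'_def m12'_def by algebra
  qed
  then have m02: "m02 = p * q * m01' + (p * s + q * r) * m02' + r * s * m12'" using D by simp
  have "D * m12 = D * (q^2 * m01' + 2 * (q * s) * m02' + s^2 * m12')"
  proof -
    have "D * m12 = (p * a1 + q * b1) * (r * a2 + s * b2) - (p * a2 + q * b2) * (r * a1 + s * b1)"
      unfolding D_def m12_def by algebra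
    then show ?thesis unfolding E unfolding D_def m01'_def m02'_def m12'_def by algebra
  qed
  then have m12: "m12 = q^2 * m01' + 2 * (q * s) * m02' + s^2 * m12'" using D by simp
  have "D * l1 = D * (p * l1' + r * l2')"
  proof -
    have "D * l1 = 2 * (D * a0) + D * b1" unfolding l1_def by algebra
    then show ?thesis unfolding Da Db E unfolding D_def l1'_def l2'_def by algebra
  qed
  then have l1: "l1 = p * l1' + r * l2'" using D by simp
  have "D * l2 = D * (q * l1' + s * l2')"
  proof -
    have "D * l2 = D * a1 + 2 * (D * b2)" unfolding l2_def by algebra
    then show ?thesis unfolding Da Db E unfolding D_def l1'_def l2'_def by algebra
  qed
  then have l2: "l2 = q * l1' + s * l2'" using D by simp
  show "quad_res a0 a1 a2 b0 b1 b2 = D^2 * quad_res a0' a1' a2' b0' b1' b2'"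
    unfolding quad_res_def m01_def[symmetric] m02_def[symmetric] m12_def[symmetric]
      m01'_def[symmetric] m02'_def[symmetric] m12'_def[symmetric]
    unfolding m01 m02 m12 D_def by algebra
  show "quad_div a0 a1 a2 b0 b1 b2 = D^2 * quad_div a0' a1' a2' b0' b1' b2'"
    unfolding quad_div_def m01_def[symmetric] m02_def[symmetric] m12_def[symmetric]
      m01'_def[symmetric] m02'_def[symmetric] m12'_def[symmetric]
      l1_def[symmetric] l2_def[symmetric] l1'_def[symmetric] l2'_def[symmetric]
    unfolding m01 m02 m12 l1 l2 D_def by algebra
  have g: "D * (- b0) = - (D * b0)" "D * (a0 - b1) = D * a0 - D * b1" "D * (a1 - b2) = D * a1 - D * b2"
    by algebra+
  show "D * (- b0) = - b0' * p^3 + (a0' - b1') * (p^2 * r) + (a1' - b2') * (p * r^2) + a2' * r^3"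
    unfolding g unfolding Da Db E by algebra
  show "D * (a0 - b1) = - b0' * (3 * p^2 * q) + (a0' - b1') * (p^2 * s + 2 * p * q * r)
       + (a1' - b2') * (2 * p * r * s + q * r^2) + a2' * (3 * r^2 * s)"
    unfolding g unfolding Da Db E by algebra
  show "D * (a1 - b2) = - b0' * (3 * p * q^2) + (a0' - b1') * (2 * p * q * s + q^2 * r)
       + (a1' - b2') * (p * s^2 + 2 * q * r * s) + a2' * (3 * r * s^2)"
    unfolding g unfolding Da Db E by algebra
  show "D * a2 = - b0' * q^3 + (a0' - b1') * (q^2 * s) + (a1' - b2') * (q * s^2) + a2' * s^3"
    unfolding Da E by algebra
qed

text \<open>In the primed coordinates the cubic form is \<open>c\<close> times the product of the
  factors \<open>y' - w\<^sub>i x'\<close>. Written in the original coordinates, these have the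
  coefficients \<open>r - w\<^sub>i p\<close> and \<open>s - w\<^sub>i q\<close>, with pairwise
  determinants \<open>- D (w\<^sub>i - w\<^sub>j)\<close>. The power \<open>D^4\<close> appears
  because the discriminant has degree 4.\<close>

lemma quad_disc_factored:
  fixes p q r s :: complex
  assumes D: "p * s - q * r \<noteq> 0"
    and E: "p * a0 + q * b0 = a0' * p^2 + a1' * (p * r) + c * r^2"
      "p * a1 + q * b1 = 2 * a0' * (p * q) + a1' * (p * s + q * r) + 2 * c * (r * s)"
      "p * a2 + q * b2 = a0' * q^2 + a1' * (q * s) + c * s^2"
      "r * a0 + s * b0 = b0' * p^2 + b1' * (p * r) + b2' * r^2"
      "r * a1 + s * b1 = 2 * b0' * (p * q) + b1' * (p * s + q * r) + 2 * b2' * (r * s)"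
      "r * a2 + s * b2 = b0' * q^2 + b1' * (q * s) + b2' * s^2"
    and b: "b2' = a1' + c * (w1 + w2 + w3)" "b1' = a0' - c * (w1 * w2 + w1 * w3 + w2 * w3)"
      "b0' = c * (w1 * w2 * w3)"
  shows "(p * s - q * r)^4 * quad_disc a0 a1 a2 b0 b1 b2
       = c^4 * (p * s - q * r)^6 * ((w1 - w2) * (w1 - w3) * (w2 - w3))^2"
proof -
  define D where "D = p * s - q * r"
  note cov = quad_covariance[OF assms(1) E, folded D_def]
  define k1 k2 k3 n1 n2 n3 where "k1 = r - w1 * p" "k2 = r - w2 * p" "k3 = r - w3 * p"
    "n1 = s - w1 * q" "n2 = s - w2 * q" "n3 = s - w3 * q"
  note kn = this
  have g: "- b0' = - c * (w1 * w2 * w3)" "a0' - b1' = c * (w1 * w2 + w1 * w3 + w2 * w3)"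
    "a1' - b2' = - c * (w1 + w2 + w3)"
    using b by (simp_all add: algebra_simps)
  have "D^4 * quad_disc a0 a1 a2 b0 b1 b2
      = cubic_disc (D * (- b0)) (D * (a0 - b1)) (D * (a1 - b2)) (D * a2)"
    unfolding quad_disc_def cubic_disc_scale ..
  also have "\<dots> = cubic_disc (c * (k1 * k2 * k3)) (c * (k1 * k2 * n3 + k1 * n2 * k3 + n1 * k2 * k3))
     (c * (k1 * n2 * n3 + n1 * k2 * n3 + n1 * n2 * k3)) (c * (n1 * n2 * n3))"
  proof -
    have "D * (- b0) = c * (k1 * k2 * k3)" unfolding cov g kn by algebra
    moreover have "D * (a0 - b1) = c * (k1 * k2 * n3 + k1 * n2 * k3 + n1 * k2 * k3)"
      unfolding cov g kn by algebra
    moreover have "D * (a1 - b2) = c * (k1 * n2 * n3 + n1 * k2 * n3 + n1 * n2 * k3)"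
      unfolding cov g kn by algebra
    moreover have "D * a2 = c * (n1 * n2 * n3)"
      unfolding cov g kn by algebra
    ultimately show ?thesis by simp
  qed
  also have "\<dots> = c^4 * D^6 * ((w1 - w2) * (w1 - w3) * (w2 - w3))^2"
  proof -
    have "k1 * n2 - k2 * n1 = - (D * (w1 - w2))" "k1 * n3 - k3 * n1 = - (D * (w1 - w3))"
      "k2 * n3 - k3 * n2 = - (D * (w2 - w3))"
      unfolding kn D_def by algebra+
    then show ?thesis unfolding cubic_disc_factored by (simp add: power_mult_distrib)
  qed
  finally show ?thesis unfolding D_def .
qed

text \<open>In coordinates with singular directions \<open>(1 : w\<^sub>j)\<close> the \<lambda>'s
  are the residues of \<open>P\<^sub>2(1, \<omega>)\<close> divided by \<open>c (\<omega> -
  w\<^sub>1) (\<omega> - w\<^sub>2) (\<omega> - w\<^sub>3)\<close>. The equations \<open>a\<close>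
  recover the numerator from the partial fractions, and \<open>b\<close> says that the
  \<open>w\<^sub>j\<close> are the roots of the cubic form. Once \<open>l$3\<close> is eliminated,
  the relations are polynomial identities in these coordinates, and covariance carries them
  back.\<close>

lemma infinity_relations_covariant:
  fixes p q r s :: complex and l :: "complex^3"
  assumes D: "p * s - q * r \<noteq> 0"
    and E: "p * a0 + q * b0 = a0' * p^2 + a1' * (p * r) + c * r^2"
      "p * a1 + q * b1 = 2 * a0' * (p * q) + a1' * (p * s + q * r) + 2 * c * (r * s)"
      "p * a2 + q * b2 = a0' * q^2 + a1' * (q * s) + c * s^2"
      "r * a0 + s * b0 = b0' * p^2 + b1' * (p * r) + b2' * r^2"
      "r * a1 + s * b1 = 2 * b0' * (p * q) + b1' * (p * s + q * r) + 2 * b2' * (r * s)"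
      "r * a2 + s * b2 = b0' * q^2 + b1' * (q * s) + b2' * s^2"
    and l: "l$1 + l$2 + l$3 = 1"
    and a: "a1' = - c * (l$1 * (w2 + w3) + l$2 * (w1 + w3) + l$3 * (w1 + w2))"
      "a0' = c * (l$1 * w2 * w3 + l$2 * w1 * w3 + l$3 * w1 * w2)"
    and b: "b2' = a1' + c * (w1 + w2 + w3)" "b1' = a0' - c * (w1 * w2 + w1 * w3 + w2 * w3)"
      "b0' = c * (w1 * w2 * w3)"
  shows "infinity_relations a0 a1 a2 b0 b1 b2 l"
proof -
  define D where "D = p * s - q * r"
  have D0: "D \<noteq> 0" using assms(1) by (simp add: D_def)
  note cov = quad_covariance[OF assms(1) E, folded D_def]
  have g: "- b0' = - c * (w1 * w2 * w3)" "a0' - b1' = c * (w1 * w2 + w1 * w3 + w2 * w3)"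
    "a1' - b2' = - c * (w1 + w2 + w3)"
    using b by (simp_all add: algebra_simps)
  have disc': "quad_disc a0' a1' c b0' b1' b2' = c^4 * ((w1 - w2) * (w1 - w3) * (w2 - w3))^2"
    unfolding quad_disc_def g cubic_disc_def by algebra
  have disc4: "D^4 * quad_disc a0 a1 a2 b0 b1 b2
      = c^4 * D^6 * ((w1 - w2) * (w1 - w3) * (w2 - w3))^2"
    unfolding D_def by (rule quad_disc_factored[OF D E b])
  have "D^4 * quad_disc a0 a1 a2 b0 b1 b2 = D^4 * (D^2 * quad_disc a0' a1' c b0' b1' b2')"
    unfolding disc' disc4 by algebra
  then have disc: "quad_disc a0 a1 a2 b0 b1 b2 = D^2 * quad_disc a0' a1' c b0' b1' b2'"
    using D0 by (metis mult_left_cancel power_not_zero)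
  have l3: "l$3 = 1 - l$1 - l$2" using l by (simp add: algebra_simps)
  have "infinity_relations a0' a1' c b0' b1' b2' l"
    unfolding infinity_relations_def
  proof (intro conjI l)
    show "l$1 * l$2 * l$3 * quad_disc a0' a1' c b0' b1' b2' = - quad_res a0' a1' c b0' b1' b2'"
      unfolding disc' unfolding quad_res_def b a l3 by algebra
    show "(l$1 * l$2 + l$1 * l$3 + l$2 * l$3) * quad_disc a0' a1' c b0' b1' b2'
        = - 9 * quad_res a0' a1' c b0' b1' b2' - quad_div a0' a1' c b0' b1' b2'"
      unfolding disc' unfolding quad_res_def quad_div_def b a l3 by algebra
  qed
  then show "infinity_relations a0 a1 a2 b0 b1 b2 l"
    unfolding infinity_relations_def disc cov(1,2) by algebra
qed


section \<open>Quadratic fields near the line at infinity\<close>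

definition vfield_coeffs ::
  "vfield \<Rightarrow> complex^2 \<Rightarrow> complex^2^2 \<Rightarrow> complex \<Rightarrow> complex \<Rightarrow> complex \<Rightarrow> complex \<Rightarrow> complex \<Rightarrow> complex \<Rightarrow> bool" where
  "vfield_coeffs v c B a0 a1 a2 b0 b1 b2 \<longleftrightarrow> quadratic v \<and>
     (\<forall>u. vf_at v u = c + B *v u + quad_map a0 a1 a2 b0 b1 b2 u) \<and>
     (\<forall>u. inf_form v u = u$2 * quad_map a0 a1 a2 b0 b1 b2 u $ 1 - u$1 * quad_map a0 a1 a2 b0 b1 b2 u $ 2)"

lemma matrix_vector_mult_2:
  fixes A :: "'a::comm_semiring_1^2^2"
  shows "(A *v u) $ 1 = A$1$1 * u$1 + A$1$2 * u$2" "(A *v u) $ 2 = A$2$1 * u$1 + A$2$2 * u$2"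
  by (simp_all add: matrix_vector_mult_def sum_2)

lemma vfield_coeffs_of_quadratic:
  assumes "quadratic v"
  obtains c B a0 a1 a2 b0 b1 b2 where "vfield_coeffs v c B a0 a1 a2 b0 b1 b2"
proof -
  obtain c00 c10 c01 c20 c11 c02 where c:
    "\<And>x. mpoly_eval (fst v) x = c00 + c10 * x 1 + c01 * x 2 + c20 * x 1 ^ 2 + c11 * (x 1 * x 2) + c02 * x 2 ^ 2"
    "\<And>x. mpoly_eval (hom_part 2 (fst v)) x = c20 * x 1 ^ 2 + c11 * (x 1 * x 2) + c02 * x 2 ^ 2"
    using quadratic_coeffs[of "fst v"] assms unfolding quadratic_def by blast
  obtain d00 d10 d01 d20 d11 d02 where d:
    "\<And>x. mpoly_eval (snd v) x = d00 + d10 * x 1 + d01 * x 2 + d20 * x 1 ^ 2 + d11 * (x 1 * x 2) + d02 * x 2 ^ 2"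
    "\<And>x. mpoly_eval (hom_part 2 (snd v)) x = d20 * x 1 ^ 2 + d11 * (x 1 * x 2) + d02 * x 2 ^ 2"
    using quadratic_coeffs[of "snd v"] assms unfolding quadratic_def by blast
  have "vfield_coeffs v (vector [c00, d00]) (vector [vector [c10, c01], vector [d10, d01]]) c20 c11 c02 d20 d11 d02"
    unfolding vfield_coeffs_def
    by (simp add: assms vf_at_def inf_form_def c d vec_eq_iff forall_2 quad_map_def matrix_vector_mult_2)
  then show ?thesis using that by blast
qed

lemma vfield_coeffs_ex:
  obtains v where "vfield_coeffs v c B a0 a1 a2 b0 b1 b2"
proof -
  obtain p :: "(2, complex) mpoly" where p: "total_degree_le 2 p"
    "\<And>x. mpoly_eval p x = c$1 + B$1$1 * x 1 + B$1$2 * x 2 + a0 * x 1 ^ 2 + a1 * (x 1 * x 2) + a2 * x 2 ^ 2"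
    "\<And>x. mpoly_eval (hom_part 2 p) x = a0 * x 1 ^ 2 + a1 * (x 1 * x 2) + a2 * x 2 ^ 2"
    using quadratic_ex by blast
  obtain q :: "(2, complex) mpoly" where q: "total_degree_le 2 q"
    "\<And>x. mpoly_eval q x = c$2 + B$2$1 * x 1 + B$2$2 * x 2 + b0 * x 1 ^ 2 + b1 * (x 1 * x 2) + b2 * x 2 ^ 2"
    "\<And>x. mpoly_eval (hom_part 2 q) x = b0 * x 1 ^ 2 + b1 * (x 1 * x 2) + b2 * x 2 ^ 2"
    using quadratic_ex by blast
  have "vfield_coeffs (p, q) c B a0 a1 a2 b0 b1 b2"
    unfolding vfield_coeffs_def
    by (simp add: quadratic_def vf_at_def inf_form_def p q vec_eq_iff forall_2 quad_map_def matrix_vector_mult_2)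
  then show ?thesis using that by blast
qed

lemma quad_map_conj_ex:
  fixes A A' :: "complex^2^2"
  obtains a0' a1' a2' b0' b1' b2' where
    "\<And>u. quad_map a0' a1' a2' b0' b1' b2' u = A *v quad_map a0 a1 a2 b0 b1 b2 (A' *v u)"
proof -
  let ?P = "A'$1$1" and ?Q = "A'$1$2" and ?R = "A'$2$1" and ?S = "A'$2$2"
  define k where "k x y z = (x * ?P^2 + y * (?P * ?R) + z * ?R^2,
    2 * x * (?P * ?Q) + y * (?P * ?S + ?Q * ?R) + 2 * z * (?R * ?S), x * ?Q^2 + y * (?Q * ?S) + z * ?S^2)" for x y z
  show ?thesis
    by (rule that[of "A$1$1 * fst (k a0 a1 a2) + A$1$2 * fst (k b0 b1 b2)"
          "A$1$1 * fst (snd (k a0 a1 a2)) + A$1$2 * fst (snd (k b0 b1 b2))"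
          "A$1$1 * snd (snd (k a0 a1 a2)) + A$1$2 * snd (snd (k b0 b1 b2))"
          "A$2$1 * fst (k a0 a1 a2) + A$2$2 * fst (k b0 b1 b2)"
          "A$2$1 * fst (snd (k a0 a1 a2)) + A$2$2 * fst (snd (k b0 b1 b2))"
          "A$2$1 * snd (snd (k a0 a1 a2)) + A$2$2 * snd (snd (k b0 b1 b2))"])
      (simp add: k_def vec_eq_iff forall_2 quad_map_def matrix_vector_mult_2 algebra_simps power2_eq_square)
qed

lemma quad_map_conj_coeffs:
  fixes A :: "complex^2^2"
  assumes "\<And>u. quad_map a0' a1' a2' b0' b1' b2' (A *v u) = A *v quad_map a0 a1 a2 b0 b1 b2 u"
  defines "p \<equiv> A$1$1" and "q \<equiv> A$1$2" and "r \<equiv> A$2$1" and "s \<equiv> A$2$2"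
  shows "p * a0 + q * b0 = a0' * p^2 + a1' * (p * r) + a2' * r^2"
    "p * a1 + q * b1 = 2 * a0' * (p * q) + a1' * (p * s + q * r) + 2 * a2' * (r * s)"
    "p * a2 + q * b2 = a0' * q^2 + a1' * (q * s) + a2' * s^2"
    "r * a0 + s * b0 = b0' * p^2 + b1' * (p * r) + b2' * r^2"
    "r * a1 + s * b1 = 2 * b0' * (p * q) + b1' * (p * s + q * r) + 2 * b2' * (r * s)"
    "r * a2 + s * b2 = b0' * q^2 + b1' * (q * s) + b2' * s^2"
proof -
  have *: "a0' * (p * x + q * y)^2 + a1' * ((p * x + q * y) * (r * x + s * y)) + a2' * (r * x + s * y)^2
     = p * (a0 * x^2 + a1 * (x * y) + a2 * y^2) + q * (b0 * x^2 + b1 * (x * y) + b2 * y^2)"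
    "b0' * (p * x + q * y)^2 + b1' * ((p * x + q * y) * (r * x + s * y)) + b2' * (r * x + s * y)^2
     = r * (a0 * x^2 + a1 * (x * y) + a2 * y^2) + s * (b0 * x^2 + b1 * (x * y) + b2 * y^2)" for x y
    using assms(1)[of "vector [x, y]"]
    by (simp_all add: vec_eq_iff forall_2 quad_map_def matrix_vector_mult_2 p_def q_def r_def s_def)
  show e: "p * a0 + q * b0 = a0' * p^2 + a1' * (p * r) + a2' * r^2"
    "p * a2 + q * b2 = a0' * q^2 + a1' * (q * s) + a2' * s^2"
    "r * a0 + s * b0 = b0' * p^2 + b1' * (p * r) + b2' * r^2"
    "r * a2 + s * b2 = b0' * q^2 + b1' * (q * s) + b2' * s^2"
    using *[of 1 0] *[of 0 1] by simp_all
  show "p * a1 + q * b1 = 2 * a0' * (p * q) + a1' * (p * s + q * r) + 2 * a2' * (r * s)"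
    using *(1)[of 1 1] e(1,2) by simp algebra
  show "r * a1 + s * b1 = 2 * b0' * (p * q) + b1' * (p * s + q * r) + 2 * b2' * (r * s)"
    using *(2)[of 1 1] e(3,4) by simp algebra
qed

definition quad_form :: "complex \<Rightarrow> complex \<Rightarrow> complex \<Rightarrow> complex \<Rightarrow> complex \<Rightarrow> complex \<Rightarrow> complex^2 \<Rightarrow> complex" where
  "quad_form a0 a1 a2 b0 b1 b2 u = u$2 * quad_map a0 a1 a2 b0 b1 b2 u $ 1 - u$1 * quad_map a0 a1 a2 b0 b1 b2 u $ 2"

lemma quad_form_conj:
  fixes A :: "complex^2^2"
  assumes "\<And>u. quad_map a0' a1' a2' b0' b1' b2' (A *v u) = A *v quad_map a0 a1 a2 b0 b1 b2 u"
  shows "quad_form a0' a1' a2' b0' b1' b2' (A *v u) = det A * quad_form a0 a1 a2 b0 b1 b2 u"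
  unfolding quad_form_def assms det_2 matrix_vector_mult_2 by algebra

section \<open>Directions at infinity and the slope of the foliation near them\<close>

lemma span_vec_1: "vec.span {u} = range (\<lambda>k. k *s u)" for u :: "complex^'n"
  by (simp add: vec.span_singleton)

lemma image_span_1: "(\<lambda>u. A *v u) ` vec.span {x} = vec.span {A *v x}" for A :: "complex^'n^'m"
  unfolding span_vec_1 by (auto simp: image_iff vector_scalar_commute)

lemma span_scale_1: "k \<noteq> 0 \<Longrightarrow> vec.span {k *s u} = vec.span {u}" for u :: "complex^'n"
proof -
  assume k: "k \<noteq> 0"
  show ?thesis unfolding span_vec_1
  proof (intro equalityI subsetI; clarsimp)
    fix a show "a *s u \<in> range (\<lambda>c. (c * k) *s u)"
      using k by (intro image_eqI[of _ _ "a / k"]) simp_all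
  next
    fix a show "(a * k) *s u \<in> range (\<lambda>c. c *s u)" by blast
  qed
qed

lemma span_affine_direction:
  fixes w :: complex
  assumes "vec.span {u} = vec.span {vector [1, w] :: complex^2}"
  shows "u = u$1 *s vector [1, w]"
proof -
  have "u \<in> vec.span {vector [1, w]}" using assms vec.span_base[of u "{u}"] by simp
  then obtain k where "u = k *s vector [1, w]" unfolding span_vec_1 by blast
  then show ?thesis by (simp add: vec_eq_iff forall_2)
qed

lemma quadratic_three_roots:
  fixes d0 d1 d2 :: complex
  assumes "x \<noteq> y" "x \<noteq> z" "y \<noteq> z"
    and "d0 + d1 * x + d2 * x^2 = 0" "d0 + d1 * y + d2 * y^2 = 0" "d0 + d1 * z + d2 * z^2 = 0"
  shows "d0 = 0 \<and> d1 = 0 \<and> d2 = 0"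
proof -
  have "(x - y) * (d1 + d2 * (x + y)) = 0" "(x - z) * (d1 + d2 * (x + z)) = 0"
    using assms(4-6) by algebra+
  then have e: "d1 + d2 * (x + y) = 0" "d1 + d2 * (x + z) = 0" using assms(1,2) by simp_all
  then have "(y - z) * d2 = 0" by algebra
  then have "d2 = 0" using assms(3) by simp
  then show ?thesis using e assms(4) by simp
qed

text \<open>As \<open>z\<close> tends to 0 the slope is \<open>z p / g + O(z^2)\<close>, where
  \<open>p\<close> and \<open>g\<close> are the values of \<open>P\<^sub>2\<close> and of the cubic
  form at \<open>(1, \<omega>)\<close>. Two coefficients of \<open>z\<close> agreeing up to
  \<open>O(z^2)\<close> are equal, so the condition in \<open>char_numbers\<close> determines the
  partial fraction sum at every nonsingular \<omega>.\<close>

lemma slope_bigo: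
  assumes v: "\<And>u. vf_at v u = c + B *v u + quad_map a0 a1 a2 b0 b1 b2 u"
    and G: "\<omega> * (a0 + a1 * \<omega> + a2 * \<omega>^2) - (b0 + b1 * \<omega> + b2 * \<omega>^2) \<noteq> 0"
  shows "(\<lambda>z. slope_dz_dw v z \<omega> - z * S) \<in> O[at 0](\<lambda>z. z^2) \<longleftrightarrow>
    S = (a0 + a1 * \<omega> + a2 * \<omega>^2) / (\<omega> * (a0 + a1 * \<omega> + a2 * \<omega>^2) - (b0 + b1 * \<omega> + b2 * \<omega>^2))"
proof -
  define p where "p = a0 + a1 * \<omega> + a2 * \<omega>^2"
  define q where "q = b0 + b1 * \<omega> + b2 * \<omega>^2"
  define g where "g = \<omega> * p - q"
  have g0: "g \<noteq> 0" using G by (simp add: g_def p_def q_def)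
  define m1 where "m1 = B$1$1 + B$1$2 * \<omega>"
  define m2 where "m2 = B$2$1 + B$2$2 * \<omega>"
  define F1 where "F1 z = p + m1 * z + c$1 * z^2" for z
  define F2 where "F2 z = q + m2 * z + c$2 * z^2" for z
  have slope: "slope_dz_dw v z \<omega> = - z * F1 z / (F2 z - \<omega> * F1 z)" if "z \<noteq> 0" for z
  proof -
    let ?f = "vf_at v (vector [1 / z, \<omega> / z])"
    have F: "?f $ 1 = F1 z / z^2" "?f $ 2 = F2 z / z^2"
      using that unfolding v
      by (simp_all add: F1_def F2_def p_def q_def m1_def m2_def quad_map_def matrix_vector_mult_2
          field_simps power2_eq_square)
    have "slope_dz_dw v z \<omega> = (- F1 z) / ((F2 z - \<omega> * F1 z) / z)"
      unfolding slope_dz_dw_def Let_def F using that by (simp add: field_simps power2_eq_square)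
    then show ?thesis by simp
  qed
  \<comment> \<open>The exact remainder divided by \<open>z^2\<close>. It has a finite limit at 0
    because its denominator tends to \<open>- g^2\<close>.\<close>
  define R where "R z = - (m1 * g + p * (m2 - \<omega> * m1) + (c$1 * g + p * (c$2 - \<omega> * c$1)) * z)
    / (g * (F2 z - \<omega> * F1 z))" for z
  have lim: "((\<lambda>z. F2 z - \<omega> * F1 z) \<longlongrightarrow> - g) (at 0)"
    unfolding F1_def F2_def g_def by (auto intro!: tendsto_eq_intros)
  have ne: "eventually (\<lambda>z. F2 z - \<omega> * F1 z \<noteq> 0) (at 0)"
    using lim by (rule tendsto_imp_eventually_ne) (use g0 in simp)
  have nz: "eventually (\<lambda>z::complex. z \<noteq> 0) (at 0)" by (rule eventually_neq_at_within)
  have eq: "eventually (\<lambda>z. (slope_dz_dw v z \<omega> - z * (p / g)) / z^2 = R z) (at 0)"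
    using ne nz
  proof eventually_elim
    case (elim z)
    have key: "- F1 z * g - p * (F2 z - \<omega> * F1 z)
      = - z * (m1 * g + p * (m2 - \<omega> * m1) + (c$1 * g + p * (c$2 - \<omega> * c$1)) * z)"
      unfolding F1_def F2_def g_def by algebra
    have "slope_dz_dw v z \<omega> - z * (p / g)
      = z * ((- F1 z * g - p * (F2 z - \<omega> * F1 z)) / (g * (F2 z - \<omega> * F1 z)))"
      unfolding slope[OF elim(2)] using elim g0
      by (simp add: divide_simps) algebra
    also have "\<dots> = z^2 * R z"
    proof -
      have "z * ((- z * K) / d) = z^2 * (- K / d)" for K d by (simp add: power2_eq_square)
      then show ?thesis unfolding key R_def .
    qed
    finally show ?case using elim by simp
  qed
  have "(R \<longlongrightarrow> - (m1 * g + p * (m2 - \<omega> * m1) + (c$1 * g + p * (c$2 - \<omega> * c$1)) * 0) / (g * - g)) (at 0)"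
    unfolding R_def using g0 by (intro tendsto_intros lim) auto
  then have "((\<lambda>z. (slope_dz_dw v z \<omega> - z * (p / g)) / z^2) \<longlongrightarrow>
      - (m1 * g + p * (m2 - \<omega> * m1) + (c$1 * g + p * (c$2 - \<omega> * c$1)) * 0) / (g * - g)) (at 0)"
    using tendsto_cong[OF eq] by blast
  then have main: "(\<lambda>z. slope_dz_dw v z \<omega> - z * (p / g)) \<in> O[at 0](\<lambda>z. z^2)"
    by (rule bigoI_tendsto) (use nz in \<open>auto elim: eventually_mono\<close>)
  show ?thesis
    unfolding p_def[symmetric] q_def[symmetric] g_def[symmetric]
  proof
    assume "S = p / g"
    then show "(\<lambda>z. slope_dz_dw v z \<omega> - z * S) \<in> O[at 0](\<lambda>z. z^2)" using main by simp
  next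
    assume "(\<lambda>z. slope_dz_dw v z \<omega> - z * S) \<in> O[at 0](\<lambda>z. z^2)"
    from sum_in_bigo(2)[OF main this] have "(\<lambda>z. z * (S - p / g)) \<in> O[at 0](\<lambda>z. z^2)"
      by (simp add: algebra_simps)
    then obtain C where "eventually (\<lambda>z. cmod (z * (S - p / g)) \<le> C * cmod (z^2)) (at 0)"
      by (rule landau_o.bigE)
    then have "eventually (\<lambda>z. cmod (S - p / g) \<le> C * cmod z) (at 0)"
      using nz
      by eventually_elim (simp add: norm_mult norm_power power2_eq_square)
    moreover have "((\<lambda>z::complex. C * cmod z) \<longlongrightarrow> C * cmod 0) (at 0)"
      by (intro tendsto_intros)
    ultimately have "cmod (S - p / g) \<le> C * cmod 0"
      by (intro tendsto_lowerbound[of _ _ "at (0::complex)"]) auto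
    then show "S = p / g" by simp
  qed
qed

text \<open>The coordinates \<open>A\<close> occurring in \<open>char_numbers\<close> and the
  coordinates \<open>N\<close> in which the relations are wanted are unrelated; covariance under
  \<open>A ** N\<close> connects them directly. Its hypotheses come from Vieta's formulas for the
  three directions and from comparing partial fractions.\<close>

lemma char_numbers_infinity_relations:
  assumes v: "vfield_coeffs v c B a0 a1 a2 b0 b1 b2"
    and q: "bij_betw q (UNIV :: 3 set) (inf_sing v)" and l: "char_numbers v q l"
    and N: "det N \<noteq> 0"
      "\<And>u. quad_map a0 a1 a2 b0 b1 b2 (N *v u) = N *v quad_map k0 k1 k2 m0 m1 m2 u"
  shows "infinity_relations k0 k1 k2 m0 m1 m2 l"
proof -
  obtain A v' w where A: "invertible A" "\<And>u. vf_at v' (A *v u) = A *v vf_at v u"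
    and qw: "\<And>j. (\<lambda>u. A *v u) ` q j = vec.span {vector [1, w $ j]}"
    and sl: "\<And>\<omega>. (\<forall>j. \<omega> \<noteq> w $ j) \<Longrightarrow>
      (\<lambda>z. slope_dz_dw v' z \<omega> - z * (\<Sum>j\<in>UNIV. l $ j / (\<omega> - w $ j))) \<in> O[at 0](\<lambda>z. z^2)"
    using l unfolding char_numbers_def linear_change_def by blast
  obtain A' where AA': "A ** A' = mat 1" "A' ** A = mat 1"
    using A(1) unfolding invertible_def by blast
  have A'A: "A' *v (A *v u) = u" "A *v (A' *v u) = u" for u
    by (simp_all add: matrix_vector_mul_assoc AA')
  have detA: "det A \<noteq> 0" using A(1) by (simp add: invertible_det_nz)
  obtain a0' a1' a2' b0' b1' b2' where
    qm: "\<And>u. quad_map a0' a1' a2' b0' b1' b2' u = A *v quad_map a0 a1 a2 b0 b1 b2 (A' *v u)"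
    using quad_map_conj_ex by blast
  have conj: "quad_map a0' a1' a2' b0' b1' b2' (A *v u) = A *v quad_map a0 a1 a2 b0 b1 b2 u" for u
    unfolding qm A'A ..
  have vf: "vf_at v u = c + B *v u + quad_map a0 a1 a2 b0 b1 b2 u"
    and iform: "inf_form v u = quad_form a0 a1 a2 b0 b1 b2 u" for u
    using v by (simp_all add: vfield_coeffs_def quad_form_def)
  have vf': "vf_at v' u = A *v c + (A ** B ** A') *v u + quad_map a0' a1' a2' b0' b1' b2' u" for u
    using A(2)[of "A' *v u"] unfolding A'A vf qm
    by (simp add: matrix_vector_right_distrib matrix_vector_mul_assoc matrix_mul_assoc)
  let ?G' = "quad_form a0' a1' a2' b0' b1' b2'"
  have G': "?G' (A *v u) = det A * inf_form v u" for u
    unfolding iform using quad_form_conj[OF conj] .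
  have G'1: "?G' (vector [1, \<omega>]) = - b0' + (a0' - b1') * \<omega> + (a1' - b2') * \<omega>^2 + a2' * \<omega>^3" for \<omega>
    by (simp add: quad_form_def quad_map_def algebra_simps power2_eq_square power3_eq_cube)
  have dir_in: "\<exists>j. vec.span {y} = vec.span {vector [1, w $ j]}" if "y \<noteq> 0" "?G' y = 0" for y
  proof -
    have y: "y = A *v (A' *v y)" by (simp add: A'A)
    have "inf_form v (A' *v y) = 0" using that(2) G'[of "A' *v y"] detA unfolding A'A by simp
    moreover have "A' *v y \<noteq> 0" using that(1) y by (metis matrix_vector_mult_0_right)
    ultimately have "vec.span {A' *v y} \<in> inf_sing v" unfolding inf_sing_def by blast
    then obtain j where "vec.span {A' *v y} = q j" using q unfolding bij_betw_def by blast
    then have "vec.span {y} = vec.span {vector [1, w $ j]}"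
      using qw[of j] image_span_1[of A "A' *v y"] unfolding A'A by simp
    then show ?thesis ..
  qed
  \<comment> \<open>The cubic form takes the value \<open>a2'\<close> at \<open>(0, 1)\<close>. Were
    it zero, this direction would be singular and hence of the form
    \<open>(1 : w\<^sub>j)\<close>.\<close>
  have c0: "a2' \<noteq> 0"
  proof
    assume "a2' = 0"
    then have "?G' (vector [0, 1]) = 0" by (simp add: quad_form_def quad_map_def)
    moreover have "vector [0, 1] \<noteq> (0 :: complex^2)" by (simp add: vec_eq_iff forall_2)
    ultimately obtain j where "vec.span {vector [0, 1] :: complex^2} = vec.span {vector [1, w $ j]}"
      using dir_in by blast
    from span_affine_direction[OF this] show False by (simp add: vec_eq_iff forall_2)
  qed
  have w_root: "?G' (vector [1, w $ j]) = 0" for j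
  proof -
    have "q j \<in> inf_sing v" using q unfolding bij_betw_def by blast
    then obtain x where x: "q j = vec.span {x}" "x \<noteq> 0" "inf_form v x = 0"
      unfolding inf_sing_def by blast
    have "vec.span {A *v x} = vec.span {vector [1, w $ j]}"
      using qw[of j] unfolding x(1) image_span_1 .
    from span_affine_direction[OF this]
    have Ax: "A *v x = (A *v x) $ 1 *s vector [1, w $ j]" .
    have "A *v x \<noteq> 0" using x(2) A'A(1)[of x] by (metis matrix_vector_mult_0_right)
    then have k: "(A *v x) $ 1 \<noteq> 0" using Ax by (metis vector_smult_lzero)
    have "?G' (k *s u) = k^3 * ?G' u" for k u
      by (simp add: quad_form_def quad_map_def algebra_simps power2_eq_square power3_eq_cube)
    then have "((A *v x) $ 1)^3 * ?G' (vector [1, w $ j]) = 0"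
      using G'[of x] x(3) Ax by (metis mult_zero_right)
    then show ?thesis using k by simp
  qed
  have w_inj: "i = j" if "w $ i = w $ j" for i j
  proof -
    have "(\<lambda>u. A *v u) ` q i = (\<lambda>u. A *v u) ` q j" using qw[of i] qw[of j] that by simp
    moreover have "inj (\<lambda>u. A *v u)" using A'A(1) by (metis injI)
    ultimately have "q i = q j" by (simp add: inj_image_eq_iff)
    then show ?thesis using q unfolding bij_betw_def inj_on_def by blast
  qed
  have wne: "w$1 \<noteq> w$2" "w$1 \<noteq> w$3" "w$2 \<noteq> w$3" using w_inj by force+
  have b: "b2' = a1' + a2' * (w$1 + w$2 + w$3)"
    "b1' = a0' - a2' * (w$1 * w$2 + w$1 * w$3 + w$2 * w$3)" "b0' = a2' * (w$1 * w$2 * w$3)"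
  proof -
    have "(- b0' + a2' * (w$1 * w$2 * w$3)) + (a0' - b1' - a2' * (w$1 * w$2 + w$1 * w$3 + w$2 * w$3)) * x
      + (a1' - b2' + a2' * (w$1 + w$2 + w$3)) * x^2
      = ?G' (vector [1, x]) - a2' * ((x - w$1) * (x - w$2) * (x - w$3))" for x
      unfolding G'1 by algebra
    note * = this
    have "(- b0' + a2' * (w$1 * w$2 * w$3)) = 0 \<and> (a0' - b1' - a2' * (w$1 * w$2 + w$1 * w$3 + w$2 * w$3)) = 0
      \<and> (a1' - b2' + a2' * (w$1 + w$2 + w$3)) = 0"
      by (rule quadratic_three_roots[OF wne]) (simp_all only: * w_root, simp_all)
    then show "b2' = a1' + a2' * (w$1 + w$2 + w$3)"
      "b1' = a0' - a2' * (w$1 * w$2 + w$1 * w$3 + w$2 * w$3)" "b0' = a2' * (w$1 * w$2 * w$3)"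
      by algebra+
  qed
  have Gfac: "\<omega> * (a0' + a1' * \<omega> + a2' * \<omega>^2) - (b0' + b1' * \<omega> + b2' * \<omega>^2)
      = a2' * ((\<omega> - w$1) * (\<omega> - w$2) * (\<omega> - w$3))" for \<omega>
    unfolding b by algebra
  have pw: "(a0' - a2' * (l$1 * w$2 * w$3 + l$2 * w$1 * w$3 + l$3 * w$1 * w$2))
      + (a1' + a2' * (l$1 * (w$2 + w$3) + l$2 * (w$1 + w$3) + l$3 * (w$1 + w$2))) * \<omega>
      + (a2' - a2' * (l$1 + l$2 + l$3)) * \<omega>^2 = 0"
    if "\<omega> \<notin> {w$1, w$2, w$3}" for \<omega>
  proof -
    define x y z where "x = \<omega> - w$1" and "y = \<omega> - w$2" and "z = \<omega> - w$3"
    have nz: "x \<noteq> 0" "y \<noteq> 0" "z \<noteq> 0" using that by (auto simp: x_def y_def z_def)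
    have "\<omega> \<noteq> w $ j" for j using that exhaust_3[of j] by auto
    then have "(\<Sum>j\<in>UNIV. l $ j / (\<omega> - w $ j)) = (a0' + a1' * \<omega> + a2' * \<omega>^2) /
        (\<omega> * (a0' + a1' * \<omega> + a2' * \<omega>^2) - (b0' + b1' * \<omega> + b2' * \<omega>^2))"
      using sl[of \<omega>] slope_bigo[OF vf', of \<omega>] c0 nz unfolding Gfac x_def y_def z_def by auto
    then have "l$1 / x + l$2 / y + l$3 / z = (a0' + a1' * \<omega> + a2' * \<omega>^2) / (a2' * (x * y * z))"
      unfolding Gfac sum_3 x_def y_def z_def .
    moreover have "l$1 / x + l$2 / y + l$3 / z
        = a2' * (l$1 * (y * z) + l$2 * (x * z) + l$3 * (x * y)) / (a2' * (x * y * z))"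
      using nz c0 by (simp add: field_simps)
    ultimately have "a0' + a1' * \<omega> + a2' * \<omega>^2 = a2' * (l$1 * (y * z) + l$2 * (x * z) + l$3 * (x * y))"
      using nz c0 by (metis divide_cancel_right mult_eq_0_iff)
    then show ?thesis unfolding x_def y_def z_def by algebra
  qed
  \<comment> \<open>The identity is known only off the singular directions, but three further points
    are enough for a polynomial of degree at most 2.\<close>
  obtain x where x: "x \<notin> {w$1, w$2, w$3}" using ex_new_if_finite[OF infinite_UNIV_char_0, of "{w$1, w$2, w$3}"] by auto
  obtain y where y: "y \<notin> {w$1, w$2, w$3, x}" using ex_new_if_finite[OF infinite_UNIV_char_0, of "{w$1, w$2, w$3, x}"] by auto
  obtain z where z: "z \<notin> {w$1, w$2, w$3, x, y}" using ex_new_if_finite[OF infinite_UNIV_char_0, of "{w$1, w$2, w$3, x, y}"] by auto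
  have "a0' - a2' * (l$1 * w$2 * w$3 + l$2 * w$1 * w$3 + l$3 * w$1 * w$2) = 0
      \<and> a1' + a2' * (l$1 * (w$2 + w$3) + l$2 * (w$1 + w$3) + l$3 * (w$1 + w$2)) = 0
      \<and> a2' - a2' * (l$1 + l$2 + l$3) = 0"
    by (rule quadratic_three_roots[of x y z]) (use x y z pw in auto)
  then have a: "a1' = - a2' * (l$1 * (w$2 + w$3) + l$2 * (w$1 + w$3) + l$3 * (w$1 + w$2))"
    "a0' = a2' * (l$1 * w$2 * w$3 + l$2 * w$1 * w$3 + l$3 * w$1 * w$2)"
    and "a2' * (l$1 + l$2 + l$3) = a2' * 1"
    by (simp_all add: algebra_simps eq_neg_iff_add_eq_0)
  then have l1: "l$1 + l$2 + l$3 = 1" using c0 by (metis mult_left_cancel)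
  have conjN: "quad_map a0' a1' a2' b0' b1' b2' ((A ** N) *v u) = (A ** N) *v quad_map k0 k1 k2 m0 m1 m2 u" for u
    unfolding matrix_vector_mul_assoc[symmetric] conj N(2) ..
  have detAN: "det (A ** N) \<noteq> 0" using detA N(1) by (simp add: det_mul)
  show ?thesis
    by (rule infinity_relations_covariant(1)[OF detAN[unfolded det_2] quad_map_conj_coeffs[OF conjN] l1 a b])
qed

text \<open>One root exists by the fundamental theorem of algebra, the second solves the quotient
  quadratic, and the third is prescribed by the sum of the roots.\<close>

lemma cubic_factorization:
  fixes g0 g1 g2 c :: complex
  assumes c: "c \<noteq> 0"
  obtains w1 w2 w3 where "g2 = - c * (w1 + w2 + w3)" "g1 = c * (w1 * w2 + w1 * w3 + w2 * w3)"
    "g0 = - c * (w1 * w2 * w3)"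
proof -
  define a where "a i = [g0, g1, g2, c] ! i" for i
  have "\<exists>i\<in>{1..3}. a i \<noteq> 0" using c by (intro bexI[of _ 3]) (auto simp: a_def)
  then have "a 0 = 0 \<or> (\<exists>i\<in>{1..3}. a i \<noteq> 0)" by blast
  from fundamental_theorem_of_algebra[OF this] obtain w1 where "(\<Sum>i\<le>3. a i * w1 ^ i) = 0" by blast
  then have r1: "g0 + g1 * w1 + g2 * w1^2 + c * w1^3 = 0"
    by (simp add: a_def eval_nat_numeral)
  obtain w2 where r2: "c * w2^2 + (g2 + c * w1) * w2 + (g1 + g2 * w1 + c * w1^2) = 0"
    using complex_quadratic_root[OF c] by blast
  define w3 where "w3 = - (g2 + c * w1) / c - w2"
  have e: "c * w3 = - (g2 + c * w1) - c * w2" using c by (simp add: w3_def field_simps)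
  show ?thesis
  proof
    show g2: "g2 = - c * (w1 + w2 + w3)" using e by algebra
    show g1: "g1 = c * (w1 * w2 + w1 * w3 + w2 * w3)" using r2 g2 by algebra
    show "g0 = - c * (w1 * w2 * w3)" using r1 g1 g2 by algebra
  qed
qed

text \<open>A shear moves a nonsingular direction \<open>(k, 1)\<close> to \<open>(0, 1)\<close>;
  then every singular direction is \<open>(1 : w)\<close> with \<open>w\<close> a root of a cubic
  whose leading coefficient \<open>a2'\<close> is nonzero. The discriminant keeps the three roots
  apart, and the \<lambda>'s are the residues there.\<close>

lemma char_numbers_ex:
  assumes v: "vfield_coeffs v c B a0 a1 a2 b0 b1 b2"
    and disc: "quad_disc a0 a1 a2 b0 b1 b2 \<noteq> 0"
  obtains q l where "bij_betw q (UNIV :: 3 set) (inf_sing v)" "char_numbers v q l"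
    "\<exists>u. inf_form v u \<noteq> 0"
proof -
  have vf: "vf_at v u = c + B *v u + quad_map a0 a1 a2 b0 b1 b2 u"
    and iform: "inf_form v u = quad_form a0 a1 a2 b0 b1 b2 u" for u
    using v by (simp_all add: vfield_coeffs_def quad_form_def)
  have "[:a2, a1 - b2, a0 - b1, - b0:] \<noteq> 0"
    using disc by (auto simp: quad_disc_def cubic_disc_def)
  then have "finite {k. poly [:a2, a1 - b2, a0 - b1, - b0:] k = 0}" by (rule poly_roots_finite)
  then obtain k where k: "poly [:a2, a1 - b2, a0 - b1, - b0:] k \<noteq> 0"
    using ex_new_if_finite[OF infinite_UNIV_char_0] by blast
  have gk: "quad_form a0 a1 a2 b0 b1 b2 (vector [k, 1]) = poly [:a2, a1 - b2, a0 - b1, - b0:] k"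
    by (simp add: quad_form_def quad_map_def algebra_simps power2_eq_square)
  define A :: "complex^2^2" where "A = vector [vector [1, - k], vector [0, 1]]"
  define A' :: "complex^2^2" where "A' = vector [vector [1, k], vector [0, 1]]"
  have A'A: "A' *v (A *v u) = u" "A *v (A' *v u) = u" for u
    by (simp_all add: vec_eq_iff forall_2 matrix_vector_mult_2 A_def A'_def)
  have detA: "det A = 1" by (simp add: det_2 A_def)
  then have invA: "invertible A" by (simp add: invertible_det_nz)
  obtain a0' a1' a2' b0' b1' b2' where
    qm: "\<And>u. quad_map a0' a1' a2' b0' b1' b2' u = A *v quad_map a0 a1 a2 b0 b1 b2 (A' *v u)"
    using quad_map_conj_ex by blast
  have conj: "quad_map a0' a1' a2' b0' b1' b2' (A *v u) = A *v quad_map a0 a1 a2 b0 b1 b2 u" for u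
    unfolding qm A'A ..
  let ?G' = "quad_form a0' a1' a2' b0' b1' b2'"
  have G': "?G' (A *v u) = inf_form v u" for u
    unfolding iform using quad_form_conj[OF conj] detA by simp
  have G'1: "?G' (vector [1, \<omega>]) = - b0' + (a0' - b1') * \<omega> + (a1' - b2') * \<omega>^2 + a2' * \<omega>^3" for \<omega>
    by (simp add: quad_form_def quad_map_def algebra_simps power2_eq_square power3_eq_cube)
  have Gs: "?G' (k *s u) = k^3 * ?G' u" for k u
    by (simp add: quad_form_def quad_map_def algebra_simps power2_eq_square power3_eq_cube)
  have c0: "a2' \<noteq> 0"
  proof -
    have "A *v vector [k, 1] = vector [0, 1]"
      by (simp add: vec_eq_iff forall_2 matrix_vector_mult_2 A_def)
    then have "?G' (vector [0, 1]) = poly [:a2, a1 - b2, a0 - b1, - b0:] k"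
      using G'[of "vector [k, 1]"] gk iform by simp
    moreover have "?G' (vector [0, 1]) = a2'" by (simp add: quad_form_def quad_map_def)
    ultimately show ?thesis using k by simp
  qed
  obtain w1 w2 w3 where w: "a1' - b2' = - a2' * (w1 + w2 + w3)"
    "a0' - b1' = a2' * (w1 * w2 + w1 * w3 + w2 * w3)" "- b0' = - a2' * (w1 * w2 * w3)"
    using cubic_factorization[OF c0] by metis
  have b: "b2' = a1' + a2' * (w1 + w2 + w3)"
    "b1' = a0' - a2' * (w1 * w2 + w1 * w3 + w2 * w3)" "b0' = a2' * (w1 * w2 * w3)"
    using w by algebra+
  have "quad_disc a0 a1 a2 b0 b1 b2 = a2'^4 * ((w1 - w2) * (w1 - w3) * (w2 - w3))^2"
    using quad_disc_factored[OF _ quad_map_conj_coeffs[OF conj] b] detA[unfolded det_2] by simp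
  then have wne: "w1 \<noteq> w2" "w1 \<noteq> w3" "w2 \<noteq> w3" using disc by auto
  have Gfac: "\<omega> * (a0' + a1' * \<omega> + a2' * \<omega>^2) - (b0' + b1' * \<omega> + b2' * \<omega>^2)
      = a2' * ((\<omega> - w1) * (\<omega> - w2) * (\<omega> - w3))" for \<omega>
    unfolding b by algebra
  have Gfac': "?G' (vector [1, \<omega>]) = a2' * ((\<omega> - w1) * (\<omega> - w2) * (\<omega> - w3))" for \<omega>
    unfolding G'1 Gfac[symmetric] by algebra
  define w where "w = (vector [w1, w2, w3] :: complex^3)"
  define q where "q j = (\<lambda>u. A' *v u) ` vec.span {vector [1, w $ j] :: complex^2}" for j :: 3
  have Aq: "(\<lambda>u. A *v u) ` q j = vec.span {vector [1, w $ j]}" for j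
    unfolding q_def image_image A'A by simp
  have winj: "i = j" if "w $ i = w $ j" for i j
    using that wne exhaust_3[of i] exhaust_3[of j] by (auto simp: w_def)
  have bij: "bij_betw q UNIV (inf_sing v)"
    unfolding bij_betw_def
  proof
    show "inj q"
    proof (rule injI)
      fix i j assume "q i = q j"
      then have "vec.span {vector [1, w $ i] :: complex^2} = vec.span {vector [1, w $ j]}"
        using Aq by metis
      from span_affine_direction[OF this] have "w $ i = w $ j" by (simp add: vec_eq_iff forall_2)
      then show "i = j" by (rule winj)
    qed
    show "range q = inf_sing v"
    proof (intro equalityI subsetI)
      fix s assume "s \<in> range q"
      then obtain j where s: "s = q j" by blast
      define x where "x = A' *v vector [1, w $ j]"
      have Ax: "A *v x = vector [1, w $ j]" by (simp add: x_def A'A)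
      have "?G' (vector [1, w $ j]) = 0" unfolding Gfac' using exhaust_3[of j] by (auto simp: w_def)
      then have "inf_form v x = 0" using G'[of x] Ax by simp
      moreover have "x \<noteq> 0"
      proof
        assume "x = 0"
        then have "A *v x = 0" by simp
        then show False using Ax by (simp add: vec_eq_iff forall_2)
      qed
      moreover have "s = vec.span {x}" unfolding s q_def image_span_1 x_def ..
      ultimately show "s \<in> inf_sing v" unfolding inf_sing_def by blast
    next
      fix s assume "s \<in> inf_sing v"
      then obtain x where x: "s = vec.span {x}" "x \<noteq> 0" "inf_form v x = 0"
        unfolding inf_sing_def by blast
      define y where "y = A *v x"
      have Gy: "?G' y = 0" using G'[of x] x(3) by (simp add: y_def)
      have xy: "x = A' *v y" by (simp add: y_def A'A)
      then have "y \<noteq> 0" using x(2) by auto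
      have "y$1 \<noteq> 0"
      proof
        assume y1: "y$1 = 0"
        then have "?G' y = a2' * (y$2)^3"
          by (simp add: quad_form_def quad_map_def power2_eq_square power3_eq_cube)
        then have "a2' * (y$2)^3 = 0" using Gy by simp
        then show False using c0 y1 \<open>y \<noteq> 0\<close> by (simp add: vec_eq_iff forall_2)
      qed
      then have y: "y = y$1 *s vector [1, y$2 / y$1]" by (simp add: vec_eq_iff forall_2)
      then have "?G' (vector [1, y$2 / y$1]) = 0" using Gy Gs \<open>y$1 \<noteq> 0\<close>
        by (metis mult_eq_0_iff power_eq_0_iff)
      then have "y$2 / y$1 = w1 \<or> y$2 / y$1 = w2 \<or> y$2 / y$1 = w3" unfolding Gfac' using c0 by simp
      then obtain j where j: "y$2 / y$1 = w $ j" using vector_3 unfolding w_def by metis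
      have "s = (\<lambda>u. A' *v u) ` vec.span {y}" unfolding x(1) image_span_1 xy[symmetric] ..
      also have "vec.span {y} = vec.span {vector [1, w $ j]}"
        using span_scale_1[OF \<open>y$1 \<noteq> 0\<close>, of "vector [1, w $ j]"] y j by metis
      finally have "s = q j" unfolding q_def .
      then show "s \<in> range q" by blast
    qed
  qed
  define p where "p x = a0' + a1' * x + a2' * x^2" for x
  \<comment> \<open>Residues of \<open>p x\<close> over
    \<open>a2' (x - w1) (x - w2) (x - w3)\<close> at its simple poles; \<open>lag\<close> is
    Lagrange interpolation of \<open>p\<close> at the three roots.\<close>
  define l where "l = (vector [p w1 / (a2' * ((w1 - w2) * (w1 - w3))), p w2 / (a2' * ((w2 - w1) * (w2 - w3))),
    p w3 / (a2' * ((w3 - w1) * (w3 - w2)))] :: complex^3)"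
  have lag: "p x = a2' * (l$1 * ((x - w2) * (x - w3)) + l$2 * ((x - w1) * (x - w3)) + l$3 * ((x - w1) * (x - w2)))" for x
  proof -
    define d0 where "d0 = a0' - a2' * (l$1 * w2 * w3 + l$2 * w1 * w3 + l$3 * w1 * w2)"
    define d1 where "d1 = a1' + a2' * (l$1 * (w2 + w3) + l$2 * (w1 + w3) + l$3 * (w1 + w2))"
    define d2 where "d2 = a2' - a2' * (l$1 + l$2 + l$3)"
    have d: "d0 + d1 * x + d2 * x^2
      = p x - a2' * (l$1 * ((x - w2) * (x - w3)) + l$2 * ((x - w1) * (x - w3)) + l$3 * ((x - w1) * (x - w2)))" for x
      unfolding d0_def d1_def d2_def p_def by algebra
    have "d0 = 0 \<and> d1 = 0 \<and> d2 = 0"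
      by (rule quadratic_three_roots[OF wne]) (use wne c0 in \<open>simp_all add: d l_def\<close>)
    then show ?thesis using d[of x] by simp
  qed
  obtain v' where v': "vfield_coeffs v' (A *v c) (A ** B ** A') a0' a1' a2' b0' b1' b2'"
    using vfield_coeffs_ex by blast
  then have vf': "vf_at v' u = A *v c + (A ** B ** A') *v u + quad_map a0' a1' a2' b0' b1' b2' u" for u
    by (simp add: vfield_coeffs_def)
  have lin: "linear_change A v v'"
    unfolding linear_change_def
  proof (intro conjI allI)
    fix u
    have "(A ** B ** A') *v (A *v u) = A *v (B *v u)"
      by (simp only: matrix_vector_mul_assoc[symmetric] A'A)
    then show "vf_at v' (A *v u) = A *v vf_at v u"
      unfolding vf' vf conj by (simp add: matrix_vector_right_distrib)
  qed (rule invA)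
  have "char_numbers v q l"
    unfolding char_numbers_def
  proof (rule exI[of _ A], rule exI[of _ v'], rule exI[of _ w], intro conjI allI impI lin Aq)
    fix \<omega> assume "\<forall>j. \<omega> \<noteq> w $ j"
    then have "\<omega> \<noteq> w $ 1" "\<omega> \<noteq> w $ 2" "\<omega> \<noteq> w $ 3" by blast+
    then have ne: "\<omega> \<noteq> w1" "\<omega> \<noteq> w2" "\<omega> \<noteq> w3" by (simp_all add: w_def)
    define x y z where "x = \<omega> - w1" and "y = \<omega> - w2" and "z = \<omega> - w3"
    have nz: "x \<noteq> 0" "y \<noteq> 0" "z \<noteq> 0" using ne by (auto simp: x_def y_def z_def)
    have "(\<Sum>j\<in>UNIV. l $ j / (\<omega> - w $ j)) = l$1 / x + l$2 / y + l$3 / z"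
      by (simp add: sum_3 w_def x_def y_def z_def)
    also have "\<dots> = a2' * (l$1 * (y * z) + l$2 * (x * z) + l$3 * (x * y)) / (a2' * (x * y * z))"
      using nz c0 by (simp add: field_simps)
    also have "\<dots> = p \<omega> / (a2' * ((\<omega> - w1) * (\<omega> - w2) * (\<omega> - w3)))"
      unfolding lag x_def y_def z_def ..
    finally have S: "(\<Sum>j\<in>UNIV. l $ j / (\<omega> - w $ j)) = p \<omega> / (a2' * ((\<omega> - w1) * (\<omega> - w2) * (\<omega> - w3)))" .
    show "(\<lambda>z. slope_dz_dw v' z \<omega> - z * (\<Sum>j\<in>UNIV. l $ j / (\<omega> - w $ j))) \<in> O[at 0](\<lambda>z. z^2)"
      unfolding S
    proof (subst slope_bigo[OF vf'])
      show "\<omega> * (a0' + a1' * \<omega> + a2' * \<omega>^2) - (b0' + b1' * \<omega> + b2' * \<omega>^2) \<noteq> 0"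
        using ne c0 unfolding Gfac by simp
    qed (simp only: Gfac p_def)
  qed
  moreover have "\<exists>u. inf_form v u \<noteq> 0" using gk k iform by metis
  ultimately show ?thesis using that bij by blast
qed

text \<open>A limit of spectra yields the \<lambda>'s only up to order, so every enumeration of the
  points at infinity has to be available.\<close>

lemma char_numbers_permute:
  assumes "char_numbers v q l" and \<pi>: "bij \<pi>"
  shows "char_numbers v (q \<circ> \<pi>) (\<chi> j. l $ \<pi> j)"
proof -
  obtain A v' w where A: "linear_change A v v'"
    and qw: "\<And>j. (\<lambda>u. A *v u) ` q j = vec.span {vector [1, w $ j]}"
    and sl: "\<And>\<omega>. (\<forall>j. \<omega> \<noteq> w $ j) \<Longrightarrow>
      (\<lambda>z. slope_dz_dw v' z \<omega> - z * (\<Sum>j\<in>UNIV. l $ j / (\<omega> - w $ j))) \<in> O[at 0](\<lambda>z. z^2)"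
    using assms(1) unfolding char_numbers_def by blast
  have sum: "(\<Sum>j\<in>UNIV. l $ \<pi> j / (\<omega> - w $ \<pi> j)) = (\<Sum>j\<in>UNIV. l $ j / (\<omega> - w $ j))" for \<omega>
    using sum.reindex_bij_betw[OF \<pi>, of "\<lambda>j. l $ j / (\<omega> - w $ j)"] .
  show ?thesis
    unfolding char_numbers_def
  proof (rule exI[of _ A], rule exI[of _ v'], rule exI[of _ "\<chi> j. w $ \<pi> j"], intro conjI allI impI A)
    show "(\<lambda>u. A *v u) ` (q \<circ> \<pi>) j = vec.span {vector [1, (\<chi> j. w $ \<pi> j) $ j]}" for j
      using qw by simp
    fix \<omega> assume ne: "\<forall>j. \<omega> \<noteq> (\<chi> j. w $ \<pi> j) $ j"
    have "\<omega> \<noteq> w $ j" for j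
      using ne \<pi> by (simp add: bij_def) (metis surjD)
    then show "(\<lambda>z. slope_dz_dw v' z \<omega> - z * (\<Sum>j\<in>UNIV. (\<chi> j. l $ \<pi> j) $ j / (\<omega> - (\<chi> j. w $ \<pi> j) $ j))) \<in> O[at 0](\<lambda>z. z^2)"
      using sl[of \<omega>] by (simp add: sum)
  qed
qed


section \<open>Normal form of the finite singularities\<close>

text \<open>The Jacobian of \<open>quad_map\<close> at \<open>u\<close>, that is, twice its polar
  form.\<close>

definition quad_lin :: "complex \<Rightarrow> complex \<Rightarrow> complex \<Rightarrow> complex \<Rightarrow> complex \<Rightarrow> complex \<Rightarrow> complex^2 \<Rightarrow> complex^2^2" where
  "quad_lin a0 a1 a2 b0 b1 b2 u = vector [vector [2 * a0 * u$1 + a1 * u$2, a1 * u$1 + 2 * a2 * u$2],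
     vector [2 * b0 * u$1 + b1 * u$2, b1 * u$1 + 2 * b2 * u$2]]"

lemma quad_map_add:
  "quad_map a0 a1 a2 b0 b1 b2 (u + w) = quad_map a0 a1 a2 b0 b1 b2 u
     + quad_lin a0 a1 a2 b0 b1 b2 u *v w + quad_map a0 a1 a2 b0 b1 b2 w"
  by (simp add: vec_eq_iff forall_2 quad_map_def quad_lin_def matrix_vector_mult_2
      algebra_simps power2_eq_square)

lemma quad_lin_add:
  "quad_lin a0 a1 a2 b0 b1 b2 (u + w) = quad_lin a0 a1 a2 b0 b1 b2 u + quad_lin a0 a1 a2 b0 b1 b2 w"
  by (simp add: vec_eq_iff forall_2 quad_lin_def algebra_simps)

lemma vf_jacobian_coeffs:
  assumes v: "vfield_coeffs v c B a0 a1 a2 b0 b1 b2"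
  shows "vf_jacobian v u = B + quad_lin a0 a1 a2 b0 b1 b2 u"
proof -
  have vf: "vf_at v x = c + B *v x + quad_map a0 a1 a2 b0 b1 b2 x" for x
    using v by (simp add: vfield_coeffs_def)
  have "vf_jacobian v u $ i $ j = (B + quad_lin a0 a1 a2 b0 b1 b2 u) $ i $ j" for i j
  proof -
    have "((\<lambda>s. vf_at v (u + axis j s) $ i) has_field_derivative
        (B + quad_lin a0 a1 a2 b0 b1 b2 u) $ i $ j) (at 0)"
      using exhaust_2[of i] exhaust_2[of j]
      unfolding vf
      by (auto simp: quad_map_def quad_lin_def matrix_vector_mult_2 axis_def algebra_simps
          intro!: derivative_eq_intros)
    then show ?thesis unfolding vf_jacobian_def by (simp add: DERIV_imp_deriv)
  qed
  then show ?thesis by (simp add: vec_eq_iff)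
qed

text \<open>The Taylor expansion is exact because the field has degree at most 2.\<close>

lemma vf_at_add:
  assumes v: "vfield_coeffs v c B a0 a1 a2 b0 b1 b2"
  shows "vf_at v (u + w) = vf_at v u + vf_jacobian v u *v w + quad_map a0 a1 a2 b0 b1 b2 w"
proof -
  have vf: "vf_at v x = c + B *v x + quad_map a0 a1 a2 b0 b1 b2 x" for x
    using v by (simp add: vfield_coeffs_def)
  show ?thesis unfolding vf vf_jacobian_coeffs[OF v] quad_map_add
    by (simp add: matrix_vector_right_distrib matrix_vector_mult_add_rdistrib)
qed

text \<open>Along the line both components are quadratic polynomials in the parameter with the three
  zeros 0, 1 and \<open>s\<close>. They vanish identically, and the whole line would consist of
  singularities.\<close>

lemma no_three_collinear_zeros:
  assumes v: "vfield_coeffs v c B a0 a1 a2 b0 b1 b2" and fin: "finite (sing v)"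
    and z: "x \<in> sing v" "x + w \<in> sing v" "x + s *s w \<in> sing v" and w: "w \<noteq> 0" and s: "s \<noteq> 0" "s \<noteq> 1"
  shows False
proof -
  have qs: "quad_map a0 a1 a2 b0 b1 b2 (\<tau> *s w) = \<tau>^2 *s quad_map a0 a1 a2 b0 b1 b2 w" for \<tau>
    by (simp add: vec_eq_iff forall_2 quad_map_def algebra_simps power2_eq_square)
  have x: "vf_at v x = 0" using z(1) by (simp add: sing_def)
  have line: "vf_at v (x + \<tau> *s w) = \<tau> *s (vf_jacobian v x *v w) + \<tau>^2 *s quad_map a0 a1 a2 b0 b1 b2 w" for \<tau>
    unfolding vf_at_add[OF v] qs x by (simp add: vector_scalar_commute)
  have comp: "(vf_jacobian v x *v w) $ i = 0 \<and> quad_map a0 a1 a2 b0 b1 b2 w $ i = 0" for i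
  proof -
    have "vf_at v (x + 1 *s w) = 0" "vf_at v (x + s *s w) = 0"
      using z(2,3) by (simp_all add: sing_def)
    then have "(vf_jacobian v x *v w) $ i + quad_map a0 a1 a2 b0 b1 b2 w $ i = 0"
      "s * (vf_jacobian v x *v w) $ i + s^2 * quad_map a0 a1 a2 b0 b1 b2 w $ i = 0"
      unfolding line by (simp_all add: vec_eq_iff)
    then have "0 = (0::complex) \<and> (vf_jacobian v x *v w) $ i = 0 \<and> quad_map a0 a1 a2 b0 b1 b2 w $ i = 0"
      using s by (intro quadratic_three_roots[of 0 1 s]) (simp_all add: mult.commute)
    then show ?thesis by blast
  qed
  then have "vf_jacobian v x *v w = 0" "quad_map a0 a1 a2 b0 b1 b2 w = 0"
    by (simp_all add: vec_eq_iff)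
  then have "range (\<lambda>\<tau>. x + \<tau> *s w) \<subseteq> sing v" by (auto simp: sing_def line)
  moreover have "inj (\<lambda>\<tau>. x + \<tau> *s w)" using w by (auto intro!: injI)
  ultimately have "finite (UNIV :: complex set)"
    using fin by (meson finite_subset finite_imageD)
  then show False using infinite_UNIV_char_0 by blast
qed

text \<open>The quadratic part that results when the matrix with rows \<open>a, b\<close> and
  \<open>c, e\<close> is applied to the conics
  \<open>x (u\<^sub>2 x - (u\<^sub>2 + u\<^sub>4) y - 1)\<close> and
  \<open>y (u\<^sub>3 y - (u\<^sub>3 + u\<^sub>4) x - 1)\<close> through the four normalised
  points.\<close>

abbreviation normal_quad_map :: "complex^4 \<Rightarrow> complex \<Rightarrow> complex \<Rightarrow> complex \<Rightarrow> complex \<Rightarrow> complex^2 \<Rightarrow> complex^2" where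
  "normal_quad_map u a b c e \<equiv> quad_map (u$2 * a) (- (u$2 + u$4) * a - (u$3 + u$4) * b) (u$3 * b)
     (u$2 * c) (- (u$2 + u$4) * c - (u$3 + u$4) * e) (u$3 * e)"

text \<open>The origin is \<open>p 1\<close> and the axes are \<open>u\<^sub>2 (p 2 - p 1)\<close>
  and \<open>u\<^sub>3 (p 3 - p 1)\<close>; the weight relation then fixes the coordinates of
  \<open>p 4\<close>. The matrix is defined as minus the linear part, and vanishing at the other
  three points expresses the quadratic part through it. Traces and determinants do not change under
  conjugation by \<open>N\<close>. The weights are only known up to scale: the determinants come out
  as a common constant over \<open>u\<^sub>k\<close>, from which (EJ1) follows.\<close>

lemma normal_form:
  fixes p :: "4 \<Rightarrow> complex^2" and u :: "complex^4"
  assumes v: "vfield_coeffs v C0 B a0 a1 a2 b0 b1 b2"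
    and p: "\<And>k. p k \<in> sing v"
    and u: "\<And>k. u$k \<noteq> 0" "u$1 + u$2 + u$3 + u$4 = 0"
    and up: "u$2 *s (p 2 - p 1) + u$3 *s (p 3 - p 1) + u$4 *s (p 4 - p 1) = 0"
    and indep: "(p 2 - p 1)$1 * (p 3 - p 1)$2 - (p 2 - p 1)$2 * (p 3 - p 1)$1 \<noteq> 0"
  obtains N a b c e where "det N \<noteq> 0"
    "\<And>x. quad_map a0 a1 a2 b0 b1 b2 (N *v x) = N *v normal_quad_map u a b c e x"
    "\<And>x. vf_at v (p 1 + N *v x) = N *v (normal_quad_map u a b c e x - vector [a * x$1 + b * x$2, c * x$1 + e * x$2])"
    "\<And>k. det (vf_jacobian v (p k)) = u$1 * (a * e - b * c) / u$k"
    "trace (vf_jacobian v (p 1)) = - (a + e)"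
    "u$2 * trace (vf_jacobian v (p 2)) = u$2 * a - (u$2 + u$4) * c + u$1 * e"
    "u$3 * trace (vf_jacobian v (p 3)) = u$3 * e - (u$3 + u$4) * b + u$1 * a"
    "u$1 * trace (vf_jacobian v (p 1)) + u$2 * trace (vf_jacobian v (p 2))
       + u$3 * trace (vf_jacobian v (p 3)) + u$4 * trace (vf_jacobian v (p 4)) = 0"
proof -
  define f where "f = u$2 *s (p 2 - p 1)"
  define g where "g = u$3 *s (p 3 - p 1)"
  define N :: "complex^2^2" where "N = vector [vector [f$1, g$1], vector [f$2, g$2]]"
  have Nx: "N *v x = x$1 *s f + x$2 *s g" for x
    by (simp add: vec_eq_iff forall_2 matrix_vector_mult_2 N_def)
  have "det N = u$2 * u$3 * ((p 2 - p 1)$1 * (p 3 - p 1)$2 - (p 2 - p 1)$2 * (p 3 - p 1)$1)"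
    by (simp add: det_2 N_def f_def g_def algebra_simps)
  then have detN: "det N \<noteq> 0" using indep u(1) by simp
  then obtain A where A: "N ** A = mat 1" "A ** N = mat 1"
    unfolding invertible_det_nz[symmetric] invertible_def by blast
  have AN: "A *v (N *v x) = x" "N *v (A *v x) = x" for x
    by (simp_all add: matrix_vector_mul_assoc A)
  obtain a0' a1' a2' b0' b1' b2' where
    qm: "\<And>x. quad_map a0' a1' a2' b0' b1' b2' x = A *v quad_map a0 a1 a2 b0 b1 b2 (N *v x)"
    using quad_map_conj_ex by blast
  let ?q = "quad_map a0' a1' a2' b0' b1' b2'"
  define J where "J = A ** vf_jacobian v (p 1) ** N"
  have zero: "vf_at v (p k) = 0" for k using p by (simp add: sing_def)
  have v': "A *v vf_at v (p 1 + N *v x) = J *v x + ?q x" for x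
    unfolding vf_at_add[OF v] zero qm J_def
    by (simp add: matrix_vector_right_distrib matrix_vector_mul_assoc matrix_mul_assoc)
  have jac: "A ** vf_jacobian v (p 1 + N *v x) ** N = J + quad_lin a0' a1' a2' b0' b1' b2' x" for x
  proof -
    have "(A ** quad_lin a0 a1 a2 b0 b1 b2 (N *v x) ** N) *v y = quad_lin a0' a1' a2' b0' b1' b2' x *v y" for y
    proof -
      have "(A ** quad_lin a0 a1 a2 b0 b1 b2 (N *v x) ** N) *v y
        = A *v (quad_lin a0 a1 a2 b0 b1 b2 (N *v x) *v (N *v y))"
        by (simp add: matrix_vector_mul_assoc matrix_mul_assoc)
      also have "quad_lin a0 a1 a2 b0 b1 b2 (N *v x) *v (N *v y) = quad_map a0 a1 a2 b0 b1 b2 (N *v (x + y))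
          - quad_map a0 a1 a2 b0 b1 b2 (N *v x) - quad_map a0 a1 a2 b0 b1 b2 (N *v y)"
        unfolding matrix_vector_right_distrib quad_map_add by simp
      also have "A *v \<dots> = ?q (x + y) - ?q x - ?q y"
        unfolding qm by (simp add: matrix_vector_mult_diff_distrib)
      also have "\<dots> = quad_lin a0' a1' a2' b0' b1' b2' x *v y"
        unfolding quad_map_add by simp
      finally show ?thesis .
    qed
    then have "A ** quad_lin a0 a1 a2 b0 b1 b2 (N *v x) ** N = quad_lin a0' a1' a2' b0' b1' b2' x"
      by (simp add: matrix_eq)
    moreover have "vf_jacobian v (p 1 + N *v x) = vf_jacobian v (p 1) + quad_lin a0 a1 a2 b0 b1 b2 (N *v x)"
      unfolding vf_jacobian_coeffs[OF v] quad_lin_add by simp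
    moreover have "A ** (X + Y) ** N = A ** X ** N + A ** Y ** N" for X Y
      by (simp add: matrix_eq matrix_vector_mul_assoc[symmetric] matrix_vector_mult_add_rdistrib
          matrix_vector_right_distrib)
    ultimately show ?thesis by (simp add: J_def)
  qed
  have tr: "trace (vf_jacobian v (p 1 + N *v x)) = trace (J + quad_lin a0' a1' a2' b0' b1' b2' x)" for x
  proof -
    have "trace (A ** vf_jacobian v (p 1 + N *v x) ** N) = trace (N ** (A ** vf_jacobian v (p 1 + N *v x)))"
      by (rule trace_mul_sym)
    then show ?thesis unfolding jac by (simp add: matrix_mul_assoc A)
  qed
  have dt: "det (vf_jacobian v (p 1 + N *v x)) = det (J + quad_lin a0' a1' a2' b0' b1' b2' x)" for x
  proof -
    have "det A * det N = 1" using A(2) by (metis det_I det_mul)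
    then have "det (A ** vf_jacobian v (p 1 + N *v x) ** N) = det (vf_jacobian v (p 1 + N *v x))"
      by (simp add: det_mul mult_ac)
    then show ?thesis unfolding jac by simp
  qed
  define X where "X k = (if k = 1 then 0 else if k = 2 then vector [1 / u$2, 0]
    else if k = 3 then vector [0, 1 / u$3] else vector [- 1 / u$4, - 1 / u$4] :: complex^2)" for k :: 4
  have pX: "p k = p 1 + N *v X k" for k
  proof -
    have "u$4 *s (p 4 - p 1) = - (f + g)" using up unfolding f_def[symmetric] g_def[symmetric]
      by (metis add.commute eq_neg_iff_add_eq_0)
    then have p4: "p 4 - p 1 = (- 1 / u$4) *s f + (- 1 / u$4) *s g"
      using u(1)[of 4] by (simp add: vec_eq_iff field_simps)
    have p2: "p 2 - p 1 = (1 / u$2) *s f" "p 3 - p 1 = (1 / u$3) *s g"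
      using u(1) by (simp_all add: f_def g_def vector_smult_assoc)
    have "p k - p 1 = N *v X k"
      using exhaust_4[of k] p4 p2 by (auto simp: X_def Nx)
    then show ?thesis by (simp add: algebra_simps)
  qed
  have zX: "J *v X k + ?q (X k) = 0" for k
    using v'[of "X k"] zero[of k] unfolding pX[of k, symmetric] by simp
  define a b c e where "a = - (J$1$1)" and "b = - (J$1$2)" and "c = - (J$2$1)" and "e = - (J$2$2)"
  have J: "J$1$1 = - a" "J$1$2 = - b" "J$2$1 = - c" "J$2$2 = - e"
    by (simp_all add: a_def b_def c_def e_def)
  have co2: "a0' = u$2 * a" "b0' = u$2 * c"
    using zX[of 2] u(1)[of 2]
    by (simp_all add: X_def vec_eq_iff forall_2 matrix_vector_mult_2 quad_map_def J field_simps power2_eq_square)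
  have co3: "a2' = u$3 * b" "b2' = u$3 * e"
    using zX[of 3] u(1)[of 3]
    by (simp_all add: X_def vec_eq_iff forall_2 matrix_vector_mult_2 quad_map_def J field_simps power2_eq_square)
  have co4: "a1' = - (u$2 + u$4) * a - (u$3 + u$4) * b" "b1' = - (u$2 + u$4) * c - (u$3 + u$4) * e"
  proof -
    have aux: "z = - w * y" if "y / w + z / w^2 = 0" "w \<noteq> 0" for w y z :: complex
    proof -
      have "(w * y + z) / w^2 = 0" using that by (simp add: add_divide_distrib power2_eq_square)
      then show ?thesis using that(2) by (simp add: eq_neg_iff_add_eq_0 add.commute)
    qed
    have "(a + b) / u$4 + (a0' + a1' + a2') / (u$4)^2 = 0" "(c + e) / u$4 + (b0' + b1' + b2') / (u$4)^2 = 0"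
      using zX[of 4]
      by (simp_all add: X_def vec_eq_iff forall_2 matrix_vector_mult_2 quad_map_def J
          add_divide_distrib power_divide power2_eq_square add_ac)
    then have *: "a0' + a1' + a2' = - u$4 * (a + b)" "b0' + b1' + b2' = - u$4 * (c + e)"
      using aux u(1)[of 4] by blast+
    show "a1' = - (u$2 + u$4) * a - (u$3 + u$4) * b" using *(1) unfolding co2 co3 by algebra
    show "b1' = - (u$2 + u$4) * c - (u$3 + u$4) * e" using *(2) unfolding co2 co3 by algebra
  qed
  note co = co2 co3 co4
  have u4: "u$4 = - u$1 - u$2 - u$3" using u(2) by (simp add: algebra_simps eq_neg_iff_add_eq_0)
  have trk: "trace (vf_jacobian v (p k)) = - a - e + (2 * (u$2 * a) + b1') * X k $ 1 + (a1' + 2 * (u$3 * e)) * X k $ 2" for k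
    unfolding pX[of k] unfolding tr unfolding trace_def sum_2 by (simp add: quad_lin_def J co2 co3 algebra_simps)
  have dtk: "det (vf_jacobian v (p k)) =
      (- a + 2 * (u$2 * a) * X k $ 1 + a1' * X k $ 2) * (- e + b1' * X k $ 1 + 2 * (u$3 * e) * X k $ 2)
      - (- b + a1' * X k $ 1 + 2 * (u$3 * b) * X k $ 2) * (- c + 2 * (u$2 * c) * X k $ 1 + b1' * X k $ 2)" for k
    unfolding pX[of k] unfolding dt unfolding det_2 by (simp add: quad_lin_def J co2 co3) algebra
  have X1: "X 1 $ 1 = 0" "X 1 $ 2 = 0" "X 2 $ 1 = 1 / u$2" "X 2 $ 2 = 0" "X 3 $ 1 = 0" "X 3 $ 2 = 1 / u$3"
    "X 4 $ 1 = - 1 / u$4" "X 4 $ 2 = - 1 / u$4" by (simp_all add: X_def)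
  have det1: "det (vf_jacobian v (p 1)) = a * e - b * c" unfolding dtk X1 by simp
  have ud: "u$k * det (vf_jacobian v (p k)) = u$1 * (a * e - b * c)" for k
  proof -
    have "u$2 * det (vf_jacobian v (p 2)) = u$1 * (a * e - b * c)"
    proof -
      have "u$2 * det (vf_jacobian v (p 2)) = a * (- u$2 * e + b1') - (- u$2 * b + a1') * c"
        unfolding dtk X1 using u(1)[of 2] by (simp add: field_simps)
      also have "\<dots> = u$1 * (a * e - b * c)" unfolding co4 u4 by algebra
      finally show ?thesis .
    qed
    moreover have "u$3 * det (vf_jacobian v (p 3)) = u$1 * (a * e - b * c)"
    proof -
      have "u$3 * det (vf_jacobian v (p 3)) = (- u$3 * a + a1') * e - b * (- u$3 * c + b1')"
        unfolding dtk X1 using u(1)[of 3] by (simp add: field_simps)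
      also have "\<dots> = u$1 * (a * e - b * c)" unfolding co4 u4 by algebra
      finally show ?thesis .
    qed
    moreover have "u$4 * det (vf_jacobian v (p 4)) = u$1 * (a * e - b * c)"
    proof -
      have "u$4 * (u$4 * det (vf_jacobian v (p 4))) = (- u$4 * a - 2 * (u$2 * a) - a1') * (- u$4 * e - b1' - 2 * (u$3 * e))
        - (- u$4 * b - a1' - 2 * (u$3 * b)) * (- u$4 * c - 2 * (u$2 * c) - b1')"
        unfolding dtk X1 using u(1)[of 4] by (simp add: divide_simps) algebra
      also have "\<dots> = u$4 * (u$1 * (a * e - b * c))" unfolding co4 u4 by algebra
      finally show ?thesis using u(1)[of 4] by simp
    qed
    ultimately show ?thesis using exhaust_4[of k] det1 by metis
  qed
  have t2: "u$2 * trace (vf_jacobian v (p 2)) = u$2 * a - (u$2 + u$4) * c + u$1 * e"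
  proof -
    have "u$2 * trace (vf_jacobian v (p 2)) = u$2 * (a - e) + b1'"
      unfolding trk X1 using u(1)[of 2] by (simp add: field_simps)
    then show ?thesis unfolding co4 u4 by algebra
  qed
  have t3: "u$3 * trace (vf_jacobian v (p 3)) = u$3 * e - (u$3 + u$4) * b + u$1 * a"
  proof -
    have "u$3 * trace (vf_jacobian v (p 3)) = u$3 * (e - a) + a1'"
      unfolding trk X1 using u(1)[of 3] by (simp add: field_simps)
    then show ?thesis unfolding co4 u4 by algebra
  qed
  have t4: "u$4 * trace (vf_jacobian v (p 4)) = - u$4 * (a + e) - 2 * (u$2 * a) - b1' - a1' - 2 * (u$3 * e)"
    unfolding trk X1 using u(1)[of 4] by (simp add: field_simps)
  have t1: "trace (vf_jacobian v (p 1)) = - (a + e)" unfolding trk X1 by simp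
  show ?thesis
  proof (rule that[OF detN])
    show conj: "quad_map a0 a1 a2 b0 b1 b2 (N *v x) = N *v normal_quad_map u a b c e x" for x
      unfolding co[symmetric] qm AN ..
    show "vf_at v (p 1 + N *v x) = N *v (normal_quad_map u a b c e x - vector [a * x$1 + b * x$2, c * x$1 + e * x$2])" for x
    proof -
      have "vf_at v (p 1 + N *v x) = N *v (J *v x + ?q x)" using v'[of x] AN(2) by metis
      also have "J *v x = - vector [a * x$1 + b * x$2, c * x$1 + e * x$2]"
        by (simp add: vec_eq_iff forall_2 matrix_vector_mult_2 J)
      finally show ?thesis unfolding co by (simp add: add.commute)
    qed
    show "det (vf_jacobian v (p k)) = u$1 * (a * e - b * c) / u$k" for k
      using ud[of k] u(1)[of k] by (simp add: eq_divide_eq mult.commute)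
    show "u$1 * trace (vf_jacobian v (p 1)) + u$2 * trace (vf_jacobian v (p 2))
       + u$3 * trace (vf_jacobian v (p 3)) + u$4 * trace (vf_jacobian v (p 4)) = 0"
      unfolding t1 t2 t3 t4 unfolding co4 u4 by algebra
  qed (rule t1 t2 t3)+
qed

text \<open>The last claim is the source of (BB). The divergence is affine with value
  \<open>t\<^sub>k\<close> at the \<open>k\<close>-th normalised point, so the coefficients
  \<open>L1\<close>, \<open>L2\<close> of its linear part are
  \<open>u\<^sub>2 (t\<^sub>2 - t\<^sub>1)\<close> and
  \<open>u\<^sub>3 (t\<^sub>3 - t\<^sub>1)\<close>. This turns \<open>quad_div\<close> into minus
  the resultant times a quadratic expression in the traces.\<close>

lemma normal_form_invariants:
  fixes u :: "complex^4" and a b c e :: complex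
  defines "a1 \<equiv> - (u$2 + u$4) * a - (u$3 + u$4) * b" and "b1 \<equiv> - (u$2 + u$4) * c - (u$3 + u$4) * e"
  assumes u: "u$1 + u$2 + u$3 + u$4 = 0" and D: "u$1 * (a * e - b * c) = 1"
  shows "quad_disc (u$2 * a) a1 (u$3 * b) (u$2 * c) b1 (u$3 * e)
      = cubic_disc (- u$2 * c) (u$2 * a + (u$2 + u$4) * c + (u$3 + u$4) * e)
        (- (u$3 * e + (u$3 + u$4) * b + (u$2 + u$4) * a)) (u$3 * b)"
    and "quad_res (u$2 * a) a1 (u$3 * b) (u$2 * c) b1 (u$3 * e) = u$2 * u$3 * u$4 / u$1"
    and "t$1 = - (a + e) \<Longrightarrow> u$2 * t$2 = u$2 * a - (u$2 + u$4) * c + u$1 * e \<Longrightarrow>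
      u$3 * t$3 = u$3 * e - (u$3 + u$4) * b + u$1 * a \<Longrightarrow>
      u$1 * t$1 + u$2 * t$2 + u$3 * t$3 + u$4 * t$4 = 0 \<Longrightarrow> (\<And>k. u$k \<noteq> 0) \<Longrightarrow>
      quad_div (u$2 * a) a1 (u$3 * b) (u$2 * c) b1 (u$3 * e) = - (u$2 * u$3 * u$4 / u$1) *
        (u$1 * (t$1)^2 + u$2 * (t$2)^2 + u$3 * (t$3)^2 + u$4 * (t$4)^2)"
proof -
  have u1: "u$1 \<noteq> 0" using D by auto
  have u4: "u$4 = - u$1 - u$2 - u$3" using u by (simp add: algebra_simps eq_neg_iff_add_eq_0)
  have Dinv: "x / u$1 = (a * e - b * c) * x" for x
    using D u1 by (simp add: divide_eq_eq mult_ac)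
  show "quad_disc (u$2 * a) a1 (u$3 * b) (u$2 * c) b1 (u$3 * e)
      = cubic_disc (- u$2 * c) (u$2 * a + (u$2 + u$4) * c + (u$3 + u$4) * e)
        (- (u$3 * e + (u$3 + u$4) * b + (u$2 + u$4) * a)) (u$3 * b)"
    unfolding quad_disc_def a1_def b1_def by (simp add: algebra_simps)
  show "quad_res (u$2 * a) a1 (u$3 * b) (u$2 * c) b1 (u$3 * e) = u$2 * u$3 * u$4 / u$1"
  proof -
    have "quad_res (u$2 * a) a1 (u$3 * b) (u$2 * c) b1 (u$3 * e)
      = (a * e - b * c) * (u$2 * u$3 * u$4) * (u$1 * (a * e - b * c))"
      unfolding quad_res_def a1_def b1_def u4 by algebra
    then show ?thesis unfolding D Dinv by simp
  qed
  show "quad_div (u$2 * a) a1 (u$3 * b) (u$2 * c) b1 (u$3 * e) = - (u$2 * u$3 * u$4 / u$1) *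
        (u$1 * (t$1)^2 + u$2 * (t$2)^2 + u$3 * (t$3)^2 + u$4 * (t$4)^2)"
    if t: "t$1 = - (a + e)" "u$2 * t$2 = u$2 * a - (u$2 + u$4) * c + u$1 * e"
      "u$3 * t$3 = u$3 * e - (u$3 + u$4) * b + u$1 * a"
      "u$1 * t$1 + u$2 * t$2 + u$3 * t$3 + u$4 * t$4 = 0" and unz: "\<And>k. u$k \<noteq> 0"
  proof -
    define L1 where "L1 = 2 * (u$2 * a) + b1"
    define L2 where "L2 = a1 + 2 * (u$3 * e)"
    have l2: "u$2 * (t$2 - t$1) = L1"
      using t(1,2) unfolding L1_def b1_def u4 by algebra
    have l3: "u$3 * (t$3 - t$1) = L2"
      using t(1,3) unfolding L2_def a1_def u4 by algebra
    have l4: "u$4 * (t$4 - t$1) = - (L1 + L2)"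
      using t(4) u unfolding l2[symmetric] l3[symmetric] by algebra
    have "quad_div (u$2 * a) a1 (u$3 * b) (u$2 * c) b1 (u$3 * e)
      = - (a * e - b * c) * (u$3 * (u$2 + u$4) * L1^2 + 2 * (u$2 * u$3) * (L1 * L2) + u$2 * (u$3 + u$4) * L2^2)"
      unfolding quad_div_def L1_def L2_def a1_def b1_def by algebra
    also have "u$3 * (u$2 + u$4) * L1^2 + 2 * (u$2 * u$3) * (L1 * L2) + u$2 * (u$3 + u$4) * L2^2
      = u$3 * u$4 * L1^2 + u$2 * u$4 * L2^2 + u$2 * u$3 * (L1 + L2)^2" by algebra
    also have "\<dots> = u$3 * u$4 * (u$2 * (t$2 - t$1))^2 + u$2 * u$4 * (u$3 * (t$3 - t$1))^2
        + u$2 * u$3 * (u$4 * (t$4 - t$1))^2"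
      unfolding l2 l3 l4 by algebra
    \<comment> \<open>By (EJ1) and (EJ2) the sum of
      \<open>u\<^sub>k (t\<^sub>k - t\<^sub>1)^2\<close> equals that of
      \<open>u\<^sub>k t\<^sub>k^2\<close>.\<close>
    also have "\<dots> = u$2 * u$3 * u$4 * (u$1 * (t$1)^2 + u$2 * (t$2)^2 + u$3 * (t$3)^2 + u$4 * (t$4)^2)"
      using u t(4) by algebra
    finally show ?thesis unfolding Dinv by (simp add: algebra_simps)
  qed
qed

text \<open>For \<open>r \<noteq> 0\<close> the equation is a genuine quadratic in
  \<open>x $ 1\<close> for each value of \<open>x $ 2\<close>; for \<open>r = 0\<close> it holds
  along \<open>x $ 2 = 0\<close>.\<close>

lemma infinite_conic:
  fixes r s u2 u3 m n :: complex
  assumes rs: "r \<noteq> 0 \<or> s \<noteq> 0" and u2: "u2 \<noteq> 0"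
  shows "infinite {x :: complex^2. r * (u2 * (x$1)^2 - m * (x$1 * x$2) - x$1)
    + s * (u3 * (x$2)^2 - n * (x$1 * x$2) - x$2) = 0}" (is "infinite ?S")
proof (cases "r = 0")
  case True
  have "range (\<lambda>x. vector [x, 0]) \<subseteq> ?S" using True by auto
  moreover have "inj (\<lambda>x. vector [x, 0] :: complex^2)" by (auto intro!: injI simp: vec_eq_iff forall_2)
  ultimately show ?thesis using infinite_UNIV_char_0 by (meson finite_subset finite_imageD)
next
  case False
  have "\<exists>x. vector [x, y] \<in> ?S" for y
  proof -
    obtain x where "(r * u2) * x^2 + (- r * m * y - r - s * n * y) * x + (s * (u3 * y^2 - y)) = 0"
      using complex_quadratic_root[of "r * u2"] False u2 by (metis mult_eq_0_iff)
    then have "vector [x, y] \<in> ?S" by simp algebra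
    then show ?thesis ..
  qed
  then obtain \<phi> where \<phi>: "\<And>y. vector [\<phi> y, y] \<in> ?S"
    using choice[of "\<lambda>y x. vector [x, y] \<in> ?S"] by blast
  have "range (\<lambda>y. vector [\<phi> y, y]) \<subseteq> ?S" using \<phi> by blast
  moreover have "inj (\<lambda>y. vector [\<phi> y, y] :: complex^2)" by (auto intro!: injI simp: vec_eq_iff forall_2)
  ultimately show ?thesis using infinite_UNIV_char_0 by (meson finite_subset finite_imageD)
qed

text \<open>With a singular matrix the two components are proportional combinations of the conics,
  so a single equation, or none, cuts out the zero set. This excludes degenerate singularities for
  fields with exactly four zeros.\<close>

lemma infinite_degenerate_zeros:
  fixes a b c e u2 u3 m n :: complex
  assumes D: "a * e - b * c = 0" and u2: "u2 \<noteq> 0"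
  shows "infinite {x. quad_map (u2 * a) (- m * a - n * b) (u3 * b) (u2 * c) (- m * c - n * e) (u3 * e) x
        - vector [a * x$1 + b * x$2, c * x$1 + e * x$2] = 0}" (is "infinite ?Z")
proof -
  define C1 where "C1 x = u2 * (x$1)^2 - m * (x$1 * x$2) - x$1" for x :: "complex^2"
  define C2 where "C2 x = u3 * (x$2)^2 - n * (x$1 * x$2) - x$2" for x :: "complex^2"
  have Z: "?Z = {x. a * C1 x + b * C2 x = 0 \<and> c * C1 x + e * C2 x = 0}"
    by (auto simp: vec_eq_iff forall_2 quad_map_def C1_def C2_def algebra_simps)
  have inf: "infinite {x. r * C1 x + s * C2 x = 0}" if "r \<noteq> 0 \<or> s \<noteq> 0" for r s
    unfolding C1_def C2_def using infinite_conic[OF that u2] .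
  have 1: "?Z = {x. a * C1 x + b * C2 x = 0}" if ab: "a \<noteq> 0 \<or> b \<noteq> 0"
  proof -
    have "c * C1 x + e * C2 x = 0" if "a * C1 x + b * C2 x = 0" for x
    proof -
      have "a * (c * C1 x + e * C2 x) = 0" "b * (c * C1 x + e * C2 x) = 0" using D that by algebra+
      then show ?thesis using ab by auto
    qed
    then show ?thesis unfolding Z by blast
  qed
  have 2: "?Z = {x. c * C1 x + e * C2 x = 0}" if "a = 0" "b = 0"
    unfolding Z using that by simp
  have 3: "?Z = UNIV" if "a = 0" "b = 0" "c = 0" "e = 0"
    unfolding Z using that by simp
  show ?thesis
  proof (cases "a \<noteq> 0 \<or> b \<noteq> 0")
    case True
    then show ?thesis using 1 inf[OF True] by simp
  next
    case ab: False
    show ?thesis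
    proof (cases "c \<noteq> 0 \<or> e \<noteq> 0")
      case True
      then show ?thesis using 2 ab inf[OF True] by simp
    next
      case False
      have "infinite {x. 1 * C1 x + 0 * C2 x = 0}" by (rule inf) simp
      then have "infinite (UNIV :: (complex^2) set)" by (metis finite_subset subset_UNIV)
      then show ?thesis using 3 ab False by simp
    qed
  qed
qed

text \<open>These are the coefficients of the affine dependence of four points in the plane; each is
  nonzero because the other three points are not collinear.\<close>

lemma four_points_weights:
  assumes v: "vfield_coeffs v C0 B a0 a1 a2 b0 b1 b2" and fin: "finite (sing v)"
    and p: "\<And>k. p k \<in> sing v" "inj (p :: 4 \<Rightarrow> complex^2)"
  obtains u :: "complex^4" where "\<And>k. u$k \<noteq> 0" "u$1 + u$2 + u$3 + u$4 = 0"
    "u$2 *s (p 2 - p 1) + u$3 *s (p 3 - p 1) + u$4 *s (p 4 - p 1) = 0"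
    "(p 2 - p 1)$1 * (p 3 - p 1)$2 - (p 2 - p 1)$2 * (p 3 - p 1)$1 \<noteq> 0"
proof -
  have ne: "p i \<noteq> p j" if "i \<noteq> j" for i j using p(2) that by (simp add: inj_eq)
  have col: False if "i \<noteq> j" "i \<noteq> k" "j \<noteq> k" "p k - p i = s *s (p j - p i)" for i j k s
  proof (rule no_three_collinear_zeros[OF v fin, of "p i" "p j - p i" s])
    show "p i \<in> sing v" "p i + (p j - p i) \<in> sing v" using p(1) by simp_all
    have "p i + s *s (p j - p i) = p k" unfolding that(4)[symmetric] by simp
    then show "p i + s *s (p j - p i) \<in> sing v" using p(1) by simp
    show "p j - p i \<noteq> 0" using ne[OF that(1)] by simp
    show "s \<noteq> 0" using that(4) ne[OF that(2)] by auto
    show "s \<noteq> 1" using that(4) ne[OF that(3)] by auto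
  qed
  define f where "f = p 2 - p 1"
  define g where "g = p 3 - p 1"
  define h where "h = p 4 - p 1"
  define D where "D = f$1 * g$2 - f$2 * g$1"
  have f0: "f \<noteq> 0" using ne[of 2 1] by (simp add: f_def)
  have D0: "D \<noteq> 0"
  proof
    assume D: "D = 0"
    have "\<exists>s. g = s *s f"
    proof (cases "f$1 = 0")
      case True
      then have f2: "f$2 \<noteq> 0" using f0 by (simp add: vec_eq_iff forall_2)
      then have "g$1 = 0" using D True by (simp add: D_def)
      then show ?thesis using True f2
        by (intro exI[of _ "g$2 / f$2"]) (simp add: vec_eq_iff forall_2)
    next
      case False
      then show ?thesis using D
        by (intro exI[of _ "g$1 / f$1"]) (simp add: vec_eq_iff forall_2 D_def field_simps)
    qed
    then show False using col[of 1 2 3] by (auto simp: f_def g_def)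
  qed
  define \<alpha> where "\<alpha> = (h$1 * g$2 - h$2 * g$1) / D"
  define \<beta> where "\<beta> = (f$1 * h$2 - f$2 * h$1) / D"
  have h: "h = \<alpha> *s f + \<beta> *s g"
  proof -
    have "D * \<alpha> = h$1 * g$2 - h$2 * g$1" "D * \<beta> = f$1 * h$2 - f$2 * h$1"
      using D0 by (simp_all add: \<alpha>_def \<beta>_def)
    then have "D * h$1 = D * (\<alpha> * f$1 + \<beta> * g$1)" "D * h$2 = D * (\<alpha> * f$2 + \<beta> * g$2)"
      unfolding D_def by algebra+
    then show ?thesis using D0 by (simp add: vec_eq_iff forall_2)
  qed
  have "\<alpha> \<noteq> 0"
  proof
    assume "\<alpha> = 0"
    then have "p 4 - p 1 = \<beta> *s (p 3 - p 1)" using h by (simp add: h_def g_def)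
    from col[OF _ _ _ this] show False by simp
  qed
  moreover have "\<beta> \<noteq> 0"
  proof
    assume "\<beta> = 0"
    then have "p 4 - p 1 = \<alpha> *s (p 2 - p 1)" using h by (simp add: h_def f_def)
    from col[OF _ _ _ this] show False by simp
  qed
  moreover have "\<alpha> + \<beta> - 1 \<noteq> 0"
  proof
    assume "\<alpha> + \<beta> - 1 = 0"
    then have \<alpha>: "\<alpha> = 1 - \<beta>" by (simp add: algebra_simps)
    have "h - f = \<beta> *s (g - f)" unfolding h \<alpha> by (simp add: vec_eq_iff algebra_simps)
    then have "p 4 - p 2 = \<beta> *s (p 3 - p 2)" by (simp add: f_def g_def h_def)
    from col[OF _ _ _ this] show False by simp
  qed
  ultimately have ne0: "\<forall>k. (vector [\<alpha> + \<beta> - 1, - \<alpha>, - \<beta>, 1] :: complex^4) $ k \<noteq> 0"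
    by (simp add: forall_4)
  have "- \<alpha> *s f + - \<beta> *s g + 1 *s h = 0" unfolding h by (simp add: vec_eq_iff)
  then show ?thesis
    using D0 ne0 unfolding D_def f_def g_def h_def
    by (intro that[of "vector [\<alpha> + \<beta> - 1, - \<alpha>, - \<beta>, 1]"]) simp_all
qed

text \<open>The normal form is taken twice. With arbitrary weights it gives
  \<open>d\<^sub>1 \<noteq> 0\<close>; only then can the weights be scaled to
  \<open>u\<^sub>1 = 1 / d\<^sub>1\<close>, after which \<open>u\<^sub>k = 1 / d\<^sub>k\<close> for
  all \<open>k\<close>.\<close>

lemma spectrum_realizable:
  assumes V: "v \<in> V2" and sp: "extended_spectrum v t d l"
  obtains u where "\<And>k. u$k \<noteq> 0" "\<And>k. d$k = 1 / u$k" "u$1 + u$2 + u$3 + u$4 = 0"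
    "realizable u t (l$1 * l$2 * l$3)"
proof -
  obtain p q where p: "bij_betw p (UNIV :: 4 set) (sing v)" and q: "bij_betw q (UNIV :: 3 set) (inf_sing v)"
    and t: "\<And>k. t $ k = trace (vf_jacobian v (p k))" and d: "\<And>k. d $ k = det (vf_jacobian v (p k))"
    and l: "char_numbers v q l"
    using sp unfolding extended_spectrum_def by blast
  have quad: "quadratic v" and card4: "card (sing v) = 4" using V by (simp_all add: V2_def)
  obtain C0 B a0 a1 a2 b0 b1 b2 where v: "vfield_coeffs v C0 B a0 a1 a2 b0 b1 b2"
    using vfield_coeffs_of_quadratic[OF quad] .
  have fin: "finite (sing v)" using card4 by (metis card.infinite zero_neq_numeral)
  have ps: "p k \<in> sing v" for k using p unfolding bij_betw_def by blast
  have pinj: "inj p" using p unfolding bij_betw_def by blast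
  obtain w :: "complex^4" where w: "\<And>k. w$k \<noteq> 0" "w$1 + w$2 + w$3 + w$4 = 0"
    "w$2 *s (p 2 - p 1) + w$3 *s (p 3 - p 1) + w$4 *s (p 4 - p 1) = 0"
    and ind: "(p 2 - p 1)$1 * (p 3 - p 1)$2 - (p 2 - p 1)$2 * (p 3 - p 1)$1 \<noteq> 0"
    using four_points_weights[OF v fin ps pinj] by blast
  have d1: "d$1 \<noteq> 0"
  proof
    assume "d$1 = 0"
    obtain N a b c e where N: "det N \<noteq> 0"
      and vN: "\<And>x. vf_at v (p 1 + N *v x) = N *v (normal_quad_map w a b c e x - vector [a * x$1 + b * x$2, c * x$1 + e * x$2])"
      and dN: "\<And>k. det (vf_jacobian v (p k)) = w$1 * (a * e - b * c) / w$k"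
      using normal_form[OF v ps w ind] by metis
    have D: "a * e - b * c = 0" using dN[of 1] \<open>d$1 = 0\<close> d[of 1] w(1)[of 1] by simp
    let ?Z = "{x. normal_quad_map w a b c e x - vector [a * x$1 + b * x$2, c * x$1 + e * x$2] = 0}"
    have "(\<lambda>x. p 1 + N *v x) ` ?Z \<subseteq> sing v" by (auto simp: sing_def vN)
    moreover have "inj (\<lambda>x. p 1 + N *v x)"
      using N inj_matrix_vector_mult[of N] by (simp add: invertible_det_nz inj_def)
    ultimately have "finite ?Z"
      using fin by (meson finite_subset finite_imageD inj_on_subset subset_UNIV)
    then show False using infinite_degenerate_zeros[OF D w(1)[of 2]] by blast
  qed
  define u where "u = (1 / (w$1 * d$1)) *s w"
  have u: "u$k \<noteq> 0" for k using w(1) d1 by (simp add: u_def)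
  have usum: "u$1 + u$2 + u$3 + u$4 = (1 / (w$1 * d$1)) * (w$1 + w$2 + w$3 + w$4)"
    by (simp add: u_def algebra_simps)
  then have u0: "u$1 + u$2 + u$3 + u$4 = 0" unfolding w(2) by simp
  have "u$2 *s (p 2 - p 1) + u$3 *s (p 3 - p 1) + u$4 *s (p 4 - p 1)
    = (1 / (w$1 * d$1)) *s (w$2 *s (p 2 - p 1) + w$3 *s (p 3 - p 1) + w$4 *s (p 4 - p 1))"
    by (simp add: u_def vec_eq_iff algebra_simps)
  then have up: "u$2 *s (p 2 - p 1) + u$3 *s (p 3 - p 1) + u$4 *s (p 4 - p 1) = 0"
    unfolding w(3) by simp
  obtain N a b c e where N: "det N \<noteq> 0"
    and conj: "\<And>x. quad_map a0 a1 a2 b0 b1 b2 (N *v x) = N *v normal_quad_map u a b c e x"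
    and dN: "\<And>k. det (vf_jacobian v (p k)) = u$1 * (a * e - b * c) / u$k"
    and tN: "trace (vf_jacobian v (p 1)) = - (a + e)"
    "u$2 * trace (vf_jacobian v (p 2)) = u$2 * a - (u$2 + u$4) * c + u$1 * e"
    "u$3 * trace (vf_jacobian v (p 3)) = u$3 * e - (u$3 + u$4) * b + u$1 * a"
    "u$1 * trace (vf_jacobian v (p 1)) + u$2 * trace (vf_jacobian v (p 2))
       + u$3 * trace (vf_jacobian v (p 3)) + u$4 * trace (vf_jacobian v (p 4)) = 0"
    using normal_form[OF v ps u u0 up ind] by metis
  have "d$1 = a * e - b * c" using dN[of 1] d[of 1] u[of 1] by simp
  then have D: "u$1 * (a * e - b * c) = 1" using w(1)[of 1] d1 by (simp add: u_def)
  have inf: "infinity_relations (u$2 * a) (- (u$2 + u$4) * a - (u$3 + u$4) * b) (u$3 * b)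
       (u$2 * c) (- (u$2 + u$4) * c - (u$3 + u$4) * e) (u$3 * e) l"
    by (rule char_numbers_infinity_relations[OF v q l N conj])
  note nf = normal_form_invariants[OF u0 D]
  have "realizable u t (l$1 * l$2 * l$3)"
    unfolding realizable_def
  proof (intro exI conjI)
    show "u$1 * (a * e - b * c) = 1" by (rule D)
    show "t$1 = - (a + e)" "u$2 * t$2 = u$2 * a - (u$2 + u$4) * c + u$1 * e"
      "u$3 * t$3 = u$3 * e - (u$3 + u$4) * b + u$1 * a"
      "u$1 * t$1 + u$2 * t$2 + u$3 * t$3 + u$4 * t$4 = 0" unfolding t by (rule tN)+
    show "l$1 * l$2 * l$3 * cubic_disc (- u$2 * c) (u$2 * a + (u$2 + u$4) * c + (u$3 + u$4) * e)
        (- (u$3 * e + (u$3 + u$4) * b + (u$2 + u$4) * a)) (u$3 * b) = - (u$2 * u$3 * u$4) / u$1"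
      using inf unfolding infinity_relations_def nf(1,2) by simp
  qed
  then show ?thesis using u u0 by (intro that[of u]) (simp_all add: d dN D)
qed

text \<open>The field is written down in normal coordinates. Its matrix is invertible, so the
  singularities are the common zeros of the two conics, and the discriminant equation forces three
  distinct points at infinity. One \<open>l\<close> is returned with all its permutations, as the
  order has to be matched later.\<close>

lemma realizable_spectrum:
  assumes u: "\<And>k. u$k \<noteq> 0" "u$1 + u$2 + u$3 + u$4 = 0" and re: "realizable u t \<Lambda>"
  obtains v and l :: "complex^3" where "v \<in> V2"
    "\<And>\<pi> :: 3 \<Rightarrow> 3. bij \<pi> \<Longrightarrow> extended_spectrum v t (\<chi> k. 1 / u$k) (\<chi> j. l $ \<pi> j)"
    "l$1 + l$2 + l$3 = 1" "l$1 * l$2 * l$3 = \<Lambda>"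
    "l$1 * l$2 + l$1 * l$3 + l$2 * l$3
      = \<Lambda> * (9 - (u$1 * (t$1)^2 + u$2 * (t$2)^2 + u$3 * (t$3)^2 + u$4 * (t$4)^2))"
proof -
  obtain a b c e where D: "u$1 * (a * e - b * c) = 1" and t: "t$1 = - (a + e)"
     "u$2 * t$2 = u$2 * a - (u$2 + u$4) * c + u$1 * e"
     "u$3 * t$3 = u$3 * e - (u$3 + u$4) * b + u$1 * a"
     "u$1 * t$1 + u$2 * t$2 + u$3 * t$3 + u$4 * t$4 = 0"
    and disc: "\<Lambda> * cubic_disc (- u$2 * c) (u$2 * a + (u$2 + u$4) * c + (u$3 + u$4) * e)
        (- (u$3 * e + (u$3 + u$4) * b + (u$2 + u$4) * a)) (u$3 * b) = - (u$2 * u$3 * u$4) / u$1"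
    using re unfolding realizable_def by blast
  note nf = normal_form_invariants[OF u(2) D]
  let ?a1 = "- (u$2 + u$4) * a - (u$3 + u$4) * b" and ?b1 = "- (u$2 + u$4) * c - (u$3 + u$4) * e"
  let ?disc = "quad_disc (u$2 * a) ?a1 (u$3 * b) (u$2 * c) ?b1 (u$3 * e)"
  have disc': "\<Lambda> * ?disc = - (u$2 * u$3 * u$4 / u$1)" unfolding nf(1) using disc by simp
  have disc0: "?disc \<noteq> 0" using disc' u(1) by auto
  define B :: "complex^2^2" where "B = vector [vector [- a, - b], vector [- c, - e]]"
  obtain v where v: "vfield_coeffs v 0 B (u$2 * a) ?a1 (u$3 * b) (u$2 * c) ?b1 (u$3 * e)"
    using vfield_coeffs_ex by blast
  define p where "p k = (if k = 1 then 0 else if k = 2 then vector [1 / u$2, 0]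
    else if k = 3 then vector [0, 1 / u$3] else vector [- 1 / u$4, - 1 / u$4] :: complex^2)" for k :: 4
  have p_simps: "p 1 = 0" "p 2 = vector [1 / u$2, 0]" "p 3 = vector [0, 1 / u$3]"
    "p 4 = vector [- 1 / u$4, - 1 / u$4]" by (simp_all add: p_def)
  have u4: "u$4 = - u$1 - u$2 - u$3" using u(2) by (simp add: algebra_simps eq_neg_iff_add_eq_0)
  define C1 where "C1 x = x$1 * (u$2 * x$1 - (u$2 + u$4) * x$2 - 1)" for x :: "complex^2"
  define C2 where "C2 x = x$2 * (u$3 * x$2 - (u$3 + u$4) * x$1 - 1)" for x :: "complex^2"
  have vf: "vf_at v x $ 1 = a * C1 x + b * C2 x" "vf_at v x $ 2 = c * C1 x + e * C2 x" for x
    using v by (simp_all add: vfield_coeffs_def quad_map_def matrix_vector_mult_2 B_def C1_def C2_def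
        algebra_simps power2_eq_square)
  have sing_iff: "x \<in> sing v \<longleftrightarrow> C1 x = 0 \<and> C2 x = 0" for x
  proof
    assume "x \<in> sing v"
    then have "a * C1 x + b * C2 x = 0" "c * C1 x + e * C2 x = 0"
      using vf[of x] by (simp_all add: sing_def)
    then have "(a * e - b * c) * C1 x = 0" "(a * e - b * c) * C2 x = 0" by algebra+
    then show "C1 x = 0 \<and> C2 x = 0" using D by auto
  qed (simp add: sing_def vec_eq_iff forall_2 vf)
  have p_sing: "p k \<in> sing v" for k
    using exhaust_4[of k] u(1) by (auto simp: sing_iff p_simps C1_def C2_def field_simps)
  have sing_p: "x \<in> range p" if "x \<in> sing v" for x
  proof -
    have C: "C1 x = 0" "C2 x = 0" using that sing_iff by simp_all
    show ?thesis
    proof (cases "x$1 = 0")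
      case True
      then have "x$2 = 0 \<or> u$3 * x$2 = 1" using C(2) by (simp add: C2_def)
      then have "x = p 1 \<or> x = p 3"
        using True u(1)[of 3] by (auto simp: p_simps vec_eq_iff forall_2 field_simps)
      then show ?thesis by blast
    next
      case x1: False
      show ?thesis
      proof (cases "x$2 = 0")
        case True
        then have "u$2 * x$1 = 1" using C(1) x1 by (simp add: C1_def)
        then have "x = p 2"
          using True u(1)[of 2] by (auto simp: p_simps vec_eq_iff forall_2 field_simps)
        then show ?thesis by blast
      next
        case False
        then have e: "u$2 * x$1 - (u$2 + u$4) * x$2 - 1 = 0" "u$3 * x$2 - (u$3 + u$4) * x$1 - 1 = 0"
          using C x1 by (simp_all add: C1_def C2_def)
        \<comment> \<open>The two remaining linear equations have determinant
          \<open>u\<^sub>1 u\<^sub>4\<close>, so they meet in a single point.\<close>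
        then have "u$1 * (u$4 * x$1 + 1) = 0" "u$1 * (u$4 * x$2 + 1) = 0"
          unfolding u4 by algebra+
        then have "u$4 * x$1 + 1 = 0" "u$4 * x$2 + 1 = 0" using u(1)[of 1] by simp_all
        then have "x = p 4"
          using u(1)[of 4] by (simp add: p_simps vec_eq_iff forall_2 field_simps eq_neg_iff_add_eq_0)
        then show ?thesis by blast
      qed
    qed
  qed
  have p_inj: "inj p"
  proof (rule injI)
    fix i j assume "p i = p j"
    then have "p i $ 1 = p j $ 1" "p i $ 2 = p j $ 2" by simp_all
    then show "i = j"
      using exhaust_4[of i] exhaust_4[of j] u(1) by (auto simp: p_simps)
  qed
  have p_bij: "bij_betw p UNIV (sing v)"
    unfolding bij_betw_def using p_inj p_sing sing_p by blast
  obtain q l where q: "bij_betw q (UNIV :: 3 set) (inf_sing v)" and l: "char_numbers v q l"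
    and nonzero: "\<exists>x. inf_form v x \<noteq> 0"
    using char_numbers_ex[OF v disc0] by blast
  have card4: "card (sing v) = 4" using bij_betw_same_card[OF p_bij] by simp
  have card3: "card (inf_sing v) = 3" using bij_betw_same_card[OF q] by simp
  have V: "v \<in> V2" using v nonzero card4 card3 by (simp add: V2_def vfield_coeffs_def)
  have inf: "infinity_relations (u$2 * a) ?a1 (u$3 * b) (u$2 * c) ?b1 (u$3 * e) l"
    by (rule char_numbers_infinity_relations[OF v q l, of "mat 1"]) simp_all
  have p1p2: "(p 2 - p 1)$1 * (p 3 - p 1)$2 - (p 2 - p 1)$2 * (p 3 - p 1)$1 \<noteq> 0"
    using u(1) by (simp add: p_simps)
  have up: "u$2 *s (p 2 - p 1) + u$3 *s (p 3 - p 1) + u$4 *s (p 4 - p 1) = 0"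
    using u(1) by (simp add: p_simps vec_eq_iff forall_2)
  \<comment> \<open>\<open>normal_form\<close> yields some matrix for \<open>v\<close>; only its
    determinant is kept, and it is identified by the Jacobian at the origin.\<close>
  obtain D' where dD: "\<And>k. det (vf_jacobian v (p k)) = u$1 * D' / u$k"
    and tsum: "u$1 * trace (vf_jacobian v (p 1)) + u$2 * trace (vf_jacobian v (p 2))
       + u$3 * trace (vf_jacobian v (p 3)) + u$4 * trace (vf_jacobian v (p 4)) = 0"
    using normal_form[OF v p_sing u up p1p2] by metis
  have jac1: "vf_jacobian v (p 1) = B"
    unfolding vf_jacobian_coeffs[OF v] p_simps by (simp add: quad_lin_def vec_eq_iff forall_2)
  have "D' = a * e - b * c" using dD[of 1] u(1)[of 1] unfolding jac1 by (simp add: det_2 B_def)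
  then have dets: "det (vf_jacobian v (p k)) = 1 / u$k" for k using dD D by simp
  have tr1: "trace (vf_jacobian v (p 1)) = t$1"
    unfolding jac1 t(1) by (simp add: trace_def sum_2 B_def)
  have tr2: "trace (vf_jacobian v (p 2)) = t$2"
  proof -
    have "u$2 * trace (vf_jacobian v (p 2)) = u$2 * t$2"
      unfolding t(2) vf_jacobian_coeffs[OF v] p_simps trace_def sum_2 u4 using u(1)[of 2]
      by (simp add: quad_lin_def B_def field_simps)
    then show ?thesis using u(1)[of 2] by simp
  qed
  have tr3: "trace (vf_jacobian v (p 3)) = t$3"
  proof -
    have "u$3 * trace (vf_jacobian v (p 3)) = u$3 * t$3"
      unfolding t(3) vf_jacobian_coeffs[OF v] p_simps trace_def sum_2 u4 using u(1)[of 3]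
      by (simp add: quad_lin_def B_def field_simps)
    then show ?thesis using u(1)[of 3] by simp
  qed
  have tr4: "trace (vf_jacobian v (p 4)) = t$4"
  proof -
    have "u$4 * trace (vf_jacobian v (p 4)) = u$4 * t$4"
      using tsum t(4) unfolding tr1 tr2 tr3 by (metis add_left_imp_eq)
    then show ?thesis using u(1)[of 4] by simp
  qed
  have trs: "t$k = trace (vf_jacobian v (p k))" for k
    using exhaust_4[of k] tr1 tr2 tr3 tr4 by metis
  show ?thesis
  proof (rule that[OF V])
    fix \<pi> :: "3 \<Rightarrow> 3" assume \<pi>: "bij \<pi>"
    have "bij_betw (q \<circ> \<pi>) UNIV (inf_sing v)" using bij_betw_trans[OF \<pi> q] .
    then show "extended_spectrum v t (\<chi> k. 1 / u$k) (\<chi> j. l $ \<pi> j)"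
      unfolding extended_spectrum_def
      using p_bij trs dets char_numbers_permute[OF l \<pi>]
      by (intro exI[of _ p] exI[of _ "q \<circ> \<pi>"]) simp
  next
    show "l$1 + l$2 + l$3 = 1" using inf by (simp add: infinity_relations_def)
    have "l$1 * l$2 * l$3 * ?disc = \<Lambda> * ?disc"
      using inf disc' unfolding infinity_relations_def nf(2) by simp
    then show "l$1 * l$2 * l$3 = \<Lambda>" using disc0 by simp
    let ?S = "u$1 * (t$1)^2 + u$2 * (t$2)^2 + u$3 * (t$3)^2 + u$4 * (t$4)^2"
    have "(l$1 * l$2 + l$1 * l$3 + l$2 * l$3) * ?disc = - (u$2 * u$3 * u$4 / u$1) * (9 - ?S)"
      using inf unfolding infinity_relations_def nf(2) nf(3)[OF t u(1)] by (simp add: algebra_simps)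
    also have "\<dots> = \<Lambda> * (9 - ?S) * ?disc" unfolding disc'[symmetric] by (simp add: mult_ac)
    finally show "l$1 * l$2 + l$1 * l$3 + l$2 * l$3 = \<Lambda> * (9 - ?S)" using disc0 by simp
  qed
qed


section \<open>Closure of the set of spectra\<close>

definition spec_polyfun :: "(complex^4 \<Rightarrow> complex^4 \<Rightarrow> complex^'n \<Rightarrow> complex) \<Rightarrow> bool" where
  "spec_polyfun f \<longleftrightarrow> (\<exists>H. \<forall>t d l. spec_eval H t d l = f t d l)"

lemma spec_polyfun_const: "spec_polyfun (\<lambda>t d l. c)"
  unfolding spec_polyfun_def spec_eval_def
  by (rule exI[of _ "Poly_Mapping.single 0 c"]) (simp add: mpoly_eval_const)

lemma spec_polyfun_var:
  "spec_polyfun (\<lambda>t d l. t $ k)" "spec_polyfun (\<lambda>t d l. d $ k)" "spec_polyfun (\<lambda>t d l. l $ j)"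
  unfolding spec_polyfun_def spec_eval_def
  by (rule exI[of _ "Poly_Mapping.single (Poly_Mapping.single (VarT k) 1) 1"], simp add: mpoly_eval_var del: One_nat_def)
    (rule exI[of _ "Poly_Mapping.single (Poly_Mapping.single (VarD k) 1) 1"], simp add: mpoly_eval_var del: One_nat_def,
     rule exI[of _ "Poly_Mapping.single (Poly_Mapping.single (VarL j) 1) 1"], simp add: mpoly_eval_var del: One_nat_def)

lemma spec_polyfun_add:
  assumes "spec_polyfun f" "spec_polyfun g"
  shows "spec_polyfun (\<lambda>t d l. f t d l + g t d l)"
proof -
  obtain p q where "\<forall>t d l. spec_eval p t d l = f t d l" "\<forall>t d l. spec_eval q t d l = g t d l"
    using assms unfolding spec_polyfun_def by blast
  then show ?thesis unfolding spec_polyfun_def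
    by (intro exI[of _ "p + q"]) (simp add: spec_eval_def mpoly_eval_add)
qed

lemma spec_polyfun_mult:
  assumes "spec_polyfun f" "spec_polyfun g"
  shows "spec_polyfun (\<lambda>t d l. f t d l * g t d l)"
proof -
  obtain p q where pq: "\<forall>t d l. spec_eval p t d l = f t d l" "\<forall>t d l. spec_eval q t d l = g t d l"
    using assms unfolding spec_polyfun_def by blast
  obtain r where "\<forall>x. mpoly_eval r x = mpoly_eval p x * mpoly_eval q x"
    using mpoly_eval_mult_ex by blast
  then show ?thesis unfolding spec_polyfun_def
    using pq by (intro exI[of _ r]) (simp add: spec_eval_def)
qed

lemma spec_polyfun_power: "spec_polyfun f \<Longrightarrow> spec_polyfun (\<lambda>t d l. f t d l ^ k)"
  by (induction k) (simp_all add: spec_polyfun_const spec_polyfun_mult)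

lemmas spec_polyfun_intros = spec_polyfun_const spec_polyfun_var spec_polyfun_add
  spec_polyfun_mult spec_polyfun_power

section \<open>Passage between the chart and the spectra\<close>

definition chart_inv :: "complex^4 \<Rightarrow> complex^4 \<Rightarrow> complex \<Rightarrow> complex^7" where
  "chart_inv t d \<Lambda> = vector [1 / d$2 + 1 / d$4, 1 / d$3 + 1 / d$4, 1 / d$2 + 1 / d$3,
     t$2 * d$1, t$3 * d$1, t$4 * d$1, \<Lambda>]"

lemma chart_inv_eq:
  assumes "EJ1 d" "EJ2 t d" "\<And>k. d$k \<noteq> 0"
  shows "chart_u (chart_inv t d \<Lambda>) = (\<chi> k. 1 / d$k)" "chart_t (chart_inv t d \<Lambda>) = t"
proof -
  define u where "u = (\<chi> k. 1 / d$k)"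
  have u: "u$k = 1 / d$k" for k by (simp add: u_def)
  have X: "chart_inv t d \<Lambda> = vector [u$2 + u$4, u$3 + u$4, u$2 + u$3, t$2 / u$1, t$3 / u$1, t$4 / u$1, \<Lambda>]"
    unfolding chart_inv_def u by simp
  have "u$1 \<noteq> 0" "u$1 + u$2 + u$3 + u$4 = 0"
    "u$1 * t$1 + u$2 * t$2 + u$3 * t$3 + u$4 * t$4 = 0"
    using assms unfolding u EJ1_def EJ2_def sum_4 by simp_all
  from chart_surj[OF this, of \<Lambda>] show "chart_u (chart_inv t d \<Lambda>) = (\<chi> k. 1 / d$k)"
    "chart_t (chart_inv t d \<Lambda>) = t"
    unfolding X u_def[symmetric] by simp_all
qed

lemma chart_inv_chart:
  assumes "\<And>k. chart_u x $ k \<noteq> 0"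
  shows "chart_inv (chart_t x) (\<chi> k. 1 / chart_u x $ k) (x$7) = x"
  using assms[of 1] chart_u_relations[of x]
  by (simp add: chart_inv_def vec_eq_iff forall_7) (simp add: chart_t_def)

text \<open>Each coordinate of \<open>chart_inv\<close> is of degree at most one in the
  \<open>1 / d\<^sub>k\<close>, so one factor \<open>d\<^sub>1 d\<^sub>2 d\<^sub>3 d\<^sub>4\<close>
  clears it. In a sum each summand is multiplied by the power belonging to the other.\<close>

lemma clear_denominators:
  assumes "cpolyfun f"
  shows "\<exists>K. \<exists>g :: complex^4 \<Rightarrow> complex^4 \<Rightarrow> complex^1 \<Rightarrow> complex. spec_polyfun g \<and>
    (\<forall>t d l. (\<forall>k. d$k \<noteq> 0) \<longrightarrow> g t d l = (d$1 * d$2 * d$3 * d$4) ^ K * f (chart_inv t d (l$1)))"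
  using assms
proof (induction rule: cpolyfun.induct)
  case (cpolyfun_const c)
  show ?case
    by (rule exI[of _ 0], rule exI[of _ "\<lambda>t d l. c"]) (simp add: spec_polyfun_intros)
next
  case (cpolyfun_nth i)
  have 1: ?case if "spec_polyfun g"
    "\<And>t d l. (\<forall>k. d$k \<noteq> 0) \<Longrightarrow> g t d l = d$1 * d$2 * d$3 * d$4 * chart_inv t d (l$1) $ i"
    for g :: "complex^4 \<Rightarrow> complex^4 \<Rightarrow> complex^1 \<Rightarrow> complex"
    by (rule exI[of _ 1], rule exI[of _ g]) (use that in simp)
  consider "i = 1" | "i = 2" | "i = 3" | "i = 4" | "i = 5" | "i = 6" | "i = 7"
    using exhaust_7[of i] by blast
  then show ?case
  proof cases
    assume i: "i = 1"
    show ?thesis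
      by (rule 1[of "\<lambda>t d l. d$1 * d$3 * d$4 + d$1 * d$2 * d$3"], intro spec_polyfun_intros)
        (simp add: i chart_inv_def field_simps)
  next
    assume i: "i = 2"
    show ?thesis
      by (rule 1[of "\<lambda>t d l. d$1 * d$2 * d$4 + d$1 * d$2 * d$3"], intro spec_polyfun_intros)
        (simp add: i chart_inv_def field_simps)
  next
    assume i: "i = 3"
    show ?thesis
      by (rule 1[of "\<lambda>t d l. d$1 * d$3 * d$4 + d$1 * d$2 * d$4"], intro spec_polyfun_intros)
        (simp add: i chart_inv_def field_simps)
  next
    assume i: "i = 4"
    show ?thesis
      by (rule 1[of "\<lambda>t d l. d$1 * d$2 * d$3 * d$4 * (t$2 * d$1)"], intro spec_polyfun_intros)
        (simp add: i chart_inv_def)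
  next
    assume i: "i = 5"
    show ?thesis
      by (rule 1[of "\<lambda>t d l. d$1 * d$2 * d$3 * d$4 * (t$3 * d$1)"], intro spec_polyfun_intros)
        (simp add: i chart_inv_def)
  next
    assume i: "i = 6"
    show ?thesis
      by (rule 1[of "\<lambda>t d l. d$1 * d$2 * d$3 * d$4 * (t$4 * d$1)"], intro spec_polyfun_intros)
        (simp add: i chart_inv_def)
  next
    assume i: "i = 7"
    show ?thesis
      by (rule 1[of "\<lambda>t d l. d$1 * d$2 * d$3 * d$4 * l$1"], intro spec_polyfun_intros)
        (simp add: i chart_inv_def)
  qed
next
  case (cpolyfun_add f1 f2)
  then obtain K1 K2 and g1 g2 :: "complex^4 \<Rightarrow> complex^4 \<Rightarrow> complex^1 \<Rightarrow> complex"
    where g: "spec_polyfun g1" "spec_polyfun g2"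
    "\<And>t d l. (\<forall>k. d$k \<noteq> 0) \<Longrightarrow> g1 t d l = (d$1 * d$2 * d$3 * d$4) ^ K1 * f1 (chart_inv t d (l$1))"
    "\<And>t d l. (\<forall>k. d$k \<noteq> 0) \<Longrightarrow> g2 t d l = (d$1 * d$2 * d$3 * d$4) ^ K2 * f2 (chart_inv t d (l$1))"
    by metis
  have "spec_polyfun (\<lambda>t d l. (d$1 * d$2 * d$3 * d$4) ^ K2 * g1 t d l + (d$1 * d$2 * d$3 * d$4) ^ K1 * g2 t d l)"
    by (intro spec_polyfun_intros g)
  then show ?case
    by (intro exI[of _ "K1 + K2"] exI conjI) (assumption, simp add: g power_add algebra_simps)
next
  case (cpolyfun_mult f1 f2)
  then obtain K1 K2 and g1 g2 :: "complex^4 \<Rightarrow> complex^4 \<Rightarrow> complex^1 \<Rightarrow> complex"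
    where g: "spec_polyfun g1" "spec_polyfun g2"
    "\<And>t d l. (\<forall>k. d$k \<noteq> 0) \<Longrightarrow> g1 t d l = (d$1 * d$2 * d$3 * d$4) ^ K1 * f1 (chart_inv t d (l$1))"
    "\<And>t d l. (\<forall>k. d$k \<noteq> 0) \<Longrightarrow> g2 t d l = (d$1 * d$2 * d$3 * d$4) ^ K2 * f2 (chart_inv t d (l$1))"
    by metis
  have "spec_polyfun (\<lambda>t d l. g1 t d l * g2 t d l)"
    by (intro spec_polyfun_intros g)
  then show ?case
    by (intro exI[of _ "K1 + K2"] exI conjI) (assumption, simp add: g power_add algebra_simps)
qed

text \<open>Since \<open>(l + 1)^2 / l = l + 2 + 1 / l\<close>, the relation (BB) together with (CS)
  says that the sum of the \<open>1 / l\<^sub>j\<close> is \<open>16 - 6 - 1 = 9\<close> minus the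
  sum over the traces. Multiplication by the product of the \<open>l\<^sub>j\<close> gives the
  second symmetric function.\<close>

lemma BB_CS_iff:
  assumes l: "\<And>j. l$j \<noteq> 0"
  shows "CS l \<and> BB t d l \<longleftrightarrow> l$1 + l$2 + l$3 = 1 \<and>
    l$1 * l$2 + l$1 * l$3 + l$2 * l$3 = l$1 * l$2 * l$3 * (9 - (\<Sum>k\<in>UNIV. (t$k)^2 / d$k))"
proof -
  have inv: "(l$j + 1)^2 / l$j = l$j + 2 + 1 / l$j" for j
    using l[of j] by (simp add: field_simps power2_eq_square)
  have "l$1 * l$2 + l$1 * l$3 + l$2 * l$3 = l$1 * l$2 * l$3 * (1 / l$1 + 1 / l$2 + 1 / l$3)"
    using l by (simp add: field_simps)
  then have "l$1 * l$2 + l$1 * l$3 + l$2 * l$3 = l$1 * l$2 * l$3 * s \<longleftrightarrow> 1 / l$1 + 1 / l$2 + 1 / l$3 = s" for s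
    using l by simp
  note * = this
  have sums: "(\<Sum>j\<in>UNIV. l$j) = l$1 + l$2 + l$3"
    "(\<Sum>j\<in>UNIV. (l$j + 1)^2 / l$j) = (l$1 + l$2 + l$3) + 6 + (1 / l$1 + 1 / l$2 + 1 / l$3)"
    unfolding sum_3 inv by simp_all
  have "x = 1 \<and> S + (x + 6 + R) = 16 \<longleftrightarrow> x = 1 \<and> R = 9 - S" for x S R :: complex
    by (auto simp: eq_diff_eq add.commute)
  then show ?thesis unfolding CS_def BB_def * sums .
qed

text \<open>\<open>l$1\<close> is a root of the monic cubic with roots \<open>m$1, m$2, m$3\<close>;
  once it is matched, the other two have prescribed sum and product. Repeated values do no harm,
  because indices are permuted.\<close>

lemma symmetric_functions_permutation:
  fixes l m :: "complex^3"
  assumes "l$1 + l$2 + l$3 = m$1 + m$2 + m$3"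
    "l$1 * l$2 + l$1 * l$3 + l$2 * l$3 = m$1 * m$2 + m$1 * m$3 + m$2 * m$3"
    "l$1 * l$2 * l$3 = m$1 * m$2 * m$3"
  obtains \<pi> where "bij \<pi>" "\<And>j. l$j = m $ \<pi> j"
proof -
  note result = that
  have perm: thesis if ne: "i1 \<noteq> i2" "i1 \<noteq> i3" "i2 \<noteq> i3" and "l$1 = m$i1" "l$2 = m$i2" "l$3 = m$i3" for i1 i2 i3
  proof (rule result)
    define \<pi> :: "3 \<Rightarrow> 3" where "\<pi> j = (if j = 1 then i1 else if j = 2 then i2 else i3)" for j
    have "inj \<pi>"
    proof (rule injI)
      fix x y assume "\<pi> x = \<pi> y"
      then show "x = y" using ne exhaust_3[of x] exhaust_3[of y] by (auto simp: \<pi>_def)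
    qed
    then show "bij \<pi>" by (simp add: bij_def finite_UNIV_inj_surj)
    show "l$j = m $ \<pi> j" for j using that exhaust_3[of j] by (auto simp: \<pi>_def)
  qed
  have two: "(l$2 = x \<and> l$3 = y) \<or> (l$2 = y \<and> l$3 = x)" if "l$2 + l$3 = x + y" "l$2 * l$3 = x * y" for x y
  proof -
    have "(l$2 - x) * (l$2 - y) = 0" using that by algebra
    then show ?thesis using that(1) by auto
  qed
  have "(l$1 - m$1) * (l$1 - m$2) * (l$1 - m$3) = 0" using assms by algebra
  then consider "l$1 = m$1" | "l$1 = m$2" | "l$1 = m$3" by auto
  then show thesis
  proof cases
    case 1
    have "l$2 + l$3 = m$2 + m$3" "l$2 * l$3 = m$2 * m$3" using assms(1,2) 1 by algebra+
    from two[OF this] show ?thesis using 1 perm[of 1 2 3] perm[of 1 3 2] by auto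
  next
    case 2
    have "l$2 + l$3 = m$1 + m$3" "l$2 * l$3 = m$1 * m$3" using assms(1,2) 2 by algebra+
    from two[OF this] show ?thesis using 2 perm[of 2 1 3] perm[of 2 3 1] by auto
  next
    case 3
    have "l$2 + l$3 = m$1 + m$2" "l$2 * l$3 = m$1 * m$2" using assms(1,2) 3 by algebra+
    from two[OF this] show ?thesis using 3 perm[of 3 1 2] perm[of 3 2 1] by auto
  qed
qed

text \<open>Applied to the \<lambda>'s, which have sum 1, with \<open>s\<close> and \<open>q\<close>
  their second and third symmetric functions; this explains the coefficient of
  \<open>r^2\<close>.\<close>

lemma monic_cubic_root_bound:
  fixes r :: complex
  assumes "r^3 = r^2 - s * r + q"
  shows "cmod r \<le> 1 + cmod s + cmod q"
proof (cases "cmod r \<le> 1")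
  case False
  then have r: "1 \<le> cmod r" by simp
  have "cmod r ^ 3 = cmod (r^2 - s * r + q)" using assms by (metis norm_power)
  also have "\<dots> \<le> cmod r ^ 2 + cmod s * cmod r + cmod q"
    using norm_triangle_ineq[of "r^2 - s * r" q] norm_triangle_ineq4[of "r^2" "s * r"]
    by (simp add: norm_power norm_mult)
  also have "\<dots> \<le> cmod r ^ 2 * (1 + cmod s + cmod q)"
  proof -
    have "cmod s * cmod r \<le> cmod r ^ 2 * cmod s"
      using r mult_right_mono[of "cmod r" "cmod r ^ 2" "cmod s"] self_le_power[of "cmod r" 2]
      by (simp add: mult.commute)
    moreover have "cmod q \<le> cmod r ^ 2 * cmod q"
      using r mult_right_mono[of 1 "cmod r ^ 2" "cmod q"] by (simp add: one_le_power)
    ultimately show ?thesis by (simp add: algebra_simps)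
  qed
  finally have "cmod r ^ 2 * cmod r \<le> cmod r ^ 2 * (1 + cmod s + cmod q)"
    by (simp add: power2_eq_square power3_eq_cube mult_ac)
  moreover have "0 < cmod r ^ 2" using r by (intro zero_less_power) linarith
  ultimately show ?thesis using mult_le_cancel_left_pos by blast
qed (use norm_ge_zero[of s] norm_ge_zero[of q] in linarith)

lemma spec_eval_tendsto:
  assumes "t \<longlonglongrightarrow> t0" "d \<longlonglongrightarrow> d0" "l \<longlonglongrightarrow> l0"
  shows "(\<lambda>n. spec_eval F (t n) (d n) (l n)) \<longlonglongrightarrow> spec_eval F t0 d0 l0"
  unfolding spec_eval_def
proof (rule mpoly_eval_tendsto)
  fix i :: "'a spec_var"
  show "(\<lambda>n. case i of VarT k \<Rightarrow> t n $ k | VarD k \<Rightarrow> d n $ k | VarL j \<Rightarrow> l n $ j)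
    \<longlonglongrightarrow> (case i of VarT k \<Rightarrow> t0 $ k | VarD k \<Rightarrow> d0 $ k | VarL j \<Rightarrow> l0 $ j)"
    by (cases i) (simp_all add: tendsto_vec_nth assms)
qed

text \<open>The characteristic numbers of the approximating fields stay bounded, and any limit point has
  the same elementary symmetric functions as \<open>l\<close>, hence is a permutation of it.\<close>
lemma limit_of_spectra:
  assumes F: "\<And>v t d l. v \<in> V2 \<Longrightarrow> extended_spectrum v t d l \<Longrightarrow> spec_eval F t d l = 0"
    and nz: "nonzero_dl d l" and cl: "classical_relations t d l"
    and y: "y \<longlonglongrightarrow> x" "\<And>n k. chart_u (y n) $ k \<noteq> 0"
      "\<And>n. realizable (chart_u (y n)) (chart_t (y n)) (y n $ 7)"
    and x: "chart_u x = (\<chi> k. 1 / d$k)" "chart_t x = t" "x$7 = l$1 * l$2 * l$3"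
  shows "spec_eval F t d l = 0"
proof -
  define u where "u n = chart_u (y n)" for n
  define s where "s n = chart_t (y n)" for n
  define S where "S n = u n$1 * (s n$1)^2 + u n$2 * (s n$2)^2 + u n$3 * (s n$3)^2 + u n$4 * (s n$4)^2" for n
  have d: "d$k \<noteq> 0" for k using nz by (simp add: nonzero_dl_def)
  have pf_lim: "(\<lambda>n. f (y n)) \<longlonglongrightarrow> f x" if "cpolyfun f" for f
    using continuous_on_tendsto_compose[OF cpolyfun_continuous[OF that] y(1), of UNIV] by simp
  have ulim: "u \<longlonglongrightarrow> chart_u x"
  proof (rule vec_tendstoI)
    show "(\<lambda>n. u n $ k) \<longlonglongrightarrow> chart_u x $ k" for k
      using cpolyfun_chart[THEN pf_lim] exhaust_4[of k] unfolding u_def by metis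
  qed
  have slim: "s \<longlonglongrightarrow> t"
  proof (rule vec_tendstoI)
    show "(\<lambda>n. s n $ k) \<longlonglongrightarrow> t $ k" for k
      using cpolyfun_chart[THEN pf_lim] exhaust_4[of k] unfolding s_def x(2)[symmetric] by metis
  qed
  have dlim: "(\<lambda>n. \<chi> k. 1 / u n $ k) \<longlonglongrightarrow> d"
  proof (rule vec_tendstoI)
    fix k
    have "(\<lambda>n. 1 / u n $ k) \<longlonglongrightarrow> 1 / chart_u x $ k"
      using d by (intro tendsto_intros tendsto_vec_nth ulim) (simp add: x)
    then show "(\<lambda>n. (\<chi> k. 1 / u n $ k) $ k) \<longlonglongrightarrow> d $ k" by (simp add: x)
  qed
  have Slim: "S \<longlonglongrightarrow> (\<Sum>k\<in>UNIV. (t$k)^2 / d$k)"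
  proof -
    have "S \<longlonglongrightarrow> chart_u x$1 * (t$1)^2 + chart_u x$2 * (t$2)^2 + chart_u x$3 * (t$3)^2 + chart_u x$4 * (t$4)^2"
      unfolding S_def by (intro tendsto_intros tendsto_vec_nth ulim slim)
    then show ?thesis by (simp add: x sum_4)
  qed
  have Llim: "(\<lambda>n. y n $ 7) \<longlonglongrightarrow> x$7" by (intro tendsto_vec_nth y(1))
  \<comment> \<open>The vanishing of \<open>F\<close> is retained for all permutations, since the
    one that matches \<open>l\<close> is known only after passing to the limit.\<close>
  have "\<exists>m :: complex^3. (\<forall>\<pi>. bij \<pi> \<longrightarrow> spec_eval F (s n) (\<chi> k. 1 / u n $ k) (\<chi> j. m $ \<pi> j) = 0) \<and>
      m$1 + m$2 + m$3 = 1 \<and> m$1 * m$2 * m$3 = y n $ 7 \<and>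
      m$1 * m$2 + m$1 * m$3 + m$2 * m$3 = y n $ 7 * (9 - S n)" for n
  proof -
    obtain v and m :: "complex^3" where "v \<in> V2"
      "\<And>\<pi> :: 3 \<Rightarrow> 3. bij \<pi> \<Longrightarrow> extended_spectrum v (s n) (\<chi> k. 1 / u n $ k) (\<chi> j. m $ \<pi> j)"
      "m$1 + m$2 + m$3 = 1" "m$1 * m$2 * m$3 = y n $ 7"
      "m$1 * m$2 + m$1 * m$3 + m$2 * m$3 = y n $ 7 * (9 - S n)"
      using realizable_spectrum[OF y(2) chart_u_relations(4) y(3), of n]
      unfolding u_def[symmetric] s_def[symmetric] S_def[symmetric] by metis
    then show ?thesis using F by blast
  qed
  then obtain m :: "nat \<Rightarrow> complex^3" where
    mF: "\<And>n \<pi>. bij \<pi> \<Longrightarrow> spec_eval F (s n) (\<chi> k. 1 / u n $ k) (\<chi> j. m n $ \<pi> j) = 0"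
    and m1: "\<And>n. m n$1 + m n$2 + m n$3 = 1" and m3: "\<And>n. m n$1 * m n$2 * m n$3 = y n $ 7"
    and m2: "\<And>n. m n$1 * m n$2 + m n$1 * m n$3 + m n$2 * m n$3 = y n $ 7 * (9 - S n)"
    by metis
  have L2lim: "(\<lambda>n. y n $ 7 * (9 - S n)) \<longlonglongrightarrow> x$7 * (9 - (\<Sum>k\<in>UNIV. (t$k)^2 / d$k))"
    by (intro tendsto_intros Llim Slim)
  obtain b2 where b2: "\<And>n. cmod (y n $ 7 * (9 - S n)) \<le> b2"
    using convergent_imp_Bseq[OF convergentI[OF L2lim]] unfolding Bseq_def by blast
  obtain b3 where b3: "\<And>n. cmod (y n $ 7) \<le> b3"
    using convergent_imp_Bseq[OF convergentI[OF Llim]] unfolding Bseq_def by blast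
  have comp: "cmod (m n $ j) \<le> 1 + b2 + b3" for n j
  proof -
    have "(m n $ j)^3 = (m n $ j)^2 - (y n $ 7 * (9 - S n)) * m n $ j + y n $ 7"
      using exhaust_3[of j]
    proof (elim disjE)
      assume j: "j = 1"
      show ?thesis unfolding j unfolding m2[of n, symmetric] unfolding m3[of n, symmetric]
        using m1[of n] by algebra
    next
      assume j: "j = 2"
      show ?thesis unfolding j unfolding m2[of n, symmetric] unfolding m3[of n, symmetric]
        using m1[of n] by algebra
    next
      assume j: "j = 3"
      show ?thesis unfolding j unfolding m2[of n, symmetric] unfolding m3[of n, symmetric]
        using m1[of n] by algebra
    qed
    from monic_cubic_root_bound[OF this] show ?thesis using b2[of n] b3[of n] by linarith
  qed
  have "bounded (range m)"
  proof -
    have "norm (m n) \<le> (\<Sum>j\<in>(UNIV :: 3 set). 1 + b2 + b3)" for n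
    proof -
      have "norm (m n) \<le> (\<Sum>j\<in>UNIV. cmod (m n $ j))"
        unfolding norm_vec_def by (rule L2_set_le_sum) simp
      also have "\<dots> \<le> (\<Sum>j\<in>(UNIV :: 3 set). 1 + b2 + b3)" by (rule sum_mono) (rule comp)
      finally show ?thesis .
    qed
    then show ?thesis by (auto simp: bounded_iff)
  qed
  then obtain M r where r: "strict_mono (r :: nat \<Rightarrow> nat)" and M: "(m \<circ> r) \<longlonglongrightarrow> M"
    using bounded_imp_convergent_subsequence by blast
  have mr: "(\<lambda>n. m (r n) $ j) \<longlonglongrightarrow> M $ j" for j
    using tendsto_vec_nth[OF M] by (simp add: o_def)
  have "M$1 + M$2 + M$3 = 1"
  proof (rule LIMSEQ_unique)
    show "(\<lambda>n. m (r n)$1 + m (r n)$2 + m (r n)$3) \<longlonglongrightarrow> M$1 + M$2 + M$3" by (intro tendsto_intros mr)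
    show "(\<lambda>n. m (r n)$1 + m (r n)$2 + m (r n)$3) \<longlonglongrightarrow> 1" by (simp add: m1)
  qed
  moreover have "M$1 * M$2 * M$3 = x$7"
  proof (rule LIMSEQ_unique)
    show "(\<lambda>n. m (r n)$1 * m (r n)$2 * m (r n)$3) \<longlonglongrightarrow> M$1 * M$2 * M$3" by (intro tendsto_intros mr)
    show "(\<lambda>n. m (r n)$1 * m (r n)$2 * m (r n)$3) \<longlonglongrightarrow> x$7"
      unfolding m3 using LIMSEQ_subseq_LIMSEQ[OF Llim r] by (simp add: o_def)
  qed
  moreover have "M$1 * M$2 + M$1 * M$3 + M$2 * M$3 = x$7 * (9 - (\<Sum>k\<in>UNIV. (t$k)^2 / d$k))"
  proof (rule LIMSEQ_unique)
    show "(\<lambda>n. m (r n)$1 * m (r n)$2 + m (r n)$1 * m (r n)$3 + m (r n)$2 * m (r n)$3)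
      \<longlonglongrightarrow> M$1 * M$2 + M$1 * M$3 + M$2 * M$3" by (intro tendsto_intros mr)
    show "(\<lambda>n. m (r n)$1 * m (r n)$2 + m (r n)$1 * m (r n)$3 + m (r n)$2 * m (r n)$3)
      \<longlonglongrightarrow> x$7 * (9 - (\<Sum>k\<in>UNIV. (t$k)^2 / d$k))"
      unfolding m2 using LIMSEQ_subseq_LIMSEQ[OF L2lim r] by (simp add: o_def)
  qed
  moreover have "l$1 + l$2 + l$3 = 1 \<and>
    l$1 * l$2 + l$1 * l$3 + l$2 * l$3 = l$1 * l$2 * l$3 * (9 - (\<Sum>k\<in>UNIV. (t$k)^2 / d$k))"
    using BB_CS_iff[of l t d] nz cl unfolding nonzero_dl_def classical_relations_def by blast
  ultimately have "l$1 + l$2 + l$3 = M$1 + M$2 + M$3"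
    "l$1 * l$2 + l$1 * l$3 + l$2 * l$3 = M$1 * M$2 + M$1 * M$3 + M$2 * M$3"
    "l$1 * l$2 * l$3 = M$1 * M$2 * M$3"
    unfolding x(3) by argo+
  then obtain \<pi> where \<pi>: "bij \<pi>" "\<And>j. l$j = M $ \<pi> j"
    using symmetric_functions_permutation[of l M] by blast
  have "(\<lambda>n. \<chi> j. m (r n) $ \<pi> j) \<longlonglongrightarrow> l"
    by (rule vec_tendstoI) (simp add: \<pi>(2) mr)
  moreover have "(\<lambda>n. s (r n)) \<longlonglongrightarrow> t" "(\<lambda>n. \<chi> k. 1 / u (r n) $ k) \<longlonglongrightarrow> d"
    using LIMSEQ_subseq_LIMSEQ[OF slim r] LIMSEQ_subseq_LIMSEQ[OF dlim r] by (simp_all add: o_def)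
  ultimately have "(\<lambda>n. spec_eval F (s (r n)) (\<chi> k. 1 / u (r n) $ k) (\<chi> j. m (r n) $ \<pi> j))
    \<longlonglongrightarrow> spec_eval F t d l" by (intro spec_eval_tendsto)
  then show ?thesis unfolding mF[OF \<pi>(1)] using LIMSEQ_unique[OF _ tendsto_const] by metis
qed

theorem theorem1p1:
  shows "\<exists>H :: (1 spec_var, complex) mpoly.
    (\<forall>v\<in>V2. \<forall>t d l. extended_spectrum v t d l \<longrightarrow> eval_Lambda H t d l = 0) \<and>
    (\<exists>t d l. nonzero_dl d l \<and> classical_relations t d l \<and> eval_Lambda H t d l \<noteq> 0) \<and>
    (\<forall>F :: (3 spec_var, complex) mpoly.
       (\<forall>v\<in>V2. \<forall>t d l. extended_spectrum v t d l \<longrightarrow> spec_eval F t d l = 0) \<longrightarrow>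
       (\<forall>t d l. nonzero_dl d l \<and> classical_relations t d l \<and> eval_Lambda H t d l = 0 \<longrightarrow>
          spec_eval F t d l = 0))"
proof -
  obtain h where h: "cpolyfun h"
    "\<And>x. \<forall>k. chart_u x $ k \<noteq> 0 \<Longrightarrow> realizable (chart_u x) (chart_t x) (x$7) \<Longrightarrow> h x = 0"
    "\<And>x U. \<forall>k. chart_u x $ k \<noteq> 0 \<Longrightarrow> x$7 \<noteq> 0 \<Longrightarrow> h x = 0 \<Longrightarrow> open U \<Longrightarrow> x \<in> U \<Longrightarrow>
       \<exists>y\<in>U. (\<forall>k. chart_u y $ k \<noteq> 0) \<and> y$7 \<noteq> 0 \<and> realizable (chart_u y) (chart_t y) (y$7)"
    "\<exists>x. (\<forall>k. chart_u x $ k \<noteq> 0) \<and> x$7 \<noteq> 0 \<and> h x \<noteq> 0"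
    using missing_relation by blast
  obtain K and g :: "complex^4 \<Rightarrow> complex^4 \<Rightarrow> complex^1 \<Rightarrow> complex" where g: "spec_polyfun g"
    "\<And>t d l. (\<forall>k. d$k \<noteq> 0) \<Longrightarrow> g t d l = (d$1 * d$2 * d$3 * d$4) ^ K * h (chart_inv t d (l$1))"
    using clear_denominators[OF h(1)] by blast
  obtain H where H: "\<And>t d l. spec_eval H t d l = g t d l"
    using g(1) unfolding spec_polyfun_def by blast
  have ev: "eval_Lambda H t d l = 0 \<longleftrightarrow> h (chart_inv t d (l$1 * l$2 * l$3)) = 0"
    if "\<forall>k. d$k \<noteq> 0" for t d and l :: "complex^3"
  proof -
    have "(\<Prod>j\<in>UNIV. l $ j) = l$1 * l$2 * l$3" unfolding UNIV_3 by simp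
    then have "eval_Lambda H t d l = (d$1 * d$2 * d$3 * d$4) ^ K * h (chart_inv t d (l$1 * l$2 * l$3))"
      unfolding eval_Lambda_def H g(2)[OF that] by simp
    then show ?thesis using that by simp
  qed
  show ?thesis
  proof (rule exI[of _ H], intro conjI ballI allI impI)
    fix v t d l assume v: "v \<in> V2" and sp: "extended_spectrum v t d l"
    obtain u where u: "\<And>k. u$k \<noteq> 0" "\<And>k. d$k = 1 / u$k" "u$1 + u$2 + u$3 + u$4 = 0"
      "realizable u t (l$1 * l$2 * l$3)"
      using spectrum_realizable[OF v sp] by blast
    have "u$1 * t$1 + u$2 * t$2 + u$3 * t$3 + u$4 * t$4 = 0"
      using u(4) unfolding realizable_def by blast
    then have "EJ1 d" "EJ2 t d"
      using u(3) by (simp_all add: EJ1_def EJ2_def sum_4 u(2) mult.commute)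
    moreover have d: "d$k \<noteq> 0" for k using u by simp
    ultimately have "chart_u (chart_inv t d (l$1 * l$2 * l$3)) = u"
      "chart_t (chart_inv t d (l$1 * l$2 * l$3)) = t"
      using chart_inv_eq[of d t] by (simp_all add: u(2) vec_eq_iff)
    moreover have "chart_inv t d (l$1 * l$2 * l$3) $ 7 = l$1 * l$2 * l$3" by (simp add: chart_inv_def)
    ultimately show "eval_Lambda H t d l = 0"
      using h(2)[of "chart_inv t d (l$1 * l$2 * l$3)"] u ev d by simp
  next
    obtain x where x: "\<forall>k. chart_u x $ k \<noteq> 0" "x$7 \<noteq> 0" "h x \<noteq> 0" using h(4) by blast
    define t where "t = chart_t x"
    define d where "d = (\<chi> k. 1 / chart_u x $ k)"
    define S where "S = (\<Sum>k\<in>UNIV. (t$k)^2 / d$k)"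
    \<comment> \<open>The \<lambda>'s are taken as the roots of
      \<open>X^3 - X^2 + \<Lambda> (9 - S) X - \<Lambda>\<close>, as (CS) and (BB) demand. They are
      nonzero because their product \<open>x $ 7\<close> is.\<close>
    obtain w1 w2 w3 where "- 1 = - 1 * (w1 + w2 + w3)" "x$7 * (9 - S) = 1 * (w1 * w2 + w1 * w3 + w2 * w3)"
      "- (x$7) = - 1 * (w1 * w2 * w3)"
      using cubic_factorization[of 1 "- 1" "x$7 * (9 - S)" "- (x$7)"] one_neq_zero by blast
    then have w: "w1 + w2 + w3 = 1" "w1 * w2 + w1 * w3 + w2 * w3 = x$7 * (9 - S)" "w1 * w2 * w3 = x$7"
      by (metis mult_minus_left mult_1 neg_equal_iff_equal)+
    define l where "l = (vector [w1, w2, w3] :: complex^3)"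
    have l: "l$1 = w1" "l$2 = w2" "l$3 = w3" by (simp_all add: l_def)
    have d0: "\<forall>k. d$k \<noteq> 0" using x(1) by (simp add: d_def)
    have l0: "l$j \<noteq> 0" for j using x(2) w(3) exhaust_3[of j] l by auto
    have "CS l \<and> BB t d l"
      unfolding BB_CS_iff[OF l0] l S_def[symmetric] using w by simp
    moreover have "EJ1 d" "EJ2 t d"
      using chart_u_relations(4)[of x] chart_t_relation[of x]
      by (simp_all add: EJ1_def EJ2_def sum_4 d_def t_def mult.commute)
    moreover have "chart_inv t d (l$1 * l$2 * l$3) = x"
      using chart_inv_chart[of x] x(1) w(3) unfolding t_def d_def l by simp
    ultimately show "\<exists>t d l. nonzero_dl d l \<and> classical_relations t d l \<and> eval_Lambda H t d l \<noteq> 0"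
      using d0 l0 ev[OF d0] x(3) unfolding nonzero_dl_def classical_relations_def by metis
  next
    fix F :: "(3 spec_var, complex) mpoly" and t d :: "complex^4" and l :: "complex^3"
    assume F: "\<forall>v\<in>V2. \<forall>t d l. extended_spectrum v t d l \<longrightarrow> spec_eval F t d l = 0"
      and a: "nonzero_dl d l \<and> classical_relations t d l \<and> eval_Lambda H t d l = 0"
    define x where "x = chart_inv t d (l$1 * l$2 * l$3)"
    have d: "\<forall>k. d$k \<noteq> 0" and l: "\<And>j. l$j \<noteq> 0" using a by (simp_all add: nonzero_dl_def)
    have x: "chart_u x = (\<chi> k. 1 / d$k)" "chart_t x = t" "x$7 = l$1 * l$2 * l$3"
      using a d chart_inv_eq[of d t] unfolding x_def classical_relations_def
      by (simp_all add: chart_inv_def)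
    have hx: "h x = 0" using a ev[OF d] by (simp add: x_def)
    have xu: "\<forall>k. chart_u x $ k \<noteq> 0" and x7: "x$7 \<noteq> 0" using d l by (simp_all add: x)
    \<comment> \<open>Shrinking balls turn the density of realizable points into a sequence
      converging to \<open>x\<close>.\<close>
    have "\<exists>y\<in>ball x (1 / real (Suc n)). (\<forall>k. chart_u y $ k \<noteq> 0) \<and> y$7 \<noteq> 0 \<and> realizable (chart_u y) (chart_t y) (y$7)" for n
      by (rule h(3)[OF xu x7 hx]) simp_all
    then obtain y where y: "\<And>n. y n \<in> ball x (1 / real (Suc n))" "\<And>n. \<forall>k. chart_u (y n) $ k \<noteq> 0"
      "\<And>n. realizable (chart_u (y n)) (chart_t (y n)) (y n $ 7)"
      by metis
    have "(\<lambda>n. y n - x) \<longlonglongrightarrow> 0"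
    proof (rule LIMSEQ_norm_0)
      show "norm (y n - x) < 1 / real (Suc n)" for n
        using y(1)[of n] by (simp add: dist_norm norm_minus_commute)
    qed
    then have "y \<longlonglongrightarrow> x" by (rule LIM_zero_cancel)
    then show "spec_eval F t d l = 0"
      using limit_of_spectra[of F d l t y x] F a y(2,3) x by blast
  qed
qed

end
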